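(* Let $\Phi:T\times\mathbb{R}^n\rightrightarrows\mathbb{R}^m$ be a set-valued normal integrand on a complete finite measure space $(T,\mathcal{A},\mu)$, and let $\bar x\in\operatorname{dom}E_\Phi$. Suppose that there exist $\rho>0$ and $\kappa\in L^1(T,\mathbb{R}_+)$ such that $\Phi_t(x)$ is convex for all $x\in\mathbb{B}_\rho(\bar x)$ and a.e. $t\in T_{na}$, and $\Phi_t(x)\subset\kappa(t)\mathbb{B}$ for all $x\in\mathbb{B}_\rho(\bar x)$ and a.e. $t\in T$. Let $\bar y\in E_\Phi(\bar x)$, $\bar{\mathsf y}\in\mathcal{S}_\Phi(\bar x,\bar y)$, $\bar y^*\in\mathbb{R}^m$, and $\bar x^*\in\hat D^*E_\Phi(\bar x,\bar y)(\bar y^* )$. Then there exist sequences $\{x_k\}\subset\mathbb{R}^n$, $\{\mathsf{x}_k\}\subset L^\infty(T,\mathbb{R}^n)$, $\{\mathsf{x}_k^*\}\subset L^1(T,\mathbb{R}^n)$, $\{\mathsf{y}_k\}\subset L^1(T,\mathbb{R}^m)$, and $\{\mathsf{y}_k^*\}\subset L^\infty(T,\mathbb{R}^m)$ such that: (i) $\mathsf{x}_k^*(t)\in\hat D^*\Phi_t(\mathsf{x}_k(t),\mathsf{y}_k(t))(\mathsf{y}_k^*(t))$ for a.e. $t\in T$ and all $k\in\mathbb{N}$; (ii) $\|\bar x-x_k\|\to0$, $\|\bar x-\mathsf{x}_k\|_\infty\to0$, $\int_T\|\bar{\mathsf y}(t)-\mathsf{y}_k(t)\|d\mu\to0$, and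 $\|\mathsf{y}_k^*-\bar y^*\|_\infty\to0$ as $k\to\infty$; (iii) $\int_T\|\mathsf{x}_k^*(t)\|\cdot\|\mathsf{x}_k(t)-x_k\|d\mu\to0$ and $\int_T\mathsf{x}_k^*(t)d\mu\to\bar x^*$ as $k\to\infty$.
   Context: $\mathbb{R}_+:=\{\alpha\in\mathbb{R}:\alpha>0\}$; $L^p(T,\cdot)$ are the usual Lebesgue spaces; vectors are identified with constant functions; $\mathbb{B}_r(\cdot)$ is the closed ball, $\mathbb{B}$ the closed unit ball. $T=T_{pa}\cup T_{na}$ is the disjoint measurable decomposition of $T$ such that $\mu(\cdot\cap T_{pa})$ is purely atomic and $\mu(\cdot\cap T_{na})$ is nonatomic. For $\Phi:T\times\mathbb{R}^n\rightrightarrows\mathbb{R}^m$ write $\Phi_t:=\Phi(t,\cdot)$. $\Phi$ is a set-valued normal integrand if $\operatorname{gph}\Phi_t$ is closed for all $t\in T$ and $\operatorname{gph}\Phi\in\mathcal{A}\otimes\mathcal{B}(\mathbb{R}^n\times\mathbb{R}^m)$. $E_\Phi(x):=\int_T\Phi_t(x)d\mu=\{\int_T\mathsf{y}\,d\mu:\mathsf{y}\in L^1(T,\mathbb{R}^m),\ \mathsf{y}(t)\in\Phi_t(x)\text{ a.e.}\}$ (Aumann integral). $\mathcal{S}_\Phi(x,y):=\{\mathsf{y}\in L^1(T,\mathbb{R}^m):\int_T\mathsf{y}\,d\mu=y,\ \mathsf{y}(t)\in\Phi_t(x)\text{ for a.e. }t\}$. Regular normal cone: $\hat N(\bar z;\Omega)=\{z^*:\limsup_{z\to\bar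 z,z\in\Omega}\langle z^*,z-\bar z\rangle/\|z-\bar z\|\le0\}$ for $\bar z\in\Omega$, $\emptyset$ otherwise. Regular coderivative at $(x,y)\in\operatorname{gph}G$: $\hat D^*G(x,y)(y^* )=\{x^*:(x^*,-y^* )\in\hat N((x,y);\operatorname{gph}G)\}$. *)

theory Defs
  imports "HOL-Analysis.Analysis" "HOL-Probability.Essential_Supremum"
begin

section \<open>Atomic and nonatomic measures\<close>

definition is_atom :: "'t measure \<Rightarrow> 't set \<Rightarrow> bool" where
  "is_atom M A \<longleftrightarrow> A \<in> sets M \<and> emeasure M A > 0 \<and>
     (\<forall>B\<in>sets M. B \<subseteq> A \<longrightarrow> emeasure M B = 0 \<or> emeasure M (A - B) = 0)"

definition nonatomic :: "'t measure \<Rightarrow> bool" where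
  "nonatomic M \<longleftrightarrow> (\<nexists>A. is_atom M A)"

definition purely_atomic :: "'t measure \<Rightarrow> bool" where
  "purely_atomic M \<longleftrightarrow>
     (\<forall>A\<in>sets M. emeasure M A > 0 \<longrightarrow> (\<exists>B\<subseteq>A. is_atom M B))"

text \<open>The measure \<open>\<mu>(\<cdot> \<inter> S)\<close> on the original \<open>\<sigma>\<close>-algebra is the density of the
  indicator of \<open>S\<close>. The zero measure is both purely atomic and nonatomic, so either part
  of the decomposition may be a null set.\<close>

definition atomic_decomposition :: "'t measure \<Rightarrow> 't set \<Rightarrow> 't set \<Rightarrow> bool" where
  "atomic_decomposition M Tpa Tna \<longleftrightarrow>
     Tpa \<in> sets M \<and> Tna \<in> sets M \<and> Tpa \<inter> Tna = {} \<and> Tpa \<union> Tna = space M \<and>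
     purely_atomic (density M (indicator Tpa)) \<and> nonatomic (density M (indicator Tna))"


section \<open>The Lebesgue space of essentially bounded functions\<close>

text \<open>Elements of Lebesgue spaces are represented by functions; \<open>L\<^sup>1\<close> membership is
  the library's Bochner integrability. The norm below takes values in \<open>ennreal\<close>, so that it
  is \<open>0\<close> (rather than \<open>-\<infinity>\<close>) when the measure vanishes.\<close>

definition Linf_norm :: "'t measure \<Rightarrow> ('t \<Rightarrow> 'b::real_normed_vector) \<Rightarrow> ennreal" where
  "Linf_norm M f = esssup M (\<lambda>t. ennreal (norm (f t)))"

definition Linf :: "'t measure \<Rightarrow> ('t \<Rightarrow> 'b::real_normed_vector) set" where
  "Linf M = {f \<in> borel_measurable M. Linf_norm M f < \<infinity>}"


section \<open>Set-valued mappings and regular coderivatives\<close>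

definition gph :: "('a \<Rightarrow> 'b set) \<Rightarrow> ('a \<times> 'b) set" where
  "gph G = {(x, y). y \<in> G x}"

definition dom_sv :: "('a \<Rightarrow> 'b set) \<Rightarrow> 'a set" where
  "dom_sv G = {x. G x \<noteq> {}}"

text \<open>The upper limit is taken in the extended reals: at an isolated point of \<open>S\<close> it equals
  \<open>-\<infinity>\<close>, so that every vector is normal there.\<close>

definition regular_normal_cone :: "'a::real_inner \<Rightarrow> 'a set \<Rightarrow> 'a set" where
  "regular_normal_cone z S =
     (if z \<in> S
      then {v. Limsup (at z within S) (\<lambda>w. ereal (v \<bullet> (w - z) / norm (w - z))) \<le> 0}
      else {})"

definition regular_coderivative ::
  "('a::real_inner \<Rightarrow> 'b::real_inner set) \<Rightarrow> 'a \<Rightarrow> 'b \<Rightarrow> 'b \<Rightarrow> 'a set" where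
  "regular_coderivative G x y ystar =
     {xstar. (xstar, - ystar) \<in> regular_normal_cone (x, y) (gph G)}"


section \<open>Normal integrands and the Aumann integral\<close>

definition set_valued_normal_integrand ::
  "'t measure \<Rightarrow> ('t \<Rightarrow> real^'n \<Rightarrow> (real^'m) set) \<Rightarrow> bool" where
  "set_valued_normal_integrand M \<Phi> \<longleftrightarrow>
     (\<forall>t\<in>space M. closed (gph (\<Phi> t))) \<and>
     {(t, x, y). t \<in> space M \<and> y \<in> \<Phi> t x} \<in> sets (M \<Otimes>\<^sub>M borel)"

definition aumann_integral :: "'t measure \<Rightarrow> ('t \<Rightarrow> (real^'m) set) \<Rightarrow> (real^'m) set" where
  "aumann_integral M F = {integral\<^sup>L M f | f. integrable M f \<and> (AE t in M. f t \<in> F t)}"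

definition expected_integral ::
  "'t measure \<Rightarrow> ('t \<Rightarrow> real^'n \<Rightarrow> (real^'m) set) \<Rightarrow> real^'n \<Rightarrow> (real^'m) set" where
  "expected_integral M \<Phi> x = aumann_integral M (\<lambda>t. \<Phi> t x)"

definition integral_selections ::
  "'t measure \<Rightarrow> ('t \<Rightarrow> real^'n \<Rightarrow> (real^'m) set) \<Rightarrow> real^'n \<Rightarrow> real^'m \<Rightarrow>
     ('t \<Rightarrow> real^'m) set" where
  "integral_selections M \<Phi> x y =
     {f. integrable M f \<and> integral\<^sup>L M f = y \<and> (AE t in M. f t \<in> \<Phi> t x)}"

end

theory Submission
  imports Defs "HOL-Library.Diagonal_Subsequence"
begin

text \<open>
  A regular normal \<open>(x\<^sup>*, -y\<^sup>*)\<close> to the graph of \<open>E\<^sub>\<Phi>\<close> at \<open>(xbar, ybar)\<close> is supported quadratically: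
  \<open>- \<langle>x\<^sup>*, \<xi>\<rangle> + \<langle>y\<^sup>*, b\<rangle> + C(\<bar>\<xi>\<bar>\<^sup>2 + \<bar>b\<bar>\<^sup>2) \<ge> -\<epsilon>\<^sup>2/C\<close> for \<open>(xbar + \<xi>, ybar + b)\<close> in the graph, where \<open>C\<close>
  may depend on \<open>\<epsilon>\<close>. Decoupling the decision, one minimises this expression with \<open>b = \<integral>(y(t) - ysel(t))\<close>
  and \<open>\<xi>\<close> a weighted mean of \<open>u(t) = x(t) - xbar\<close>, plus \<open>p \<integral>\<kappa>\<bar>u - \<xi>\<bar>\<^sup>2 + \<epsilon> \<integral>\<bar>y - ysel\<bar>\<^sup>2/\<kappa>\<close>, over
  measurable selections of the graphs of \<open>\<Phi>\<^sub>t\<close>. The Borwein--Preiss principle supplies an exact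
  minimiser after a small quadratic perturbation; as the objective is smooth, a measurable selection
  argument turns minimality into the pointwise regular coderivative inclusion. The weight \<open>\<kappa>\<close>
  in the penalty makes \<open>u\<close> uniformly small: replacing \<open>(x(t), y(t))\<close> by \<open>(xbar, ysel(t))\<close> on a set
  changes everything but the penalty by at most a multiple of the \<open>\<kappa>\<close>-measure of that set. As \<open>p \<rightarrow> \<infinity>\<close>,
  limits of \<open>(\<xi>, b)\<close> stay in the graph of \<open>E\<^sub>\<Phi>\<close>, by pointwise convergence of subsequences on the
  atomic part and by convexity and Mazur's lemma on the nonatomic part.
\<close>

section \<open>Measurable selections\<close>

text \<open>Regular normals have no exact sum rule for nonsmooth perturbations, so a nonsmooth
  variational principle would move the inclusion to other points; a quadratic perturbation enters as
  a small vector at the minimiser itself. A minimiser cannot be taken for granted, since bounded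
  selections have only weak limits and the graphs are not convex. The parameters are fixed in the
  order \<open>\<epsilon>\<close>, \<open>C\<close>, \<open>p\<close>, and neither \<open>C\<close>
  nor \<open>p\<close> is bounded as \<open>\<epsilon>\<close> tends to 0. For \<open>C\<close> this
  is harmless because a graph point with nonpositive supported value is so close to the base point
  that \<open>C\<close> times its distance is at most \<open>\<epsilon>\<close>; the gradients of
  the quadratic terms therefore vanish with \<open>\<epsilon>\<close>. For \<open>p\<close>, the
  multiplier contains \<open>2 * p\<close> times \<open>u - \<xi>\<close>, which may be large
  pointwise. Its weighted integral is zero because \<open>\<xi>\<close> is the weighted mean of
  \<open>u\<close>, so the integrated multipliers do not see it; multiplied by
  \<open>norm (u - \<xi>)\<close> it integrates to twice the penalty, which is of order
  \<open>\<epsilon>\<close> squared. These two facts yield both limits in (iii).\<close>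

definition souslin_scheme :: "'x set set \<Rightarrow> (nat \<Rightarrow> (nat \<Rightarrow> nat) \<Rightarrow> 'x set) \<Rightarrow> bool" where
  "souslin_scheme P S \<longleftrightarrow> (\<forall>n \<sigma>. S n \<sigma> \<in> P) \<and>
     (\<forall>n \<sigma>. \<exists>m. \<forall>\<tau>. (\<forall>i<m. \<tau> i = \<sigma> i) \<longrightarrow> S n \<tau> = S n \<sigma>)"

text \<open>This is the Souslin operation. Instead of indexing sets by finite prefixes, a scheme is
  defined on whole sequences and is only required to be locally constant; the determining prefix may
  have any length, so schemes are recoded without bookkeeping of lengths.\<close>

definition souslin :: "'x set set \<Rightarrow> 'x set \<Rightarrow> bool" where
  "souslin P G \<longleftrightarrow> (\<exists>S. souslin_scheme P S \<and> G = (\<Union>\<sigma>. \<Inter>n. S n \<sigma>))"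

lemma souslin_basic: "G \<in> P \<Longrightarrow> souslin P G"
  unfolding souslin_def souslin_scheme_def by (rule exI[of _ "\<lambda>_ _. G"]) auto

text \<open>The coordinate \<open>\<sigma> 0\<close> names the member of the union and the shifted
  sequence serves as its branch, so determining prefixes grow by one.\<close>

lemma souslin_UN:
  fixes G :: "nat \<Rightarrow> 'x set"
  assumes "\<And>i. souslin P (G i)"
  shows "souslin P (\<Union>i. G i)"
proof -
  from assms obtain S where *: "\<And>i. souslin_scheme P (S i)"
    and G: "\<And>i. G i = (\<Union>\<sigma>. \<Inter>n. S i n \<sigma>)"
    unfolding souslin_def by metis
  then have S: "S i n \<sigma> \<in> P" "\<exists>m. \<forall>\<tau>. (\<forall>j<m. \<tau> j = \<sigma> j) \<longrightarrow> S i n \<tau> = S i n \<sigma>" for i n \<sigma>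
    by (auto simp: souslin_scheme_def)
  define S' where "S' n \<sigma> = S (\<sigma> 0) n (\<lambda>j. \<sigma> (Suc j))" for n and \<sigma> :: "nat \<Rightarrow> nat"
  have "\<exists>m. \<forall>\<tau>. (\<forall>j<m. \<tau> j = \<sigma> j) \<longrightarrow> S' n \<tau> = S' n \<sigma>" for n \<sigma>
  proof -
    obtain m where m: "\<forall>\<tau>. (\<forall>j<m. \<tau> j = \<sigma> (Suc j)) \<longrightarrow> S (\<sigma> 0) n \<tau> = S (\<sigma> 0) n (\<lambda>j. \<sigma> (Suc j))"
      using S(2)[of "\<lambda>j. \<sigma> (Suc j)" "\<sigma> 0" n] by auto
    show ?thesis
      by (rule exI[of _ "Suc m"]) (auto simp: S'_def intro!: m[rule_format])
  qed
  moreover have "(\<Union>i. G i) = (\<Union>\<sigma>. \<Inter>n. S' n \<sigma>)"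
  proof (intro equalityI subsetI)
    fix x assume "x \<in> (\<Union>i. G i)"
    then obtain i \<sigma> where *: "\<And>n. x \<in> S i n \<sigma>" by (auto simp: G)
    have "x \<in> (\<Inter>n. S' n (case_nat i \<sigma>))" using * by (auto simp: S'_def)
    then show "x \<in> (\<Union>\<sigma>. \<Inter>n. S' n \<sigma>)" by blast
  qed (auto simp: G S'_def)
  ultimately show ?thesis
    unfolding souslin_def souslin_scheme_def using S(1) by (intro exI[of _ S']) (auto simp: S'_def)
qed

text \<open>A pairing function interleaves countably many branches in one sequence:
  \<open>part i \<sigma>\<close> is the branch used by scheme \<open>i\<close>, and the sets of all
  schemes are enumerated together.\<close>

lemma souslin_INT:
  fixes G :: "nat \<Rightarrow> 'x set"
  assumes "\<And>i. souslin P (G i)"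
  shows "souslin P (\<Inter>i. G i)"
proof -
  from assms obtain S where *: "\<And>i. souslin_scheme P (S i)"
    and G: "\<And>i. G i = (\<Union>\<sigma>. \<Inter>n. S i n \<sigma>)"
    unfolding souslin_def by metis
  then have S: "S i n \<sigma> \<in> P" "\<exists>m. \<forall>\<tau>. (\<forall>j<m. \<tau> j = \<sigma> j) \<longrightarrow> S i n \<tau> = S i n \<sigma>" for i n \<sigma>
    by (auto simp: souslin_scheme_def)
  define part where "part i \<sigma> = (\<lambda>j. \<sigma> (prod_encode (i, j)))" for i and \<sigma> :: "nat \<Rightarrow> nat"
  define S' where "S' k \<sigma> = S (fst (prod_decode k)) (snd (prod_decode k)) (part (fst (prod_decode k)) \<sigma>)"
    for k \<sigma>
  have "\<exists>m. \<forall>\<tau>. (\<forall>j<m. \<tau> j = \<sigma> j) \<longrightarrow> S' k \<tau> = S' k \<sigma>" for k \<sigma>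
  proof -
    define i n where "i = fst (prod_decode k)" and "n = snd (prod_decode k)"
    obtain m where m: "\<forall>\<tau>. (\<forall>j<m. \<tau> j = part i \<sigma> j) \<longrightarrow> S i n \<tau> = S i n (part i \<sigma>)"
      using S(2) by blast
    \<comment> \<open>Branch \<open>i\<close> reads only the coordinates
      \<open>prod_encode (i, j)\<close> with \<open>j < m\<close>, and \<open>m'\<close> lies beyond
      all of them; inserting 0 keeps \<open>Max\<close> meaningful for \<open>m = 0\<close>.\<close>
    define m' where "m' = Suc (Max (insert 0 ((\<lambda>j. prod_encode (i, j)) ` {..<m})))"
    have lt: "prod_encode (i, j) < m'" if "j < m" for j
      unfolding m'_def less_Suc_eq_le using that by (intro Max_ge) auto
    have "S' k \<tau> = S' k \<sigma>" if "\<forall>j<m'. \<tau> j = \<sigma> j" for \<tau>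
      unfolding S'_def i_def[symmetric] n_def[symmetric]
      using that lt by (intro m[rule_format]) (auto simp: part_def)
    then show ?thesis by blast
  qed
  moreover have "(\<Inter>i. G i) = (\<Union>\<sigma>. \<Inter>k. S' k \<sigma>)"
  proof (intro equalityI subsetI)
    fix x assume "x \<in> (\<Inter>i. G i)"
    then have "\<forall>i. \<exists>\<sigma>. \<forall>n. x \<in> S i n \<sigma>" by (auto simp: G)
    then obtain \<sigma> where *: "\<And>i n. x \<in> S i n (\<sigma> i)" by metis
    define \<tau> where "\<tau> k = \<sigma> (fst (prod_decode k)) (snd (prod_decode k))" for k
    have "part i \<tau> = \<sigma> i" for i by (auto simp: part_def \<tau>_def)
    then have "x \<in> (\<Inter>k. S' k \<tau>)" using * by (auto simp: S'_def)
    then show "x \<in> (\<Union>\<sigma>. \<Inter>k. S' k \<sigma>)" by blast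
  next
    fix x assume "x \<in> (\<Union>\<sigma>. \<Inter>k. S' k \<sigma>)"
    then obtain \<sigma> where *: "\<And>k. x \<in> S' k \<sigma>" by blast
    have "x \<in> S i n (part i \<sigma>)" for i n
      using *[of "prod_encode (i, n)"] by (simp add: S'_def)
    then show "x \<in> (\<Inter>i. G i)" by (auto simp: G)
  qed
  ultimately show ?thesis
    unfolding souslin_def souslin_scheme_def using S(1) by (intro exI[of _ S']) (auto simp: S'_def)
qed

abbreviation closed_rectangles :: "'t measure \<Rightarrow> ('t \<times> 'a::topological_space) set set" where
  "closed_rectangles M \<equiv> {A \<times> C | A C. A \<in> sets M \<and> closed C}"

text \<open>Souslin sets need not have Souslin complements, so the induction runs over the sets that
  are Souslin together with their complement; by the two preceding lemmas these form a
  sigma-algebra. Closed second factors are what later yields compact sections.\<close>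

lemma souslin_pair_measure:
  fixes G :: "('t \<times> 'a::euclidean_space) set"
  assumes "G \<in> sets (M \<Otimes>\<^sub>M borel)"
  shows "souslin (closed_rectangles M) G"
proof -
  let ?P = "closed_rectangles M :: ('t \<times> 'a) set set"
  let ?\<Omega> = "space M \<times> (UNIV :: 'a set)"
  define D where "D = {G. G \<subseteq> ?\<Omega> \<and> souslin ?P G \<and> souslin ?P (?\<Omega> - G)}"
  have empty: "{} \<in> D"
    unfolding D_def by (auto intro!: souslin_basic)
  have compl: "?\<Omega> - G \<in> D" if "G \<in> D" for G
    using that by (auto simp: D_def double_diff)
  have union: "(\<Union>i. G i) \<in> D" if "range G \<subseteq> D" for G :: "nat \<Rightarrow> _"
  proof -
    have "?\<Omega> - (\<Union>i. G i) = (\<Inter>i. ?\<Omega> - G i)" by auto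
    moreover have "souslin ?P (\<Union>i. G i)" "souslin ?P (\<Inter>i. ?\<Omega> - G i)"
      using that unfolding D_def by (intro souslin_UN souslin_INT; blast)+
    moreover have "(\<Union>i. G i) \<subseteq> ?\<Omega>" using that by (auto simp: D_def)
    ultimately show ?thesis by (simp add: D_def)
  qed
  interpret D: sigma_algebra ?\<Omega> D
    unfolding sigma_algebra_iff2 using empty compl union by (auto simp: D_def)
  have A: "A \<times> UNIV \<in> D" if "A \<in> sets M" for A
  proof -
    have "?\<Omega> - A \<times> UNIV = (space M - A) \<times> UNIV" by auto
    then show ?thesis using that sets.sets_into_space[OF that] unfolding D_def
      by (auto intro!: souslin_basic)
  qed
  have B: "space M \<times> B \<in> D" if "B \<in> sets borel" for B :: "'a set"
  proof -
    have "B \<in> sigma_sets UNIV (Collect closed)"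
      using that by (simp add: borel_eq_closed)
    then show ?thesis
    proof induction
      case (Basic C)
      then have "closed C" by simp
      \<comment> \<open>An open set is a countable union of closed ones, which makes the complement
        of a closed cylinder Souslin.\<close>
      have "fsigma_in euclidean (- C)"
        using \<open>closed C\<close> by (intro open_imp_fsigma_in metrizable_space_euclidean) auto
      then obtain F :: "nat \<Rightarrow> 'a set" where F: "\<And>n. closed (F n)" "- C = (\<Union>n. F n)"
        unfolding fsigma_in_ascending closed_closedin[symmetric] by metis
      have "?\<Omega> - space M \<times> C = (\<Union>n. space M \<times> F n)" using F(2) by blast
      moreover have "souslin ?P (\<Union>n. space M \<times> F n)"
        using F(1) by (intro souslin_UN souslin_basic) blast
      moreover have "souslin ?P (space M \<times> C)"
        using \<open>closed C\<close> by (intro souslin_basic) blast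
      ultimately show ?case by (auto simp: D_def)
    next
      case Empty then show ?case using empty by simp
    next
      case (Compl a)
      have "space M \<times> (UNIV - a) = ?\<Omega> - space M \<times> a" by auto
      then show ?case using compl[OF Compl.IH] by simp
    next
      case (Union a)
      have "space M \<times> (\<Union>i. a i) = (\<Union>i. space M \<times> a i)" by auto
      then show ?case using union[of "\<lambda>i. space M \<times> a i"] Union.IH by auto
    qed
  qed
  have "A \<times> B \<in> D" if "A \<in> sets M" "B \<in> sets borel" for A and B :: "'a set"
  proof -
    have "A \<times> B = (A \<times> UNIV) \<inter> (space M \<times> B)" using sets.sets_into_space[OF that(1)] by auto
    then show ?thesis using A[OF that(1)] B[OF that(2)] by auto
  qed
  then have "sigma_sets ?\<Omega> {a \<times> b | a b. a \<in> sets M \<and> b \<in> sets (borel :: 'a measure)} \<subseteq> D"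
    by (intro D.sigma_sets_subset) auto
  then have "G \<in> D" using assms by (auto simp: sets_pair_measure)
  then show ?thesis by (simp add: D_def)
qed

section \<open>Compact-valued measurable maps and their selections\<close>

text \<open>Measurability is tested by hitting closed sets, with empty values allowed; the domain of
  the map is then the set where it hits \<open>UNIV\<close>.\<close>

definition compact_measurable :: "'t measure \<Rightarrow> ('t \<Rightarrow> 'a::euclidean_space set) \<Rightarrow> bool" where
  "compact_measurable M H \<longleftrightarrow> (\<forall>t\<in>space M. compact (H t)) \<and>
     (\<forall>C. closed C \<longrightarrow> {t\<in>space M. H t \<inter> C \<noteq> {}} \<in> sets M)"

lemma compact_measurable_domain:
  assumes "compact_measurable M H"
  shows "{t\<in>space M. H t \<noteq> {}} \<in> sets M"
proof -
  have "{t\<in>space M. H t \<inter> UNIV \<noteq> {}} \<in> sets M"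
    using assms closed_UNIV unfolding compact_measurable_def by blast
  then show ?thesis by simp
qed

lemma compact_measurable_rectangle:
  assumes "A \<in> sets M" "compact C"
  shows "compact_measurable M (\<lambda>t. {x. (t, x) \<in> A \<times> C})"
proof -
  have *: "{x. (t, x) \<in> A \<times> C} = (if t \<in> A then C else {})" for t by auto
  have "{t \<in> space M. (if t \<in> A then C else {}) \<inter> X \<noteq> {}} = (if C \<inter> X = {} then {} else A)" for X
    using sets.sets_into_space[OF assms(1)] by auto
  then show ?thesis using assms unfolding compact_measurable_def * by simp
qed

lemma compact_measurable_UN:
  assumes "finite I" "\<And>i. i \<in> I \<Longrightarrow> compact_measurable M (H i)"
  shows "compact_measurable M (\<lambda>t. \<Union>i\<in>I. H i t)"
proof -
  have "{t\<in>space M. (\<Union>i\<in>I. H i t) \<inter> C \<noteq> {}} = (\<Union>i\<in>I. {t\<in>space M. H i t \<inter> C \<noteq> {}})" for C by auto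
  then show ?thesis using assms unfolding compact_measurable_def by auto
qed

text \<open>For decreasing compact values, Cantor's intersection theorem reduces hitting
  \<open>C\<close> by the intersection to hitting \<open>C\<close> by each \<open>H i\<close>, a
  countable condition.\<close>

lemma compact_measurable_INT:
  fixes H :: "nat \<Rightarrow> 't \<Rightarrow> 'a::euclidean_space set"
  assumes H: "\<And>i. compact_measurable M (H i)" and dec: "\<And>i t. H (Suc i) t \<subseteq> H i t"
  shows "compact_measurable M (\<lambda>t. \<Inter>i. H i t)"
proof -
  have dec': "H j t \<subseteq> H i t" if "i \<le> j" for i j t
    using that by (rule lift_Suc_antimono_le[of "\<lambda>i. H i t", OF dec])
  have "(\<Inter>i. H i t) \<inter> C \<noteq> {} \<longleftrightarrow> (\<forall>i. H i t \<inter> C \<noteq> {})" if "closed C" "t \<in> space M" for C t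
  proof
    assume "\<forall>i. H i t \<inter> C \<noteq> {}"
    moreover have "compact (H i t \<inter> C)" for i
      using H[of i] that by (auto simp: compact_measurable_def)
    ultimately have "\<Inter>(range (\<lambda>i. H i t \<inter> C)) \<noteq> {}"
      using dec'[where t=t] by (intro compact_nest) blast+
    then show "(\<Inter>i. H i t) \<inter> C \<noteq> {}" by auto
  qed auto
  then have "{t\<in>space M. (\<Inter>i. H i t) \<inter> C \<noteq> {}} = (\<Inter>i. {t\<in>space M. H i t \<inter> C \<noteq> {}})" if "closed C" for C
    using that by (intro set_eqI) (simp, blast)
  moreover have "compact (\<Inter>i. H i t)" if "t \<in> space M" for t
    using H that by (intro compact_Inter) (auto simp: compact_measurable_def)
  ultimately show ?thesis using H unfolding compact_measurable_def by auto
qed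

text \<open>Whether a minimiser lies in \<open>C\<close> is a countable condition: every rational
  sublevel set of \<open>u\<close> that meets \<open>H t\<close> must meet it inside
  \<open>C\<close>. If the minimum over \<open>H t \<inter> C\<close> were above some value on
  \<open>H t\<close>, a rational level in between would violate this.\<close>

lemma compact_measurable_argmin:
  fixes u :: "'a::euclidean_space \<Rightarrow> real"
  assumes H: "compact_measurable M H" and u: "continuous_on UNIV u"
  shows "compact_measurable M (\<lambda>t. {x \<in> H t. \<forall>y\<in>H t. u x \<le> u y})"
    (is "compact_measurable M ?A")
proof -
  have clq: "closed {x. u x \<le> q}" for q
    using u by (intro closed_Collect_le) auto
  have "compact (?A t)" if "t \<in> space M" for t
  proof -
    have "?A t = H t \<inter> (\<Inter>y\<in>H t. {x. u x \<le> u y})" by auto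
    then show ?thesis using H that clq by (auto simp: compact_measurable_def intro!: compact_Int_closed)
  qed
  moreover have "{t\<in>space M. ?A t \<inter> C \<noteq> {}} \<in> sets M" if C: "closed C" for C
  proof -
    have "?A t \<inter> C \<noteq> {} \<longleftrightarrow> H t \<inter> C \<noteq> {} \<and>
        (\<forall>q. H t \<inter> {x. u x \<le> real_of_rat q} \<noteq> {} \<longrightarrow> H t \<inter> (C \<inter> {x. u x \<le> real_of_rat q}) \<noteq> {})"
      if t: "t \<in> space M" for t
    proof
      assume "?A t \<inter> C \<noteq> {}"
      then obtain x where x: "x \<in> H t" "x \<in> C" "\<forall>y\<in>H t. u x \<le> u y" by auto
      have "x \<in> H t \<inter> (C \<inter> {x. u x \<le> real_of_rat q})" if "H t \<inter> {x. u x \<le> real_of_rat q} \<noteq> {}" for q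
        using x that by (auto intro: order_trans)
      with x show "H t \<inter> C \<noteq> {} \<and>
        (\<forall>q. H t \<inter> {x. u x \<le> real_of_rat q} \<noteq> {} \<longrightarrow> H t \<inter> (C \<inter> {x. u x \<le> real_of_rat q}) \<noteq> {})"
        by blast
    next
      assume *: "H t \<inter> C \<noteq> {} \<and>
        (\<forall>q. H t \<inter> {x. u x \<le> real_of_rat q} \<noteq> {} \<longrightarrow> H t \<inter> (C \<inter> {x. u x \<le> real_of_rat q}) \<noteq> {})"
      have "compact (H t \<inter> C)" using H t C by (auto simp: compact_measurable_def)
      then obtain x where x: "x \<in> H t" "x \<in> C" "\<forall>y\<in>H t \<inter> C. u x \<le> u y"
        using continuous_attains_inf[of "H t \<inter> C" u] * u by (auto intro: continuous_on_subset)
      have "u x \<le> u y" if "y \<in> H t" for y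
      proof (rule ccontr)
        assume "\<not> u x \<le> u y"
        then obtain q where q: "u y < real_of_rat q" "real_of_rat q < u x" using of_rat_dense by (meson not_le)
        then have "H t \<inter> {x. u x \<le> real_of_rat q} \<noteq> {}" using \<open>y \<in> H t\<close> by force
        then obtain x' where "x' \<in> H t" "x' \<in> C" "u x' \<le> real_of_rat q" using * by blast
        then show False using x(3) q(2) by force
      qed
      then show "?A t \<inter> C \<noteq> {}" using x by blast
    qed
    then have eq: "{t\<in>space M. ?A t \<inter> C \<noteq> {}} = {t\<in>space M. H t \<inter> C \<noteq> {} \<and>
        (\<forall>q. H t \<inter> {x. u x \<le> real_of_rat q} \<noteq> {} \<longrightarrow> H t \<inter> (C \<inter> {x. u x \<le> real_of_rat q}) \<noteq> {})}"
      by auto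
    have m: "Measurable.pred M (\<lambda>t. H t \<inter> X \<noteq> {})" if "closed X" for X
      using H that by (auto simp: compact_measurable_def pred_def)
    have "Measurable.pred M (\<lambda>t. H t \<inter> C \<noteq> {} \<and>
        (\<forall>q. H t \<inter> {x. u x \<le> real_of_rat q} \<noteq> {} \<longrightarrow> H t \<inter> (C \<inter> {x. u x \<le> real_of_rat q}) \<noteq> {}))"
    proof (rule pred_intros_logic(3))
      show "Measurable.pred M (\<lambda>t. \<forall>q. H t \<inter> {x. u x \<le> real_of_rat q} \<noteq> {} \<longrightarrow> H t \<inter> (C \<inter> {x. u x \<le> real_of_rat q}) \<noteq> {})"
        by (intro pred_intros_countable(1) pred_intros_logic(4) m clq closed_Int C)
    qed (rule m[OF C])
    then show ?thesis unfolding eq pred_def .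
  qed
  ultimately show ?thesis unfolding compact_measurable_def by auto
qed

text \<open>A lexicographic minimum is obtained by minimising the coordinates one after the other.\<close>

lemma compact_measurable_selection:
  fixes H :: "'t \<Rightarrow> 'a::euclidean_space set"
  assumes H: "compact_measurable M H"
  obtains f where "f \<in> borel_measurable M" "\<And>t. t \<in> space M \<Longrightarrow> H t \<noteq> {} \<Longrightarrow> f t \<in> H t"
proof -
  have "\<exists>H'. compact_measurable M H' \<and> (\<forall>t\<in>space M. H' t \<subseteq> H t \<and> (H t \<noteq> {} \<longrightarrow> H' t \<noteq> {}) \<and>
      (\<forall>x\<in>H' t. \<forall>y\<in>H' t. \<forall>b\<in>B. x \<bullet> b = y \<bullet> b))" if "finite B" for B :: "'a set"
    using that
  proof induction
    case empty
    then show ?case using H by (intro exI[of _ H]) auto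
  next
    case (insert b B)
    then obtain H' where H': "compact_measurable M H'"
      "\<And>t. t \<in> space M \<Longrightarrow> H' t \<subseteq> H t" "\<And>t. t \<in> space M \<Longrightarrow> H t \<noteq> {} \<Longrightarrow> H' t \<noteq> {}"
      "\<And>t x y b. t \<in> space M \<Longrightarrow> x \<in> H' t \<Longrightarrow> y \<in> H' t \<Longrightarrow> b \<in> B \<Longrightarrow> x \<bullet> b = y \<bullet> b"
      by metis
    let ?A = "\<lambda>t. {x \<in> H' t. \<forall>y\<in>H' t. x \<bullet> b \<le> y \<bullet> b}"
    have "?A t \<noteq> {}" if "t \<in> space M" "H t \<noteq> {}" for t
    proof -
      have "compact (H' t)" using H'(1) that by (auto simp: compact_measurable_def)
      then show ?thesis
        using continuous_attains_inf[of "H' t" "\<lambda>x. x \<bullet> b"] H'(3)[OF that] by (force intro: continuous_intros)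
    qed
    moreover have "compact_measurable M ?A"
      by (intro compact_measurable_argmin H' continuous_intros)
    ultimately show ?case using H'(2,4) 
      by (intro exI[of _ ?A]) (auto intro: antisym)
  qed
  from this[OF finite_Basis] obtain H' where H': "compact_measurable M H'"
    and *: "\<forall>t\<in>space M. H' t \<subseteq> H t \<and> (H t \<noteq> {} \<longrightarrow> H' t \<noteq> {}) \<and>
      (\<forall>x\<in>H' t. \<forall>y\<in>H' t. \<forall>b\<in>Basis. x \<bullet> b = y \<bullet> b)"
    by (elim exE conjE) (rule that)
  have unique: "x = y" if "t \<in> space M" "x \<in> H' t" "y \<in> H' t" for t x y
  proof (rule euclidean_eqI)
    fix b :: 'a assume "b \<in> Basis"
    have "\<forall>x\<in>H' t. \<forall>y\<in>H' t. \<forall>b\<in>Basis. x \<bullet> b = y \<bullet> b"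
      using bspec[OF * that(1)] by (elim conjE)
    from bspec[OF bspec[OF bspec[OF this that(2)] that(3)] \<open>b \<in> Basis\<close>]
    show "x \<bullet> b = y \<bullet> b" .
  qed
  \<comment> \<open>The default value 0 on empty \<open>H' t\<close> causes the extra set in the
    preimage of a closed set containing 0.\<close>
  define f where "f t = (if H' t = {} then 0 else SOME x. x \<in> H' t)" for t
  have f: "f t \<in> H' t" if "H' t \<noteq> {}" for t
    using that by (auto simp: f_def intro: someI)
  have "f \<in> borel_measurable M"
    unfolding borel_eq_closed
  proof (rule measurable_measure_of)
    fix C :: "'a set" assume "C \<in> Collect closed"
    then have "{t\<in>space M. H' t \<inter> C \<noteq> {}} \<in> sets M" "{t\<in>space M. H' t \<inter> UNIV \<noteq> {}} \<in> sets M"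
      using H' closed_UNIV unfolding compact_measurable_def by blast+
    moreover have "f -` C \<inter> space M = {t\<in>space M. H' t \<inter> C \<noteq> {}} \<union>
        (if 0 \<in> C then space M - {t\<in>space M. H' t \<inter> UNIV \<noteq> {}} else {})"
    proof -
      have "f t \<in> C \<longleftrightarrow> H' t \<inter> C \<noteq> {} \<or> 0 \<in> C \<and> H' t = {}" if "t \<in> space M" for t
        using f[of t] unique[OF that] by (cases "H' t = {}") (auto simp: f_def)
      then show ?thesis by auto
    qed
    ultimately show "f -` C \<inter> space M \<in> sets M" by auto
  qed auto
  then show thesis using that f * by blast
qed


section \<open>Capacitability and selections on nonnull sets\<close>

text \<open>This is compactness of the product of the finite sets \<open>{..k i}\<close>: the
  pigeonhole principle gives nested infinite index sets \<open>J m\<close> on which the first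
  \<open>m\<close> coordinates are constant, and \<open>\<sigma>\<close> collects the constants. It
  is a cluster point, in general not a limit.\<close>

lemma infinite_diagonal_branch:
  fixes s :: "nat \<Rightarrow> nat \<Rightarrow> nat"
  assumes bound: "\<And>j i. s j i \<le> k i"
  obtains \<sigma> where "\<And>m m'. \<exists>j\<ge>m'. \<forall>i<m. s j i = \<sigma> i"
proof -
  have "\<exists>J. \<forall>m. (infinite (J m) \<and> (\<forall>i<m. \<exists>c. \<forall>j\<in>J m. s j i = c)) \<and> J (Suc m) \<subseteq> J m"
  proof (rule dependent_nat_choice)
    fix J :: "nat set" and m
    assume J: "infinite J \<and> (\<forall>i<m. \<exists>c. \<forall>j\<in>J. s j i = c)"
    have "finite ((\<lambda>j. s j m) ` J)"
      by (rule finite_subset[of _ "{..k m}"]) (use bound in blast, simp)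
    then obtain j0 where "infinite {j\<in>J. s j m = s j0 m}"
      using pigeonhole_infinite[of J "\<lambda>j. s j m"] J by blast
    moreover have "\<exists>c. \<forall>j\<in>{j\<in>J. s j m = s j0 m}. s j i = c" if "i < Suc m" for i
      using J that by (cases "i = m") (auto, metis less_SucE)
    ultimately show "\<exists>J'. (infinite J' \<and> (\<forall>i<Suc m. \<exists>c. \<forall>j\<in>J'. s j i = c)) \<and> J' \<subseteq> J"
      by (intro exI[of _ "{j\<in>J. s j m = s j0 m}"]) simp
  qed (auto intro!: exI[of _ UNIV])
  then obtain J where J: "\<And>m. infinite (J m)" "\<And>m i. i < m \<Longrightarrow> \<exists>c. \<forall>j\<in>J m. s j i = c"
    "\<And>m. J (Suc m) \<subseteq> J m" by blast
  have sub: "J m \<subseteq> J n" if "n \<le> m" for n m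
    using that by (rule lift_Suc_antimono_le[of J, OF J(3)])
  from J(2)[of _ "Suc _"] have "\<forall>i. \<exists>c. \<forall>j\<in>J (Suc i). s j i = c" by blast
  then obtain \<sigma> where \<sigma>: "\<And>i j. j \<in> J (Suc i) \<Longrightarrow> s j i = \<sigma> i" by metis
  have "\<exists>j\<ge>m'. \<forall>i<m. s j i = \<sigma> i" for m m'
  proof -
    obtain j where "j \<in> J m" "j \<ge> m'"
      using J(1)[of m] by (meson finite_nat_set_iff_bounded not_le)
    then show ?thesis using \<sigma> sub[of "Suc _" m] by (meson Suc_leI subsetD)
  qed
  then show thesis using that by blast
qed

text \<open>Choquet's capacitability argument: bounding the branches of the Souslin scheme
  coordinate by coordinate costs an arbitrarily small amount of outer measure, and by
  compactness the bounded part of the scheme is a decreasing intersection of finite unions of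
  rectangles with compact sections.\<close>

lemma compact_measurable_subset_of_measurable_graph:
  fixes G :: "('t \<times> 'a::euclidean_space) set"
  assumes fin: "finite_measure M" and G: "G \<in> sets (M \<Otimes>\<^sub>M borel)"
    and K: "compact K" "G \<subseteq> UNIV \<times> K"
    and pos: "\<not> (AE t in M. \<forall>x. (t, x) \<notin> G)"
  obtains H where "compact_measurable M H" "\<And>t x. t \<in> space M \<Longrightarrow> x \<in> H t \<Longrightarrow> (t, x) \<in> G"
    "emeasure M {t\<in>space M. H t \<noteq> {}} > 0"
proof -
  have GM: "fst ` G \<subseteq> space M"
    using sets.sets_into_space[OF G] by (auto simp: space_pair_measure)
  obtain S where "souslin_scheme (closed_rectangles M) S" and GS: "G = (\<Union>\<sigma>. \<Inter>n. S n \<sigma>)"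
    using souslin_pair_measure[OF G] unfolding souslin_def by blast
  then have S: "S n \<sigma> \<in> closed_rectangles M"
    "\<exists>m. \<forall>\<tau>. (\<forall>i<m. \<tau> i = \<sigma> i) \<longrightarrow> S n \<tau> = S n \<sigma>" for n \<sigma>
    unfolding souslin_scheme_def by blast+
  define R where "R B = (\<Union>\<sigma>\<in>B. \<Inter>n. S n \<sigma>)" for B
  have RG: "R B \<subseteq> G" for B by (auto simp: R_def GS)
  \<comment> \<open>Projections are not known to be measurable, hence the outer measure; the
    construction uses its continuity along increasing sequences of sets.\<close>
  define \<mu> where "\<mu> B = outer_measure_of M (fst ` R B)" for B
  have "\<mu> UNIV > 0"
  proof (rule ccontr)
    assume "\<not> \<mu> UNIV > 0"
    then have "outer_measure_of M (fst ` G) = 0" by (simp add: \<mu>_def R_def GS)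
    then obtain E where "E \<in> sets M" "fst ` G \<subseteq> E" "emeasure M E = 0"
      using outer_measure_of_attain[OF GM] by auto
    then have "AE t in M. \<forall>x. (t, x) \<notin> G"
      by (intro AE_I[of _ _ E]) force+
    with pos show False by simp
  qed
  then obtain a where a: "0 < a" "a < \<mu> UNIV" using dense by blast
  \<comment> \<open>As the bound on coordinate \<open>m\<close> grows, the bounded branches exhaust
    \<open>B m\<close>, so some bound keeps the outer measure above \<open>a\<close>; the level
    \<open>a\<close> is the same at every stage.\<close>
  have "\<exists>B. \<forall>m. \<mu> (B m) > a \<and> (m = 0 \<longrightarrow> B m = UNIV) \<and> (\<exists>k. B (Suc m) = B m \<inter> {\<sigma>. \<sigma> m \<le> k})"
  proof -
    have "\<exists>B. \<forall>m. (\<mu> (B m) > a \<and> (m = 0 \<longrightarrow> B m = UNIV)) \<and> (\<exists>k. B (Suc m) = B m \<inter> {\<sigma>. \<sigma> m \<le> k})"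
    proof (rule dependent_nat_choice)
      fix B :: "(nat \<Rightarrow> nat) set" and m :: nat
      assume B: "a < \<mu> B \<and> (m = 0 \<longrightarrow> B = UNIV)"
      have "(\<Union>k. fst ` R (B \<inter> {\<sigma>. \<sigma> m \<le> k})) = fst ` R B"
      proof -
        have "(\<Union>k. B \<inter> {\<sigma>. \<sigma> m \<le> k}) = B" by auto
        then show ?thesis unfolding R_def image_UN[symmetric] UN_UN_flatten[symmetric] by simp
      qed
      moreover have "incseq (\<lambda>k. fst ` R (B \<inter> {\<sigma>. \<sigma> m \<le> k}))"
        unfolding incseq_def R_def by (intro allI impI image_mono UN_mono) auto
      moreover have "fst ` R B' \<subseteq> space M" for B'
        using image_mono[OF RG] GM by (rule order_trans)
      ultimately have "(SUP k. \<mu> (B \<inter> {\<sigma>. \<sigma> m \<le> k})) = \<mu> B"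
        using SUP_outer_measure_of_incseq[of "\<lambda>k. fst ` R (B \<inter> {\<sigma>. \<sigma> m \<le> k})" M] by (simp add: \<mu>_def)
      then obtain k where "a < \<mu> (B \<inter> {\<sigma>. \<sigma> m \<le> k})" using B less_SUP_iff[of a "\<lambda>k. \<mu> (B \<inter> {\<sigma>. \<sigma> m \<le> k})" UNIV] by auto
      then show "\<exists>B'. (a < \<mu> B' \<and> (Suc m = 0 \<longrightarrow> B' = UNIV)) \<and> (\<exists>k. B' = B \<inter> {\<sigma>. \<sigma> m \<le> k})"
        by blast
    qed (use a in auto)
    then show ?thesis by blast
  qed
  then obtain B where B: "\<And>m. \<mu> (B m) > a" "B 0 = UNIV" "\<And>m. \<exists>k. B (Suc m) = B m \<inter> {\<sigma>. \<sigma> m \<le> k}"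
    by blast
  then obtain k where k: "\<And>m. B (Suc m) = B m \<inter> {\<sigma>. \<sigma> m \<le> k m}" by metis
  have Bk: "B m = {\<sigma>. \<forall>i<m. \<sigma> i \<le> k i}" for m
    by (induction m) (auto simp: B(2) k less_Suc_eq)

  define dt where "dt n \<sigma> m \<longleftrightarrow> (\<forall>\<tau>. (\<forall>i<m. \<tau> i = \<sigma> i) \<longrightarrow> S n \<tau> = S n \<sigma>)" for n \<sigma> m
  \<comment> \<open>Only the sets already determined by the prefix of length \<open>m\<close> are
    intersected, so \<open>T m \<sigma>\<close> depends on that prefix alone and takes finitely many
    values on \<open>B m\<close>. The factor \<open>space M \<times> K\<close> makes the sections
    compact and covers the case in which no set is determined yet.\<close>
  define T where "T m \<sigma> = (space M \<times> K) \<inter> (\<Inter>n\<in>{n. n < m \<and> dt n \<sigma> m}. S n \<sigma>)" for m \<sigma>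
  define trunc where "trunc m \<sigma> = (\<lambda>i. if i < m then \<sigma> i else 0)" for m and \<sigma> :: "nat \<Rightarrow> nat"
  define H where "H m t = (\<Union>\<sigma>\<in>B m. {x. (t, x) \<in> T m \<sigma>})" for m t
  have T_cong: "T m \<sigma> = T m \<tau>" if "\<forall>i<m. \<tau> i = \<sigma> i" for m \<sigma> \<tau>
  proof -
    have dtD: "dt n \<tau> m \<and> S n \<tau> = S n \<sigma>"
      if agree: "\<And>i. i < m \<Longrightarrow> \<tau> i = \<sigma> i" and "dt n \<sigma> m" for n and \<sigma> \<tau> :: "nat \<Rightarrow> nat"
    proof -
      have "S n \<upsilon> = S n \<sigma>" if "\<forall>i<m. \<upsilon> i = \<tau> i" for \<upsilon>
      proof (rule \<open>dt n \<sigma> m\<close>[unfolded dt_def, rule_format])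
        fix i assume "i < m"
        then show "\<upsilon> i = \<sigma> i" using that agree[of i] by metis
      qed
      then have *: "\<forall>\<upsilon>. (\<forall>i<m. \<upsilon> i = \<tau> i) \<longrightarrow> S n \<upsilon> = S n \<sigma>" by blast
      then have "S n \<tau> = S n \<sigma>" by blast
      with * show ?thesis unfolding dt_def by metis
    qed
    have S_eq: "dt n \<sigma> m \<longleftrightarrow> dt n \<tau> m" "dt n \<tau> m \<Longrightarrow> S n \<sigma> = S n \<tau>" for n
      using dtD[of \<tau> \<sigma> n] dtD[of \<sigma> \<tau> n] that by auto
    then show ?thesis unfolding T_def S_eq(1) by (intro arg_cong2[of _ _ _ _ "(\<inter>)"] INF_cong) auto
  qed
  have H_fin: "H m t = (\<Union>\<sigma>\<in>trunc m ` B m. {x. (t, x) \<in> T m \<sigma>})" for m t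
  proof -
    have "T m (trunc m \<sigma>) = T m \<sigma>" for \<sigma> by (rule T_cong) (auto simp: trunc_def)
    then show ?thesis by (simp add: H_def)
  qed
  have finB: "finite (trunc m ` B m)" for m
  proof (rule finite_subset)
    show "finite {f. \<forall>x. (x \<in> {..<m} \<longrightarrow> f x \<in> {..Max (k ` {..<m})}) \<and> (x \<notin> {..<m} \<longrightarrow> f x = (0::nat))}"
      by (rule finite_set_of_finite_funs) auto
    show "trunc m ` B m \<subseteq> \<dots>"
    proof (rule image_subsetI, rule CollectI, intro allI conjI impI)
      fix \<sigma> i assume "\<sigma> \<in> B m" "i \<in> {..<m}"
      then have "trunc m \<sigma> i \<le> k i" "k i \<le> Max (k ` {..<m})" by (auto simp: Bk trunc_def)
      then show "trunc m \<sigma> i \<in> {..Max (k ` {..<m})}" by simp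
    qed (simp add: trunc_def)
  qed
  have T_rect: "\<exists>A C. A \<in> sets M \<and> compact C \<and> T m \<sigma> = A \<times> C" for m \<sigma>
  proof -
    obtain A C where AC: "\<And>n. A n \<in> sets M" "\<And>n. closed (C n)" "\<And>n. S n \<sigma> = A n \<times> C n"
      using S(1)[of _ \<sigma>] by (simp only: mem_Collect_eq) metis
    let ?I = "{n. n < m \<and> dt n \<sigma> m}"
    have "T m \<sigma> = (space M \<inter> (\<Inter>n\<in>?I. A n)) \<times> (K \<inter> (\<Inter>n\<in>?I. C n))"
      unfolding T_def AC(3) by auto
    moreover have "compact (K \<inter> (\<Inter>n\<in>?I. C n))" using K(1) AC(2) by auto
    moreover have "space M \<inter> (\<Inter>n\<in>?I. A n) \<in> sets M"
      using AC(1) by (cases "?I = {}") (auto intro!: sets.Int sets.finite_INT)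
    ultimately show ?thesis by blast
  qed
  have cm: "compact_measurable M (H m)" for m
  proof -
    have "compact_measurable M (\<lambda>t. {x. (t, x) \<in> T m \<sigma>})" for \<sigma>
    proof -
      obtain A C where AC: "A \<in> sets M" "compact C" "T m \<sigma> = A \<times> C" using T_rect by blast
      show ?thesis unfolding AC(3) by (rule compact_measurable_rectangle[OF AC(1,2)])
    qed
    then have "compact_measurable M (\<lambda>t. \<Union>\<sigma>\<in>trunc m ` B m. {x. (t, x) \<in> T m \<sigma>})"
      by (rule compact_measurable_UN[OF finB])
    then show ?thesis by (simp add: H_fin[abs_def])
  qed
  have dec: "H (Suc m) t \<subseteq> H m t" for m t
  proof -
    have "dt n \<sigma> (Suc m)" if "dt n \<sigma> m" for n \<sigma>
      using that less_SucI unfolding dt_def by metis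
    then have "T (Suc m) \<sigma> \<subseteq> T m \<sigma>" for \<sigma> by (auto simp: T_def)
    then show ?thesis unfolding H_def k by blast
  qed
  \<comment> \<open>A point surviving at all levels may use a different branch at each level. These
    branches are bounded by \<open>k\<close>, so they have a cluster branch, and each
    \<open>S n\<close> at the cluster branch is determined by a prefix shared with some late
    level.\<close>
  have HG: "(t, x) \<in> G" if tx: "x \<in> (\<Inter>m. H m t)" for t x
  proof -
    have "\<forall>m. \<exists>\<sigma>. \<sigma> \<in> B m \<and> (t, x) \<in> T m \<sigma>" using tx by (auto simp: H_def)
    then obtain s where s: "\<And>m. s m \<in> B m" "\<And>m. (t, x) \<in> T m (s m)" by metis
    define s' where "s' m = trunc m (s m)" for m
    have s': "s' m i \<le> k i" "(t, x) \<in> T m (s' m)" for m i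
      using s T_cong[of m "s' m" "s m"] by (auto simp: s'_def trunc_def Bk)
    obtain \<sigma> where \<sigma>: "\<And>m m'. \<exists>j\<ge>m'. \<forall>i<m. s' j i = \<sigma> i"
      using infinite_diagonal_branch[of s' k] s'(1) by blast
    have "(t, x) \<in> S n \<sigma>" for n
    proof -
      obtain m where m: "\<forall>\<tau>. (\<forall>i<m. \<tau> i = \<sigma> i) \<longrightarrow> S n \<tau> = S n \<sigma>" using S(2) by blast
      \<comment> \<open>\<open>Suc n\<close> ensures \<open>n < j\<close>, so that
        \<open>S n\<close> takes part in \<open>T j\<close>; \<open>m\<close> ensures that it is
        determined there.\<close>
      obtain j where j: "j \<ge> max m (Suc n)" "\<forall>i<m. s' j i = \<sigma> i" using \<sigma> by blast
      have eq: "S n (s' j) = S n \<sigma>" using m j by blast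
      have "dt n (s' j) j"
        unfolding dt_def eq
      proof (intro allI impI)
        fix \<tau> assume \<tau>: "\<forall>i<j. \<tau> i = s' j i"
        show "S n \<tau> = S n \<sigma>"
        proof (rule m[rule_format])
          fix i assume "i < m"
          then show "\<tau> i = \<sigma> i" using \<tau> j by (metis less_le_trans max.bounded_iff)
        qed
      qed
      then have "(t, x) \<in> S n (s' j)" using s'(2)[of j] j(1) by (auto simp: T_def)
      then show ?thesis using eq by simp
    qed
    then show ?thesis by (auto simp: GS)
  qed
  have RH: "fst ` R (B m) \<subseteq> {t\<in>space M. H m t \<noteq> {}}" for m
  proof
    fix t assume "t \<in> fst ` R (B m)"
    then obtain x \<sigma> where *: "\<sigma> \<in> B m" "\<forall>n. (t, x) \<in> S n \<sigma>" by (auto simp: R_def)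
    then have "(t, x) \<in> G" by (auto simp: GS)
    then have "(t, x) \<in> T m \<sigma>" using * K(2) GM by (force simp: T_def)
    then show "t \<in> {t\<in>space M. H m t \<noteq> {}}" using *(1) by (auto simp: H_def T_def)
  qed
  have meas: "{t\<in>space M. H m t \<noteq> {}} \<in> sets M" for m
    by (rule compact_measurable_domain[OF cm])
  have "{t\<in>space M. (\<Inter>m. H m t) \<noteq> {}} = (\<Inter>m. {t\<in>space M. H m t \<noteq> {}})"
  proof -
    have "(\<Inter>m. H m t) \<noteq> {}" if "t \<in> space M" "\<And>m. H m t \<noteq> {}" for t
      using compact_nest[of "\<lambda>m. H m t"] that cm lift_Suc_antimono_le[of "\<lambda>m. H m t", OF dec]
      by (auto simp: compact_measurable_def)
    then show ?thesis by auto
  qed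
  \<comment> \<open>The domains decrease and the measure is finite, so the lower bound
    \<open>a\<close> passes to their intersection.\<close>
  moreover have "emeasure M (\<Inter>m. {t\<in>space M. H m t \<noteq> {}}) \<ge> a"
  proof -
    have "a \<le> emeasure M {t\<in>space M. H m t \<noteq> {}}" for m
      using B(1)[of m] outer_measure_of_mono[OF RH, of M m] meas[of m]
      unfolding \<mu>_def by (auto intro: less_imp_le order_less_le_trans)
    moreover have "emeasure M (\<Inter>m. {t\<in>space M. H m t \<noteq> {}}) = (INF m. emeasure M {t\<in>space M. H m t \<noteq> {}})"
      using meas dec finite_measure.emeasure_finite[OF fin]
      by (intro INF_emeasure_decseq[symmetric]) (auto intro!: decseq_SucI simp: less_top[symmetric] dest: subsetD, blast)
    ultimately show ?thesis by (auto intro: INF_greatest)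
  qed
  ultimately have "emeasure M {t\<in>space M. (\<Inter>m. H m t) \<noteq> {}} > 0" using a by simp
  then show thesis
    using that[of "\<lambda>t. \<Inter>m. H m t"] compact_measurable_INT[of M H, OF cm dec] HG by blast
qed

text \<open>An almost everywhere statement is refuted by a selection of counterexamples on some
  nonnull set; asking for no more avoids the measurability of the projection of
  \<open>G\<close>.\<close>

lemma measurable_selection_on_nonnull:
  fixes G :: "('t \<times> 'a::euclidean_space) set"
  assumes "finite_measure M" "G \<in> sets (M \<Otimes>\<^sub>M borel)"
    and "compact K" "G \<subseteq> UNIV \<times> K"
    and "\<not> (AE t in M. \<forall>x. (t, x) \<notin> G)"
  obtains A f where "A \<in> sets M" "emeasure M A > 0" "f \<in> borel_measurable M"
    "\<And>t. t \<in> A \<Longrightarrow> (t, f t) \<in> G"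
proof -
  obtain H where H: "compact_measurable M H" "\<And>t x. t \<in> space M \<Longrightarrow> x \<in> H t \<Longrightarrow> (t, x) \<in> G"
    "emeasure M {t\<in>space M. H t \<noteq> {}} > 0"
    by (rule compact_measurable_subset_of_measurable_graph[OF assms]) (rule that; assumption)
  obtain f where f: "f \<in> borel_measurable M" "\<And>t. t \<in> space M \<Longrightarrow> H t \<noteq> {} \<Longrightarrow> f t \<in> H t"
    by (rule compact_measurable_selection[OF H(1)]) (rule that; assumption)
  have "{t\<in>space M. H t \<noteq> {}} \<in> sets M"
    by (rule compact_measurable_domain[OF H(1)])
  from this H(3) f(1) show thesis
  proof (rule that)
    fix t assume "t \<in> {t\<in>space M. H t \<noteq> {}}"
    then show "(t, f t) \<in> G" using H(2) f(2) by simp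
  qed
qed

section \<open>Regular normals and a smooth variational principle\<close>

text \<open>The limit superior ignores \<open>w = z\<close>, where the product form reads
  \<open>0 \<le> 0\<close>, so the quotient can be cleared. Isolated points satisfy both forms
  trivially.\<close>

lemma regular_normal_cone_iff:
  "v \<in> regular_normal_cone z S \<longleftrightarrow> z \<in> S \<and>
     (\<forall>e>0. \<exists>d>0. \<forall>w\<in>S. norm (w - z) < d \<longrightarrow> v \<bullet> (w - z) \<le> e * norm (w - z))"
proof -
  have "Limsup (at z within S) (\<lambda>w. ereal (v \<bullet> (w - z) / norm (w - z))) \<le> 0 \<longleftrightarrow>
     (\<forall>e>0. \<exists>d>0. \<forall>w\<in>S. norm (w - z) < d \<longrightarrow> v \<bullet> (w - z) \<le> e * norm (w - z))"
    (is "?L \<longleftrightarrow> ?R")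
  proof
    assume ?L
    show ?R
    proof (intro allI impI)
      fix e :: real assume "e > 0"
      with \<open>?L\<close> have "eventually (\<lambda>w. ereal (v \<bullet> (w - z) / norm (w - z)) < ereal e) (at z within S)"
        unfolding Limsup_le_iff by (metis ereal_less(2))
      then obtain d where d: "d > 0"
        "\<And>w. w \<in> S \<Longrightarrow> w \<noteq> z \<Longrightarrow> norm (w - z) < d \<Longrightarrow> v \<bullet> (w - z) / norm (w - z) < e"
        unfolding eventually_at by (auto simp: dist_norm)
      have "v \<bullet> (w - z) \<le> e * norm (w - z)" if "w \<in> S" "norm (w - z) < d" for w
        using d(2)[OF that(1) _ that(2)] by (cases "w = z") (auto simp: field_simps)
      with d(1) show "\<exists>d>0. \<forall>w\<in>S. norm (w - z) < d \<longrightarrow> v \<bullet> (w - z) \<le> e * norm (w - z)" by blast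
    qed
  next
    assume R: ?R
    show ?L
      unfolding Limsup_le_iff
    proof (intro allI impI)
      fix y :: ereal assume "y > 0"
      then obtain e where e: "e > 0" "ereal e < y"
        by (metis ereal_dense2 ereal_less(2) zero_ereal_def)
      with R obtain d where d: "d > 0" "\<And>w. w \<in> S \<Longrightarrow> norm (w - z) < d \<Longrightarrow> v \<bullet> (w - z) \<le> e * norm (w - z)"
        by blast
      have "v \<bullet> (w - z) / norm (w - z) \<le> e" if "w \<in> S" "w \<noteq> z" "norm (w - z) < d" for w
        using d(2)[OF that(1,3)] that(2) by (simp add: field_simps)
      then show "eventually (\<lambda>w. ereal (v \<bullet> (w - z) / norm (w - z)) < y) (at z within S)"
        unfolding eventually_at using d(1) e(2)
        by (intro exI[of _ d]) (auto simp: dist_norm intro: le_less_trans[OF _ e(2)])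
    qed
  qed
  then show ?thesis by (simp add: regular_normal_cone_def)
qed

section \<open>Exact minimisation over measurable selections and its pointwise consequence\<close>

definition selections :: "'t measure \<Rightarrow> ('t \<Rightarrow> 'e::euclidean_space set) \<Rightarrow> ('t \<Rightarrow> 'e) set" where
  "selections M \<Gamma> = {z \<in> borel_measurable M. AE t in M. z t \<in> \<Gamma> t}"

lemma near_minimizer:
  fixes J :: "'z \<Rightarrow> real"
  assumes "z0 \<in> Z" "\<forall>z\<in>Z. B \<le> J z" "e > 0"
  shows "\<exists>z\<in>Z. \<forall>z'\<in>Z. J z \<le> J z' + e"
proof -
  have bdd: "bdd_below (J ` Z)" using assms(2) by (auto simp: bdd_below_def)
  have "(INF z\<in>Z. J z) < (INF z\<in>Z. J z) + e" using assms(3) by simp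
  then obtain z where z: "z \<in> Z" "J z < (INF z\<in>Z. J z) + e"
    using cINF_less_iff[OF _ bdd] assms(1) by blast
  have "(INF z\<in>Z. J z) \<le> J z'" if "z' \<in> Z" for z' using bdd that by (rule cINF_lower)
  then have "J z \<le> J z' + e" if "z' \<in> Z" for z' using z(2) that by force
  with z(1) show ?thesis by blast
qed

text \<open>Either \<open>a \<le> r\<close> or \<open>a \<le> a\<^sup>2 / r\<close>. Integrated,
  this controls an L1 norm by \<open>r\<close> times the total mass plus the squared L2 norm over
  \<open>r\<close>, in place of the Cauchy-Schwarz inequality for integrals.\<close>

lemma le_add_power2_divide:
  fixes a r :: real
  assumes "r > 0" "a \<ge> 0"
  shows "a \<le> r + a\<^sup>2 / r"
proof -
  have "0 \<le> (a - r)\<^sup>2 + a * r" using assms by simp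
  then show ?thesis using assms(1) by (simp add: field_simps power2_eq_square)
qed

lemma (in finite_measure) integrable_norm_square:
  fixes f :: "'a \<Rightarrow> 'e::euclidean_space"
  assumes "f \<in> borel_measurable M" "AE t in M. norm (f t) \<le> c"
  shows "integrable M (\<lambda>t. (norm (f t))\<^sup>2)"
proof (rule integrable_const_bound)
  show "AE t in M. norm ((norm (f t))\<^sup>2) \<le> c\<^sup>2"
    using assms(2) by eventually_elim (auto intro: power_mono)
qed (use assms(1) in measurable)

lemma (in finite_measure) norm_integral_le:
  fixes f :: "'a \<Rightarrow> 'e::euclidean_space"
  assumes "integrable M f" "AE t in M. norm (f t) \<le> c"
  shows "norm (\<integral>t. f t \<partial>M) \<le> c * measure M (space M)"
proof -
  have "norm (\<integral>t. f t \<partial>M) \<le> (\<integral>t. norm (f t) \<partial>M)" by (rule integral_norm_bound)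
  also have "\<dots> \<le> (\<integral>t. c \<partial>M)" using assms by (intro integral_mono_AE) auto
  finally show ?thesis by (simp add: mult_ac)
qed

text \<open>The Borwein--Preiss smooth variational principle with quadratic perturbations: the
  squared distances to the successive approximate minimisers add up to a single quadratic
  \<open>\<Lambda>\<bar>z\<bar>\<^sup>2 - 2\<langle>z, W\<rangle>\<close>, up to a constant.\<close>

lemma (in finite_measure) smooth_variational_principle:
  fixes \<Gamma> :: "'a \<Rightarrow> 'e::euclidean_space set" and J :: "('a \<Rightarrow> 'e) \<Rightarrow> real"
  assumes closed: "\<And>t. t \<in> space M \<Longrightarrow> closed (\<Gamma> t)"
    and bdd: "\<And>t. t \<in> space M \<Longrightarrow> \<Gamma> t \<subseteq> cball 0 R" and "R \<ge> 0"
    and ne: "z0 \<in> selections M \<Gamma>"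
    and below: "\<And>z. z \<in> selections M \<Gamma> \<Longrightarrow> B \<le> J z"
    and cont: "\<And>zs z. (\<And>i. zs i \<in> selections M \<Gamma>) \<Longrightarrow> z \<in> selections M \<Gamma> \<Longrightarrow>
      (AE t in M. (\<lambda>i. zs i t) \<longlonglongrightarrow> z t) \<Longrightarrow> (\<lambda>i. J (zs i)) \<longlonglongrightarrow> J z"
    and "\<Lambda> > 0"
  obtains z W where "z \<in> selections M \<Gamma>" "W \<in> borel_measurable M" "AE t in M. norm (W t) \<le> \<Lambda> * R"
    "\<And>z'. z' \<in> selections M \<Gamma> \<Longrightarrow>
      J z + (\<integral>t. \<Lambda> * (norm (z t))\<^sup>2 - 2 * (z t \<bullet> W t) \<partial>M) \<le>
      J z' + (\<integral>t. \<Lambda> * (norm (z' t))\<^sup>2 - 2 * (z' t \<bullet> W t) \<partial>M)"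
proof -
  let ?Z = "selections M \<Gamma>"
  have half: "a * (1 / 2) ^ n = a / 2 ^ n" for a :: real and n :: nat by (simp add: power_one_over)
  define dd where "dd y z = (\<integral>t. (norm (y t - z t))\<^sup>2 \<partial>M)" for y z :: "'a \<Rightarrow> 'e"
  \<comment> \<open>The weights add up to \<open>\<Lambda>\<close>. With the errors
    \<open>\<Lambda> / 8 ^ i\<close>, the ratio \<open>2 * \<epsilon> i / l i\<close> is
    \<open>4 / 4 ^ i\<close>, so squared distances decay fast enough to survive the factor
    \<open>2 ^ i\<close> in the L1 estimate.\<close>
  define l where "l i = \<Lambda> / 2 ^ Suc i" for i :: nat
  define \<epsilon> where "\<epsilon> i = \<Lambda> / 8 ^ i" for i :: nat
  have lpos: "l i > 0" and \<epsilon>pos: "\<epsilon> i > 0" for i using \<open>\<Lambda> > 0\<close> by (auto simp: l_def \<epsilon>_def)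
  have dd0: "dd y z \<ge> 0" for y z by (simp add: dd_def)
  have Zm [measurable_dest]: "z \<in> borel_measurable M" if "z \<in> ?Z" for z
    using that by (simp add: selections_def)
  have ZR: "AE t in M. norm (z t) \<le> R" if "z \<in> ?Z" for z
  proof -
    have "AE t in M. z t \<in> \<Gamma> t" using that by (simp add: selections_def)
    then show ?thesis using AE_space by eventually_elim (use bdd in \<open>auto simp: subset_iff\<close>)
  qed
  have Zint: "integrable M (\<lambda>t. (norm (z t))\<^sup>2)" if z: "z \<in> ?Z" for z
    using Zm[OF z] ZR[OF z] by (rule integrable_norm_square)
  have Zint1: "integrable M z" if z: "z \<in> ?Z" for z
    using ZR[OF z] Zm[OF z] by (rule integrable_const_bound)
  have Zin: "integrable M (\<lambda>t. y t \<bullet> z t)" if "y \<in> borel_measurable M" "AE t in M. norm (y t) \<le> C" "z \<in> ?Z" for y z C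
  proof (rule integrable_const_bound)
    show "AE t in M. norm (y t \<bullet> z t) \<le> \<bar>C\<bar> * R"
      using ZR[OF that(3)] that(2)
    proof eventually_elim
      case (elim t)
      have "norm (y t \<bullet> z t) \<le> norm (y t) * norm (z t)" by (simp add: Cauchy_Schwarz_ineq2)
      also have "\<dots> \<le> \<bar>C\<bar> * R" using elim by (intro mult_mono) auto
      finally show ?case .
    qed
  qed (use that in measurable)
  have ddint: "integrable M (\<lambda>t. (norm (y t - z t))\<^sup>2)" and
    ddR: "dd y z \<le> 4 * R\<^sup>2 * measure M (space M)" if y: "y \<in> ?Z" and z: "z \<in> ?Z" for y z
  proof -
    have *: "AE t in M. (norm (y t - z t))\<^sup>2 \<le> 4 * R\<^sup>2"
      using ZR[OF y] ZR[OF z]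
    proof eventually_elim
      case (elim t)
      have "norm (y t - z t) \<le> 2 * R" using elim norm_triangle_ineq4[of "y t" "z t"] by linarith
      then have "(norm (y t - z t))\<^sup>2 \<le> (2 * R)\<^sup>2" by (intro power_mono) auto
      then show ?case by (simp add: power_mult_distrib)
    qed
    show int: "integrable M (\<lambda>t. (norm (y t - z t))\<^sup>2)"
      by (rule integrable_const_bound[of _ "4 * R\<^sup>2"]) (use * y z in auto)
    have "dd y z \<le> (\<integral>t. 4 * R\<^sup>2 \<partial>M)"
      unfolding dd_def by (rule integral_mono_AE[OF int _ *]) simp
    then show "dd y z \<le> 4 * R\<^sup>2 * measure M (space M)" by (simp add: mult_ac)
  qed

  \<comment> \<open>A state consists of the current perturbed functional and an
    \<open>\<epsilon> n\<close>-minimiser of it, so that dependent choice constructs both at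
    once.\<close>
  define P where "P n s \<longleftrightarrow> snd s \<in> ?Z \<and> (\<forall>z'\<in>?Z. B \<le> fst s z') \<and>
     (\<forall>z'\<in>?Z. fst s (snd s) \<le> fst s z' + \<epsilon> n) \<and> (n = 0 \<longrightarrow> fst s = J)"
    for n and s :: "(('a \<Rightarrow> 'e) \<Rightarrow> real) \<times> ('a \<Rightarrow> 'e)"
  define Q where "Q n s s' \<longleftrightarrow> fst s' = (\<lambda>y. fst s y + l n * dd y (snd s))"
    for n and s s' :: "(('a \<Rightarrow> 'e) \<Rightarrow> real) \<times> ('a \<Rightarrow> 'e)"
  have "\<exists>f. \<forall>n. P n (f n) \<and> Q n (f n) (f (Suc n))"
  proof (rule dependent_nat_choice)
    obtain z where "z \<in> ?Z" "\<forall>z'\<in>?Z. J z \<le> J z' + \<epsilon> 0"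
      using near_minimizer[of z0 ?Z B J "\<epsilon> 0", OF ne _ \<epsilon>pos] below by blast
    then show "\<exists>x. P 0 x" using below by (intro exI[of _ "(J, z)"]) (simp add: P_def)
  next
    fix s n assume s: "P n s"
    define J' where "J' = (\<lambda>y. fst s y + l n * dd y (snd s))"
    have b: "B \<le> J' z'" if "z' \<in> ?Z" for z'
      using s that dd0 lpos[of n] unfolding P_def J'_def by (intro add_increasing2) auto
    obtain z where "z \<in> ?Z" "\<forall>z'\<in>?Z. J' z \<le> J' z' + \<epsilon> (Suc n)"
      using near_minimizer[of z0 ?Z B J' "\<epsilon> (Suc n)", OF ne _ \<epsilon>pos] b by blast
    then show "\<exists>s'. P (Suc n) s' \<and> Q n s s'"
      using b by (intro exI[of _ "(J', z)"]) (simp add: P_def Q_def J'_def)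
  qed
  then obtain f where f: "\<And>n. P n (f n)" "\<And>n. Q n (f n) (f (Suc n))" by blast
  define z where "z n = snd (f n)" for n
  define Jn where "Jn n = fst (f n)" for n
  have z: "z n \<in> ?Z" for n using f(1)[of n] by (simp add: P_def z_def)
  have min: "Jn n (z n) \<le> Jn n y + \<epsilon> n" if "y \<in> ?Z" for n y
    using f(1)[of n] that by (simp add: P_def z_def Jn_def)
  have J0: "Jn 0 = J" using f(1)[of 0] by (simp add: P_def Jn_def)
  have JSuc: "Jn (Suc n) y = Jn n y + l n * dd y (z n)" for n y
    using f(2)[of n] by (simp add: Q_def Jn_def z_def)
  have Jsum: "Jn n y = J y + (\<Sum>i<n. l i * dd y (z i))" for n y
    by (induction n) (simp_all add: J0 JSuc)
  have Jmono: "Jn i y \<le> Jn j y" if "i \<le> j" for i j y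
    by (rule lift_Suc_mono_le[of "\<lambda>i. Jn i y", OF _ that]) (simp add: JSuc less_imp_le[OF lpos] dd0)
  \<comment> \<open>The newly added distance vanishes at \<open>z n\<close>, so passing to
    \<open>z (Suc n)\<close> raises the value by at most \<open>\<epsilon> (Suc n)\<close>; the
    errors at least halve, which absorbs this.\<close>
  have adec: "Jn j (z j) + \<epsilon> j \<le> Jn i (z i) + \<epsilon> i" if "i \<le> j" for i j
  proof (rule lift_Suc_antimono_le[of "\<lambda>i. Jn i (z i) + \<epsilon> i", OF _ that])
    fix n
    have "Jn (Suc n) (z (Suc n)) \<le> Jn n (z n) + \<epsilon> (Suc n)"
      using min[OF z, of "Suc n" n] by (simp add: JSuc dd_def)
    moreover have "2 * \<epsilon> (Suc n) \<le> \<epsilon> n" using \<open>\<Lambda> > 0\<close> by (simp add: \<epsilon>_def field_simps)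
    ultimately show "Jn (Suc n) (z (Suc n)) + \<epsilon> (Suc n) \<le> Jn n (z n) + \<epsilon> n" by simp
  qed
  \<comment> \<open>\<open>l i * dd (z j) (z i)\<close> is one of the nonnegative terms added
    between \<open>Jn i\<close> and \<open>Jn j\<close>, and near minimality bounds their total at
    \<open>z j\<close> by \<open>2 * \<epsilon> i\<close>.\<close>
  have ddz: "dd (z j) (z i) \<le> 4 / 4 ^ i" if "i \<le> j" for i j
  proof (cases "i = j")
    case False
    have "l i * dd (z j) (z i) = Jn (Suc i) (z j) - Jn i (z j)" by (simp add: JSuc)
    also have "\<dots> \<le> Jn j (z j) - Jn i (z j)" using False that by (intro diff_right_mono Jmono) auto
    also have "\<dots> \<le> 2 * \<epsilon> i" using adec[OF that] min[OF z, of i j] \<epsilon>pos[of j] by linarith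
    finally have "dd (z j) (z i) \<le> 2 * \<epsilon> i / l i" using lpos[of i] by (simp add: field_simps)
    also have "\<dots> = 4 / 4 ^ i"
      using \<open>\<Lambda> > 0\<close> power_mult_distrib[of "2::real" 4 i] by (simp add: \<epsilon>_def l_def field_simps)
    finally show ?thesis .
  qed (simp add: dd_def)
  have L1: "(\<integral>t. norm (z j t - z i t) \<partial>M) \<le> (measure M (space M) + 4) / 2 ^ i" if "i \<le> j" for i j
  proof -
    have "(\<integral>t. norm (z j t - z i t) \<partial>M) \<le> (\<integral>t. 1 / 2 ^ i + 2 ^ i * (norm (z j t - z i t))\<^sup>2 \<partial>M)"
    proof (rule integral_mono_AE)
      show "integrable M (\<lambda>t. norm (z j t - z i t))" using Zint1[OF z] by auto
      show "integrable M (\<lambda>t. 1 / 2 ^ i + 2 ^ i * (norm (z j t - z i t))\<^sup>2)" using ddint[OF z z] by auto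
      show "AE t in M. norm (z j t - z i t) \<le> 1 / 2 ^ i + 2 ^ i * (norm (z j t - z i t))\<^sup>2"
      proof (rule AE_I2)
        show "norm (z j t - z i t) \<le> 1 / 2 ^ i + 2 ^ i * (norm (z j t - z i t))\<^sup>2" for t
          using le_add_power2_divide[of "1 / 2 ^ i" "norm (z j t - z i t)"] by (simp add: mult_ac)
      qed
    qed
    also have "\<dots> = measure M (space M) / 2 ^ i + 2 ^ i * dd (z j) (z i)"
      using ddint[OF z z] by (simp add: dd_def)
    also have "\<dots> \<le> measure M (space M) / 2 ^ i + 2 ^ i * (4 / 4 ^ i)"
      using ddz[OF that] by (intro add_left_mono mult_left_mono) auto
    also have "\<dots> = (measure M (space M) + 4) / 2 ^ i"
      using power_mult_distrib[of "2::real" 2 i] by (simp add: field_simps)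
    finally show ?thesis .
  qed
  have cau: "\<exists>N. \<forall>i\<ge>N. \<forall>j\<ge>N. (\<integral>t. norm (z i t - z j t) \<partial>M) < e" if "e > 0" for e
  proof -
    have "(\<lambda>i. (measure M (space M) + 4) * (1 / 2) ^ i) \<longlonglongrightarrow> (measure M (space M) + 4) * 0"
      by (intro tendsto_mult_left LIMSEQ_realpow_zero) auto
    then have "eventually (\<lambda>i. (measure M (space M) + 4) * (1 / 2) ^ i < e) sequentially"
      using that by (intro order_tendstoD(2)) auto
    then obtain N where N: "\<And>i. i \<ge> N \<Longrightarrow> (measure M (space M) + 4) / 2 ^ i < e"
      unfolding eventually_sequentially half by blast
    show ?thesis
    proof (intro exI[of _ N] allI impI)
      fix i j assume "i \<ge> N" "j \<ge> N"
      then show "(\<integral>t. norm (z i t - z j t) \<partial>M) < e"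
        using L1[of i j] L1[of j i] N[of i] N[of j] by (cases "i \<le> j") (auto simp: norm_minus_commute)
    qed
  qed
  have "\<exists>r. strict_mono r \<and> (AE t in M. Cauchy (\<lambda>i. z (r i) t))"
  proof (rule cauchy_L1_AE_cauchy_subseq[of M z])
    show "integrable M (z n)" for n by (rule Zint1[OF z])
    show "\<exists>N. \<forall>i\<ge>N. \<forall>j\<ge>N. (\<integral>t. norm (z i t - z j t) \<partial>M) < e" if "e > 0" for e
      by (rule cau[OF that])
  qed blast
  then obtain r where r: "strict_mono r" "AE t in M. Cauchy (\<lambda>i. z (r i) t)" by blast
  define zl where "zl t = lim (\<lambda>i. z (r i) t)" for t
  have conv: "AE t in M. (\<lambda>i. z (r i) t) \<longlonglongrightarrow> zl t"
    using r(2) by eventually_elim (simp add: zl_def Cauchy_convergent_iff convergent_LIMSEQ_iff)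
  have AEz: "AE t in M. \<forall>i. z i t \<in> \<Gamma> t"
    unfolding AE_all_countable using z by (simp add: selections_def)
  have zl: "zl \<in> ?Z"
  proof -
    have "zl \<in> borel_measurable M"
      unfolding zl_def using Zm[OF z] by (intro borel_measurable_lim_metric) auto
    moreover have "AE t in M. zl t \<in> \<Gamma> t"
      using conv AEz AE_space
    proof eventually_elim
      case (elim t)
      then show ?case using closed_sequentially[OF closed[OF elim(3)], of "\<lambda>i. z (r i) t" "zl t"] by blast
    qed
    ultimately show ?thesis by (simp add: selections_def)
  qed
  have ddconv: "(\<lambda>j. dd (z (r j)) (z i)) \<longlonglongrightarrow> dd zl (z i)" for i
    unfolding dd_def
  proof (rule integral_dominated_convergence[where w = "\<lambda>_. 4 * R\<^sup>2"])
    show "AE t in M. (\<lambda>j. (norm (z (r j) t - z i t))\<^sup>2) \<longlonglongrightarrow> (norm (zl t - z i t))\<^sup>2"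
      using conv by eventually_elim (intro tendsto_intros)
    show "AE t in M. norm ((norm (z (r j) t - z i t))\<^sup>2) \<le> 4 * R\<^sup>2" for j
      using ZR[OF z[of "r j"]] ZR[OF z[of i]]
    proof eventually_elim
      case (elim t)
      have "norm (z (r j) t - z i t) \<le> 2 * R" using elim norm_triangle_ineq4[of "z (r j) t" "z i t"] by linarith
      then have "(norm (z (r j) t - z i t))\<^sup>2 \<le> (2 * R)\<^sup>2" by (intro power_mono) auto
      then show ?case by (simp add: power_mult_distrib)
    qed
  qed (use z zl in auto)
  have Jconv: "(\<lambda>j. Jn i (z (r j))) \<longlonglongrightarrow> Jn i zl" for i
    unfolding Jsum by (intro tendsto_add tendsto_sum tendsto_mult_left ddconv cont z zl conv)
  define D where "D = 4 * R\<^sup>2 * measure M (space M)"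
  \<comment> \<open>\<open>D\<close> bounds all squared distances and the weights from index
    \<open>i\<close> on sum to \<open>\<Lambda> / 2 ^ i\<close>, so the terms still missing from
    \<open>Jn i y\<close> cost at most \<open>D * \<Lambda> / 2 ^ i\<close>.\<close>
  have Jle: "Jn i zl \<le> Jn i y + D * \<Lambda> / 2 ^ i" if y: "y \<in> ?Z" for i y
  proof (rule LIMSEQ_le[OF Jconv])
    have "filterlim (\<lambda>j. (8::real) ^ r j) at_infinity sequentially"
      by (rule filterlim_compose[OF filterlim_realpow_sequentially_gt1 filterlim_subseq[OF r(1)]]) simp
    then have "(\<lambda>j. \<epsilon> (r j)) \<longlonglongrightarrow> 0"
      unfolding \<epsilon>_def by (intro tendsto_divide_0[OF tendsto_const])
    then show "(\<lambda>j. Jn i y + D * \<Lambda> / 2 ^ i + \<epsilon> (r j)) \<longlonglongrightarrow> Jn i y + D * \<Lambda> / 2 ^ i"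
      using tendsto_add[OF tendsto_const] by fastforce
    have "Jn j y \<le> Jn i y + D * \<Lambda> * (1 / 2 ^ i - 1 / 2 ^ j)" if "i \<le> j" for j
      using that
    proof (induction rule: dec_induct)
      case (step n)
      have "l n * dd y (z n) \<le> l n * D"
        using ddR[OF y z[of n]] lpos[of n] unfolding D_def by (intro mult_left_mono) auto
      moreover have "l n * D = D * \<Lambda> * (1 / 2 ^ n - 1 / 2 ^ Suc n)" by (simp add: l_def field_simps)
      ultimately show ?case using step.IH by (simp add: JSuc right_diff_distrib)
    qed simp
    then have *: "Jn j y \<le> Jn i y + D * \<Lambda> / 2 ^ i" if "i \<le> j" for j
    proof -
      have "D * \<Lambda> * (1 / 2 ^ i - 1 / 2 ^ j) \<le> D * \<Lambda> / 2 ^ i"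
        using \<open>\<Lambda> > 0\<close> by (simp add: D_def field_simps)
      then show ?thesis using \<open>\<And>j. i \<le> j \<Longrightarrow> Jn j y \<le> _ j\<close>[OF that] by linarith
    qed
    have "Jn i (z (r j)) \<le> Jn i y + D * \<Lambda> / 2 ^ i + \<epsilon> (r j)" if "j \<ge> i" for j
    proof -
      have "i \<le> r j" using seq_suble[OF r(1), of j] that by linarith
      then show ?thesis using Jmono[of i "r j" "z (r j)"] min[OF y, of "r j"] *[of "r j"] by linarith
    qed
    then show "\<exists>N. \<forall>n\<ge>N. Jn i (z (r n)) \<le> Jn i y + D * \<Lambda> / 2 ^ i + \<epsilon> (r n)" by blast
  qed

  \<comment> \<open>Expanding the squares splits the perturbation into \<open>Ln n\<close> times the
    squared norm, a term linear in \<open>Wn n\<close>, and the constant \<open>c n\<close>. The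
    constant cancels in every comparison, and \<open>Ln\<close>, \<open>Wn\<close> tend to
    \<open>\<Lambda>\<close>, \<open>W\<close>.\<close>
  define Wn where "Wn n t = (\<Sum>i<n. l i *\<^sub>R z i t)" for n t
  define Ln where "Ln n = (\<Sum>i<n. l i)" for n
  define c where "c n = (\<Sum>i<n. l i * (\<integral>t. (norm (z i t))\<^sup>2 \<partial>M))" for n
  have Wnm [measurable]: "Wn n \<in> borel_measurable M" for n
    unfolding Wn_def[abs_def] using Zm[OF z] by measurable
  have Ln: "Ln n = \<Lambda> - \<Lambda> / 2 ^ n" for n
    by (induction n) (simp_all add: Ln_def l_def field_simps)
  have AEzR: "AE t in M. \<forall>i. norm (z i t) \<le> R"
    unfolding AE_all_countable using ZR[OF z] by blast
  have lsum: "l sums \<Lambda>"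
  proof -
    have "(\<lambda>n. \<Lambda> - \<Lambda> * (1 / 2) ^ n) \<longlonglongrightarrow> \<Lambda> - \<Lambda> * 0"
      by (intro tendsto_intros LIMSEQ_realpow_zero) auto
    then show ?thesis
      unfolding sums_def Ln_def[symmetric] Ln half by simp
  qed
  define W where "W t = lim (\<lambda>n. Wn n t)" for t
  have Wm [measurable]: "W \<in> borel_measurable M"
    unfolding W_def by (intro borel_measurable_lim_metric Wnm)
  have WnR: "AE t in M. \<forall>n. norm (Wn n t) \<le> \<Lambda> * R"
    using AEzR
  proof eventually_elim
    case (elim t)
    show ?case
    proof
      fix n
      have "norm (Wn n t) \<le> (\<Sum>i<n. l i * R)"
        unfolding Wn_def using elim
        by (intro order_trans[OF norm_sum] sum_mono)
          (auto simp: abs_of_pos[OF lpos] intro!: mult_left_mono less_imp_le[OF lpos])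
      also have "\<dots> = Ln n * R" by (simp add: Ln_def sum_distrib_right)
      also have "\<dots> \<le> \<Lambda> * R" using \<open>R \<ge> 0\<close> \<open>\<Lambda> > 0\<close> by (intro mult_right_mono) (simp_all add: Ln)
      finally show "norm (Wn n t) \<le> \<Lambda> * R" .
    qed
  qed
  have Wconv: "AE t in M. (\<lambda>n. Wn n t) \<longlonglongrightarrow> W t"
    using AEzR
  proof eventually_elim
    case (elim t)
    have "summable (\<lambda>i. l i *\<^sub>R z i t)"
    proof (rule summable_comparison_test')
      show "summable (\<lambda>i. l i * R)" using lsum by (auto intro: summable_mult2 sums_summable)
      show "norm (l i *\<^sub>R z i t) \<le> l i * R" if "0 \<le> i" for i
        using elim by (auto simp: abs_of_pos[OF lpos] intro!: mult_left_mono less_imp_le[OF lpos])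
    qed
    then have "convergent (\<lambda>n. Wn n t)" unfolding Wn_def by (simp add: summable_iff_convergent)
    then show ?case by (simp add: W_def convergent_LIMSEQ_iff)
  qed
  have WR: "AE t in M. norm (W t) \<le> \<Lambda> * R"
    using Wconv WnR by eventually_elim (auto intro: LIMSEQ_le_const2 tendsto_norm)
  define G where "G n y = (\<integral>t. Ln n * (norm (y t))\<^sup>2 - 2 * (y t \<bullet> Wn n t) \<partial>M)" for n y
  have Jexp: "Jn n y = J y + G n y + c n" if y: "y \<in> ?Z" for n y
  proof -
    have yz: "integrable M (\<lambda>t. y t \<bullet> z i t)" for i
      by (rule Zin[OF Zm[OF y] ZR[OF y] z])
    have dd_eq: "dd y (z i) = (\<integral>t. (norm (y t))\<^sup>2 \<partial>M) - 2 * (\<integral>t. y t \<bullet> z i t \<partial>M) + (\<integral>t. (norm (z i t))\<^sup>2 \<partial>M)" for i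
    proof -
      have "(norm (y t - z i t))\<^sup>2 = (norm (y t))\<^sup>2 - 2 * (y t \<bullet> z i t) + (norm (z i t))\<^sup>2" for t
        by (simp add: power2_norm_eq_inner inner_diff inner_commute)
      then show ?thesis unfolding dd_def using Zint[OF y] Zint[OF z] yz by simp
    qed
    have G_eq: "G n y = Ln n * (\<integral>t. (norm (y t))\<^sup>2 \<partial>M) - 2 * (\<Sum>i<n. l i * (\<integral>t. y t \<bullet> z i t \<partial>M))"
    proof -
      have "y t \<bullet> Wn n t = (\<Sum>i<n. l i * (y t \<bullet> z i t))" for t
        by (simp add: Wn_def inner_sum_right)
      then show ?thesis unfolding G_def using Zint[OF y] yz by (simp add: integrable_sum)
    qed
    have "(\<Sum>i<n. l i * dd y (z i)) = (\<Sum>i<n. l i * (\<integral>t. (norm (y t))\<^sup>2 \<partial>M) -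
        2 * (l i * (\<integral>t. y t \<bullet> z i t \<partial>M)) + l i * (\<integral>t. (norm (z i t))\<^sup>2 \<partial>M))"
      by (intro sum.cong) (simp_all add: dd_eq ring_distribs)
    also have "\<dots> = G n y + c n"
      unfolding G_eq by (simp add: Ln_def c_def sum.distrib sum_subtractf sum_distrib_right sum_distrib_left)
    finally show ?thesis by (simp add: Jsum)
  qed
  have Gconv: "(\<lambda>n. G n y) \<longlonglongrightarrow> (\<integral>t. \<Lambda> * (norm (y t))\<^sup>2 - 2 * (y t \<bullet> W t) \<partial>M)" if y: "y \<in> ?Z" for y
    unfolding G_def
  proof (rule integral_dominated_convergence[where w = "\<lambda>_. \<Lambda> * R\<^sup>2 + 2 * (R * (\<Lambda> * R))"])
    have Lnc: "Ln \<longlonglongrightarrow> \<Lambda>" using lsum unfolding sums_def Ln_def .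
    show "AE t in M. (\<lambda>n. Ln n * (norm (y t))\<^sup>2 - 2 * (y t \<bullet> Wn n t)) \<longlonglongrightarrow> \<Lambda> * (norm (y t))\<^sup>2 - 2 * (y t \<bullet> W t)"
      using Wconv by eventually_elim (intro tendsto_intros Lnc)
    show "AE t in M. norm (Ln n * (norm (y t))\<^sup>2 - 2 * (y t \<bullet> Wn n t)) \<le> \<Lambda> * R\<^sup>2 + 2 * (R * (\<Lambda> * R))" for n
      using ZR[OF y] WnR
    proof eventually_elim
      case (elim t)
      have "\<bar>Ln n * (norm (y t))\<^sup>2\<bar> \<le> \<Lambda> * R\<^sup>2"
      proof -
        have "(norm (y t))\<^sup>2 \<le> R\<^sup>2" using elim by (intro power_mono) auto
        moreover have "\<bar>Ln n\<bar> \<le> \<Lambda>" using \<open>\<Lambda> > 0\<close> by (simp add: Ln field_simps)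
        ultimately show ?thesis unfolding abs_mult by (intro mult_mono) auto
      qed
      moreover have "\<bar>y t \<bullet> Wn n t\<bar> \<le> R * (\<Lambda> * R)"
        using elim \<open>R \<ge> 0\<close> by (intro order_trans[OF Cauchy_Schwarz_ineq2] mult_mono) auto
      ultimately show ?case by (auto simp: abs_le_iff)
    qed
  qed (use y in measurable)
  have fin: "J zl + (\<integral>t. \<Lambda> * (norm (zl t))\<^sup>2 - 2 * (zl t \<bullet> W t) \<partial>M) \<le>
      J y + (\<integral>t. \<Lambda> * (norm (y t))\<^sup>2 - 2 * (y t \<bullet> W t) \<partial>M)" if y: "y \<in> ?Z" for y
  proof (rule LIMSEQ_le)
    show "(\<lambda>n. J zl + G n zl) \<longlonglongrightarrow> J zl + (\<integral>t. \<Lambda> * (norm (zl t))\<^sup>2 - 2 * (zl t \<bullet> W t) \<partial>M)"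
      by (intro tendsto_intros Gconv zl)
    have "(\<lambda>n. J y + G n y + D * \<Lambda> * (1 / 2) ^ n) \<longlonglongrightarrow>
        J y + (\<integral>t. \<Lambda> * (norm (y t))\<^sup>2 - 2 * (y t \<bullet> W t) \<partial>M) + D * \<Lambda> * 0"
      by (intro tendsto_intros Gconv y LIMSEQ_realpow_zero) auto
    then show "(\<lambda>n. J y + G n y + D * \<Lambda> / 2 ^ n) \<longlonglongrightarrow> J y + (\<integral>t. \<Lambda> * (norm (y t))\<^sup>2 - 2 * (y t \<bullet> W t) \<partial>M)"
      unfolding half by simp
    have "J zl + G n zl \<le> J y + G n y + D * \<Lambda> / 2 ^ n" for n
      using Jle[OF y, of n] by (simp add: Jexp[OF y] Jexp[OF zl])
    then show "\<exists>N. \<forall>n\<ge>N. J zl + G n zl \<le> J y + G n y + D * \<Lambda> / 2 ^ n" by blast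
  qed
  show thesis using fin by (rule that[OF zl Wm WR])
qed

text \<open>Only competitors at distance at most \<open>\<tau>\<close> from \<open>z\<close> are used, so the second-order terms are
  dominated by the first-order ones on atoms as well, where the set of modification cannot be
  made small.\<close>

lemma (in finite_measure) minimizer_regular_normal:
  fixes \<Gamma> :: "'a \<Rightarrow> 'e::euclidean_space set"
  assumes graph [measurable]: "{(t, x). t \<in> space M \<and> x \<in> \<Gamma> t} \<in> sets (M \<Otimes>\<^sub>M borel)"
    and bdd: "\<And>t. t \<in> space M \<Longrightarrow> \<Gamma> t \<subseteq> cball 0 R"
    and z: "z \<in> selections M \<Gamma>"
    and b [measurable]: "b \<in> borel_measurable M" and bC: "AE t in M. norm (b t) \<le> C" and "L \<ge> 0"
    and opt: "\<And>z'. z' \<in> selections M \<Gamma> \<Longrightarrow>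
      0 \<le> g \<bullet> (\<integral>t. z' t - z t \<partial>M) + L * (norm (\<integral>t. z' t - z t \<partial>M))\<^sup>2 +
        (\<integral>t. b t \<bullet> (z' t - z t) + L * (norm (z' t - z t))\<^sup>2 \<partial>M)"
  shows "AE t in M. - (g + b t) \<in> regular_normal_cone (z t) (\<Gamma> t)"
proof -
  have [measurable]: "z \<in> borel_measurable M" and z\<Gamma>: "AE t in M. z t \<in> \<Gamma> t"
    using z by (auto simp: selections_def)
  let ?\<mu> = "measure M (space M)"
  \<comment> \<open>For given \<open>e\<close> one radius serves almost all \<open>t\<close>.
    Countably many \<open>e\<close> then suffice for the normal cone, so the exceptional null sets
    can be united.\<close>
  have key: "\<exists>\<tau>>0. AE t in M. \<forall>x\<in>\<Gamma> t. norm (x - z t) < \<tau> \<longrightarrow> - ((g + b t) \<bullet> (x - z t)) \<le> e * norm (x - z t)"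
    if "e > 0" for e
  proof -
    \<comment> \<open>In \<open>1 + ?\<mu>\<close> the 1 pays for the pointwise quadratic term and
      \<open>?\<mu>\<close> for the square of the integral, whose norm is at most
      \<open>\<tau> * ?\<mu>\<close>. Using \<open>L + 1\<close> keeps the denominator positive when
      \<open>L = 0\<close>.\<close>
    define \<tau> where "\<tau> = e / (2 * (L + 1) * (1 + ?\<mu>))"
    have pos: "(L + 1) * (1 + ?\<mu>) > 0" using \<open>L \<ge> 0\<close> by (intro mult_pos_pos) (auto intro: add_pos_nonneg)
    then have "\<tau> > 0" using that by (simp add: \<tau>_def field_simps)
    have \<tau>e: "L * \<tau> * (1 + ?\<mu>) \<le> e / 2"
    proof -
      have "L * \<tau> * (1 + ?\<mu>) \<le> (L + 1) * \<tau> * (1 + ?\<mu>)" using \<open>\<tau> > 0\<close> by (intro mult_right_mono) auto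
      also have "\<dots> = e / 2" using pos by (simp add: \<tau>_def field_simps)
      finally show ?thesis .
    qed
    \<comment> \<open>These are the pairs violating the estimate. A measurable selection of them on
      a nonnull set, with \<open>z\<close> kept elsewhere, would be a competitor contradicting
      \<open>opt\<close>.\<close>
    define G where "G = {(t, x). t \<in> space M \<and> x \<in> \<Gamma> t} \<inter>
      {p \<in> space (M \<Otimes>\<^sub>M borel). norm (snd p - z (fst p)) < \<tau> \<and>
        e * norm (snd p - z (fst p)) < - ((g + b (fst p)) \<bullet> (snd p - z (fst p)))}"
    have G: "G \<in> sets (M \<Otimes>\<^sub>M borel)" unfolding G_def by measurable
    have GR: "G \<subseteq> UNIV \<times> cball 0 R" using bdd by (auto simp: G_def)
    have "AE t in M. \<forall>x. (t, x) \<notin> G"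
    proof (rule ccontr)
      assume "\<not> (AE t in M. \<forall>x. (t, x) \<notin> G)"
      then obtain A f where A [measurable]: "A \<in> sets M" and "emeasure M A > 0"
        and f [measurable]: "f \<in> borel_measurable M" and fG: "\<And>t. t \<in> A \<Longrightarrow> (t, f t) \<in> G"
        by (rule measurable_selection_on_nonnull[OF finite_measure_axioms G compact_cball GR])
          (rule that; assumption)
      define z' where "z' t = (if t \<in> A then f t else z t)" for t
      have z'm [measurable]: "z' \<in> borel_measurable M" unfolding z'_def[abs_def] by measurable
      have z': "z' \<in> selections M \<Gamma>"
        unfolding selections_def using z\<Gamma> fG by (auto simp: z'_def G_def)
      define s where "s t = norm (z' t - z t)" for t
      have sm [measurable]: "s \<in> borel_measurable M" unfolding s_def[abs_def] by measurable
      have s: "0 \<le> s t" "s t \<le> \<tau>" for t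
        using fG[of t] \<open>\<tau> > 0\<close> by (auto simp: s_def z'_def G_def)
      have first: "(g + b t) \<bullet> (z' t - z t) \<le> - (e * s t)" for t
        using fG[of t] by (auto simp: s_def z'_def G_def)
      have s_pos: "s t > 0" if "t \<in> A" for t
        using fG[OF that] that \<open>e > 0\<close> by (auto simp: s_def z'_def G_def)
      have sint: "integrable M s" using s by (intro integrable_const_bound[of _ \<tau>]) auto
      have s2int: "integrable M (\<lambda>t. (s t)\<^sup>2)"
        using s by (intro integrable_const_bound[of _ "\<tau>\<^sup>2"]) (auto intro!: power_mono)
      have dint: "integrable M (\<lambda>t. z' t - z t)"
        using s by (intro integrable_const_bound[of _ \<tau>]) (auto simp: s_def)
      have bint: "integrable M (\<lambda>t. b t \<bullet> (z' t - z t))"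
      proof (rule integrable_const_bound)
        show "AE t in M. norm (b t \<bullet> (z' t - z t)) \<le> \<bar>C\<bar> * \<tau>"
          using bC
        proof eventually_elim
          case (elim t)
          have "norm (b t \<bullet> (z' t - z t)) \<le> norm (b t) * s t" by (simp add: Cauchy_Schwarz_ineq2 s_def)
          also have "\<dots> \<le> \<bar>C\<bar> * \<tau>" using elim s by (intro mult_mono) auto
          finally show ?case .
        qed
      qed measurable
      define S where "S = (\<integral>t. s t \<partial>M)"
      have hS: "norm (\<integral>t. z' t - z t \<partial>M) \<le> S"
        unfolding S_def s_def by (rule integral_norm_bound)
      have "S \<le> (\<integral>t. \<tau> \<partial>M)" unfolding S_def using s by (intro integral_mono sint) auto
      then have S\<tau>: "S \<le> \<tau> * ?\<mu>" by (simp add: mult_ac)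
      have "S \<ge> 0" unfolding S_def using s by (simp add: integral_nonneg)
      have "S \<noteq> 0"
      proof
        assume "S = 0"
        then have "AE t in M. s t = 0"
          unfolding S_def using integral_nonneg_eq_0_iff_AE[OF sint] s by simp
        then have "AE t in M. t \<notin> A" by eventually_elim (use s_pos in force)
        then have "emeasure M A = 0" using AE_iff_measurable[OF A] sets.sets_into_space[OF A]
          by (simp add: Int_absorb2 AE_iff_null_sets[OF A] null_setsD1)
        with \<open>emeasure M A > 0\<close> show False by simp
      qed
      with \<open>S \<ge> 0\<close> have "S > 0" by simp
      have "g \<bullet> (\<integral>t. z' t - z t \<partial>M) + (\<integral>t. b t \<bullet> (z' t - z t) + L * (norm (z' t - z t))\<^sup>2 \<partial>M)
          = (\<integral>t. (g + b t) \<bullet> (z' t - z t) + L * (s t)\<^sup>2 \<partial>M)"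
      proof -
        have "g \<bullet> (\<integral>t. z' t - z t \<partial>M) = (\<integral>t. g \<bullet> (z' t - z t) \<partial>M)"
          by (rule integral_inner_right[symmetric]) (use dint in auto)
        moreover have "integrable M (\<lambda>t. g \<bullet> (z' t - z t))" using dint by (rule integrable_inner_right)
        moreover have "integrable M (\<lambda>t. b t \<bullet> (z' t - z t) + L * (norm (z' t - z t))\<^sup>2)"
          using bint s2int by (simp add: s_def)
        ultimately show ?thesis
          by (simp only: Bochner_Integration.integral_add[symmetric] s_def inner_add_left add.assoc)
      qed
      also have "\<dots> \<le> (\<integral>t. - e * s t + L * \<tau> * s t \<partial>M)"
      proof (rule integral_mono)
        show "integrable M (\<lambda>t. (g + b t) \<bullet> (z' t - z t) + L * (s t)\<^sup>2)"
          using bint s2int dint by (simp add: inner_add_left)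
        show "integrable M (\<lambda>t. - e * s t + L * \<tau> * s t)" using sint by simp
        show "(g + b t) \<bullet> (z' t - z t) + L * (s t)\<^sup>2 \<le> - e * s t + L * \<tau> * s t" for t
        proof -
          have "L * (s t)\<^sup>2 \<le> L * (\<tau> * s t)"
            unfolding power2_eq_square using s[of t] \<open>L \<ge> 0\<close> by (intro mult_left_mono mult_right_mono) auto
          then show ?thesis using first[of t] by simp
        qed
      qed
      also have "\<dots> = - e * S + L * \<tau> * S" using sint by (simp add: S_def)
      finally have "0 \<le> L * (norm (\<integral>t. z' t - z t \<partial>M))\<^sup>2 + (- e * S + L * \<tau> * S)"
        using opt[OF z'] by linarith
      also have "L * (norm (\<integral>t. z' t - z t \<partial>M))\<^sup>2 \<le> L * (S * (\<tau> * ?\<mu>))"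
        unfolding power2_eq_square using \<open>L \<ge> 0\<close> hS S\<tau> \<open>S \<ge> 0\<close>
        by (intro mult_left_mono mult_mono) auto
      finally have "0 \<le> S * (L * \<tau> * (1 + ?\<mu>) - e)" by (simp add: algebra_simps)
      then have "0 \<le> L * \<tau> * (1 + ?\<mu>) - e" using \<open>S > 0\<close> by (simp add: zero_le_mult_iff)
      with \<tau>e \<open>e > 0\<close> show False by linarith
    qed
    then have "AE t in M. \<forall>x\<in>\<Gamma> t. norm (x - z t) < \<tau> \<longrightarrow> - ((g + b t) \<bullet> (x - z t)) \<le> e * norm (x - z t)"
      using AE_space by eventually_elim (auto simp: G_def space_pair_measure not_less)
    with \<open>\<tau> > 0\<close> show ?thesis by blast
  qed
  have "AE t in M. \<forall>n. \<exists>\<tau>>0. \<forall>x\<in>\<Gamma> t. norm (x - z t) < \<tau> \<longrightarrow>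
      - ((g + b t) \<bullet> (x - z t)) \<le> 1 / Suc n * norm (x - z t)"
    unfolding AE_all_countable
  proof
    fix n
    obtain \<tau> where "\<tau> > 0" "AE t in M. \<forall>x\<in>\<Gamma> t. norm (x - z t) < \<tau> \<longrightarrow>
        - ((g + b t) \<bullet> (x - z t)) \<le> 1 / Suc n * norm (x - z t)"
      using key[of "1 / Suc n"] by auto
    from this(2) show "AE t in M. \<exists>\<tau>>0. \<forall>x\<in>\<Gamma> t. norm (x - z t) < \<tau> \<longrightarrow>
        - ((g + b t) \<bullet> (x - z t)) \<le> 1 / Suc n * norm (x - z t)"
      by eventually_elim (use \<open>\<tau> > 0\<close> in blast)
  qed
  then show ?thesis
    using z\<Gamma>
  proof eventually_elim
    case (elim t)
    show ?case
      unfolding regular_normal_cone_iff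
    proof (intro conjI allI impI)
      fix e :: real assume "e > 0"
      then obtain n where n: "1 / Suc n < e" using nat_approx_posE by (metis inverse_eq_divide of_nat_Suc)
      obtain \<tau> where \<tau>: "\<tau> > 0" "\<And>x. x \<in> \<Gamma> t \<Longrightarrow> norm (x - z t) < \<tau> \<Longrightarrow>
          - ((g + b t) \<bullet> (x - z t)) \<le> 1 / Suc n * norm (x - z t)"
        using elim(1) by blast
      have "- ((g + b t) \<bullet> (x - z t)) \<le> e * norm (x - z t)"
        if "x \<in> \<Gamma> t" "norm (x - z t) < \<tau>" for x
        using \<tau>(2)[OF that] mult_right_mono[OF less_imp_le[OF n], of "norm (x - z t)"] by simp
      then show "\<exists>d>0. \<forall>w\<in>\<Gamma> t. norm (w - z t) < d \<longrightarrow> - (g + b t) \<bullet> (w - z t) \<le> e * norm (w - z t)"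
        using \<tau>(1) unfolding inner_minus_left by blast
    qed (rule elim(2))
  qed
qed

section \<open>Closedness under limits of selections\<close>

text \<open>Dyadic convex combinations suffice: the parallelogram identity uses only midpoints, and
  properties of the hull follow by a one-step induction. The members are functions, so the same
  coefficients are used at every \<open>t\<close>.\<close>

inductive_set midpoint_hull :: "('t \<Rightarrow> 'e::real_vector) set \<Rightarrow> ('t \<Rightarrow> 'e) set" for S where
  base: "f \<in> S \<Longrightarrow> f \<in> midpoint_hull S"
| mid: "f \<in> midpoint_hull S \<Longrightarrow> g \<in> midpoint_hull S \<Longrightarrow> (\<lambda>t. (1/2) *\<^sub>R (f t + g t)) \<in> midpoint_hull S"

lemma midpoint_hull_mono: "S \<subseteq> T \<Longrightarrow> midpoint_hull S \<subseteq> midpoint_hull T"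
proof
  fix f assume "S \<subseteq> T" "f \<in> midpoint_hull S"
  from this(2,1) show "f \<in> midpoint_hull T" by induction (auto intro: midpoint_hull.intros)
qed

lemma convex_midpoint:
  assumes "convex C" "x \<in> C" "y \<in> C"
  shows "(1/2) *\<^sub>R (x + y) \<in> C"
  using convexD[OF assms, of "1/2" "1/2"] by (simp add: scaleR_add_right)

lemma midpoint_hull_in_convex:
  assumes "f \<in> midpoint_hull S" "convex C" "\<And>g. g \<in> S \<Longrightarrow> g t \<in> C"
  shows "f t \<in> C"
  using assms(1) by induction (auto intro: assms(3) convex_midpoint[OF assms(2)])

lemma midpoint_hull_measurable:
  fixes f :: "'t \<Rightarrow> 'e::euclidean_space"
  assumes "f \<in> midpoint_hull S" "S \<subseteq> borel_measurable M"
  shows "f \<in> borel_measurable M"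
  using assms by induction auto

lemma midpoint_hull_integral_in_convex:
  fixes f :: "'t \<Rightarrow> 'e::euclidean_space"
  assumes "f \<in> midpoint_hull S" "convex C" "\<And>g. g \<in> S \<Longrightarrow> integrable M g \<and> integral\<^sup>L M g \<in> C"
  shows "integrable M f \<and> integral\<^sup>L M f \<in> C"
  using assms(1)
proof induction
  case (mid f g)
  then have "(\<integral>t. (1/2) *\<^sub>R (f t + g t) \<partial>M) = (1/2) *\<^sub>R (integral\<^sup>L M f + integral\<^sup>L M g)" by simp
  with mid show ?case using convex_midpoint[OF assms(2)] by auto
qed (rule assms(3))

text \<open>Elements of almost minimal \<open>L\<^sup>2\<close> norm in the convex hulls of the tails of a bounded
  sequence form a Cauchy sequence, by the parallelogram identity.\<close>

lemma (in finite_measure) mazur_AE: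
  fixes f :: "nat \<Rightarrow> 'a \<Rightarrow> 'e::euclidean_space"
  assumes fm: "\<And>n. f n \<in> borel_measurable M" and fR: "\<And>n. AE t in M. norm (f n t) \<le> R"
  obtains g gl where "\<And>n. g n \<in> midpoint_hull (f ` {n..})" "gl \<in> borel_measurable M"
    "AE t in M. (\<lambda>n. g n t) \<longlonglongrightarrow> gl t"
proof -
  define N where "N h = (\<integral>t. (norm (h t))\<^sup>2 \<partial>M)" for h :: "'a \<Rightarrow> 'e"
  define H where "H n = midpoint_hull (f ` {n..})" for n
  have fRall: "AE t in M. \<forall>n. norm (f n t) \<le> R" unfolding AE_all_countable using fR by blast
  have Hm: "h \<in> borel_measurable M" if "h \<in> H n" for h n
    using midpoint_hull_measurable[of h "f ` {n..}" M] that fm unfolding H_def by blast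
  have HR: "AE t in M. norm (h t) \<le> R" if "h \<in> H n" for h n
    using fRall
  proof eventually_elim
    case (elim t)
    have "h t \<in> cball 0 R"
      by (rule midpoint_hull_in_convex[OF that[unfolded H_def]]) (use elim in auto)
    then show ?case by simp
  qed
  have Hint: "integrable M h" if "h \<in> H n" for h n
    using HR[OF that] Hm[OF that] by (rule integrable_const_bound)
  have Hint2: "integrable M (\<lambda>t. (norm (h t))\<^sup>2)" if "h \<in> H n" for h n
    using Hm[OF that] HR[OF that] by (rule integrable_norm_square)
  have Hdec: "H m \<subseteq> H n" if "n \<le> m" for n m
    unfolding H_def using that by (intro midpoint_hull_mono image_mono) auto
  have N0: "N h \<ge> 0" for h by (simp add: N_def)
  \<comment> \<open>The hulls \<open>H n\<close> shrink, so the infima increase; being bounded, they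
    converge.\<close>
  define i where "i n = (INF h\<in>H n. N h)" for n
  have ne: "H n \<noteq> {}" for n unfolding H_def by (auto intro: midpoint_hull.base)
  have bdd: "bdd_below (N ` H n)" for n using N0 by (auto simp: bdd_below_def)
  have i_le: "i n \<le> N h" if "h \<in> H n" for n h unfolding i_def using bdd that by (rule cINF_lower)
  have i_mono: "i n \<le> i m" if "n \<le> m" for n m
    unfolding i_def by (rule cINF_superset_mono[OF ne bdd Hdec[OF that]]) simp
  have i_bound: "i n \<le> R\<^sup>2 * measure M (space M)" for n
  proof -
    obtain h where h: "h \<in> H n" using ne by blast
    have "AE t in M. (norm (h t))\<^sup>2 \<le> R\<^sup>2" using HR[OF h] by eventually_elim (auto intro: power_mono)
    then have "N h \<le> (\<integral>t. R\<^sup>2 \<partial>M)" unfolding N_def by (intro integral_mono_AE Hint2[OF h]) auto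
    then show ?thesis using i_le[OF h] by (simp add: mult_ac)
  qed
  have "convergent i"
  proof -
    have "incseq i" using i_mono by (simp add: incseq_def)
    moreover have "\<forall>n. i n \<le> R\<^sup>2 * measure M (space M)" using i_bound by blast
    ultimately obtain L where "i \<longlonglongrightarrow> L" by (rule incseq_convergent)
    then show ?thesis by (rule convergentI)
  qed
  then have Ci: "Cauchy i" by (rule convergent_Cauchy)
  have "\<exists>h\<in>H n. N h < i n + 1 / Suc n" for n
  proof -
    have "(INF h\<in>H n. N h) < i n + 1 / Suc n" by (simp add: i_def)
    then show ?thesis using cINF_less_iff[OF ne bdd] by blast
  qed
  then obtain h where h: "\<And>n. h n \<in> H n" "\<And>n. N (h n) < i n + 1 / Suc n" by metis
  \<comment> \<open>The midpoint \<open>k\<close> of \<open>h n\<close> and \<open>h m\<close> stays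
    in \<open>H n\<close>, so \<open>N k \<ge> i n\<close>; what remains is the gap of the infima
    and the two approximation errors.\<close>
  have par: "(\<integral>t. (norm (h m t - h n t))\<^sup>2 \<partial>M) \<le> 2 * (i m - i n) + 4 / Suc n" if "n \<le> m" for n m
  proof -
    define k where "k = (\<lambda>t. (1/2) *\<^sub>R (h n t + h m t))"
    have hm: "h m \<in> H n" using h(1) Hdec[OF that] by blast
    have k: "k \<in> H n" unfolding k_def H_def using h(1)[of n] hm by (auto simp: H_def intro: midpoint_hull.mid)
    have "4 * (norm (k t))\<^sup>2 = (norm (h n t + h m t))\<^sup>2" for t
      by (simp add: k_def power_divide)
    then have "(norm (h m t - h n t))\<^sup>2 = 2 * (norm (h m t))\<^sup>2 + 2 * (norm (h n t))\<^sup>2 - 4 * (norm (k t))\<^sup>2" for t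
      by (simp add: power2_norm_eq_inner inner_diff inner_add inner_commute)
    then have "(\<integral>t. (norm (h m t - h n t))\<^sup>2 \<partial>M) = 2 * N (h m) + 2 * N (h n) - 4 * N k"
      unfolding N_def using Hint2[OF h(1)] Hint2[OF k] by simp
    moreover have "1 / real (Suc m) \<le> 1 / Suc n" using that by (simp add: field_simps)
    ultimately show ?thesis using h(2)[of n] h(2)[of m] i_le[OF k] by simp
  qed
  have cau: "\<exists>K. \<forall>a\<ge>K. \<forall>b\<ge>K. (\<integral>t. norm (h a t - h b t) \<partial>M) < e" if e: "e > 0" for e
  proof -
    \<comment> \<open>With this \<open>c\<close> the mass term is at most \<open>e / 2\<close>,
      while a squared L2 distance below \<open>c * e / 2\<close> makes the other term smaller than
      \<open>e / 2\<close>.\<close>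
    define c where "c = e / (2 * (measure M (space M) + 1))"
    have \<mu>: "measure M (space M) + 1 > 0" by (simp add: add_nonneg_pos)
    have "c > 0" using that \<mu> by (simp add: c_def)
    have "(\<lambda>n. 4 * inverse (real (Suc n))) \<longlonglongrightarrow> 4 * 0" by (intro tendsto_intros LIMSEQ_inverse_real_of_nat)
    from order_tendstoD(2)[OF this, of "c * e / 4"]
    have "eventually (\<lambda>n. 4 * inverse (real (Suc n)) < c * e / 4) sequentially"
      using that \<open>c > 0\<close> by simp
    then obtain K1 where K1: "\<And>n. n \<ge> K1 \<Longrightarrow> 4 / Suc n < c * e / 4"
      unfolding eventually_sequentially by (auto simp: field_simps)
    have "c * e / 8 > 0" using that \<open>c > 0\<close> by simp
    then obtain K2 where K2: "\<forall>m\<ge>K2. \<forall>n\<ge>K2. \<bar>i m - i n\<bar> < c * e / 8"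
      using Ci unfolding Cauchy_iff real_norm_def by blast
    have main: "(\<integral>t. norm (h m t - h n t) \<partial>M) < e" if nm: "n \<le> m" "n \<ge> max K1 K2" for n m
    proof -
      have 2: "(\<integral>t. (norm (h m t - h n t))\<^sup>2 \<partial>M) < c * e / 2"
      proof -
        have ge: "K1 \<le> n" "K2 \<le> n" "K2 \<le> m" using nm by auto
        have "\<bar>i m - i n\<bar> < c * e / 8" using K2 ge by blast
        then have "i m - i n < c * e / 8" by (simp only: abs_less_iff)
        then have "2 * (i m - i n) + 4 / real (Suc n) < 2 * (c * e / 8) + c * e / 4"
          using K1[OF ge(1)] by (intro add_strict_mono mult_strict_left_mono) simp_all
        also have "\<dots> = c * e / 2" by simp
        finally show ?thesis using par[OF nm(1)] by (rule le_less_trans[rotated])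
      qed
      have int2: "integrable M (\<lambda>t. (norm (h m t - h n t))\<^sup>2)"
      proof (rule integrable_norm_square)
        show "AE t in M. norm (h m t - h n t) \<le> R + R"
          using HR[OF h(1)[of m]] HR[OF h(1)[of n]]
          by eventually_elim (rule order_trans[OF norm_triangle_ineq4 add_mono])
      qed (use Hm[OF h(1)] in measurable)
      have "(\<integral>t. norm (h m t - h n t) \<partial>M) \<le> (\<integral>t. c + (norm (h m t - h n t))\<^sup>2 / c \<partial>M)"
      proof (rule integral_mono)
        show "integrable M (\<lambda>t. norm (h m t - h n t))" using Hint[OF h(1)] by auto
        show "integrable M (\<lambda>t. c + (norm (h m t - h n t))\<^sup>2 / c)" using int2 by auto
        show "norm (h m t - h n t) \<le> c + (norm (h m t - h n t))\<^sup>2 / c" for t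
          using \<open>c > 0\<close> by (rule le_add_power2_divide) simp
      qed
      also have "\<dots> = measure M (space M) * c + (\<integral>t. (norm (h m t - h n t))\<^sup>2 \<partial>M) / c"
        using int2 by simp
      also have "\<dots> < measure M (space M) * c + e / 2"
        using 2 \<open>c > 0\<close> by (simp add: field_simps)
      also have "measure M (space M) * c \<le> e / 2" using \<mu> e by (simp add: c_def field_simps)
      finally show ?thesis by simp
    qed
    show ?thesis
    proof (intro exI[of _ "max K1 K2"] allI impI)
      fix a b assume "max K1 K2 \<le> a" "max K1 K2 \<le> b"
      then show "(\<integral>t. norm (h a t - h b t) \<partial>M) < e"
        using main[of a b] main[of b a] by (cases "a \<le> b") (simp_all add: norm_minus_commute)
    qed
  qed
  have "\<exists>r. strict_mono r \<and> (AE t in M. Cauchy (\<lambda>i. h (r i) t))"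
  proof (rule cauchy_L1_AE_cauchy_subseq[of M h])
    show "integrable M (h n)" for n by (rule Hint[OF h(1)])
    show "\<exists>N. \<forall>i\<ge>N. \<forall>j\<ge>N. (\<integral>t. norm (h i t - h j t) \<partial>M) < e" if "e > 0" for e
      by (rule cau[OF that])
  qed blast
  then obtain r where r: "strict_mono r" "AE t in M. Cauchy (\<lambda>i. h (r i) t)" by blast
  show thesis
  proof (rule that)
    \<comment> \<open>Since \<open>r n \<ge> n\<close>, the subsequence still takes its values in
      the hulls of the tails.\<close>
    show "h (r n) \<in> midpoint_hull (f ` {n..})" for n
      using h(1)[of "r n"] Hdec[OF seq_suble[OF r(1), of n]] unfolding H_def by blast
    show "(\<lambda>t. lim (\<lambda>n. h (r n) t)) \<in> borel_measurable M"
      using Hm[OF h(1)] by (intro borel_measurable_lim_metric) auto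
    show "AE t in M. (\<lambda>n. h (r n) t) \<longlonglongrightarrow> lim (\<lambda>n. h (r n) t)"
      using r(2) by eventually_elim (simp add: Cauchy_convergent_iff convergent_LIMSEQ_iff)
  qed
qed

section \<open>Bounded sequences on the purely atomic part\<close>

text \<open>If a real function exceeded its mean on a nonnull part of the atom, it would do so
  almost everywhere on the atom, which is absurd. This is applied to both signs and to each
  coordinate.\<close>

lemma (in finite_measure) AE_const_on_atom:
  fixes f :: "'a \<Rightarrow> 'e::euclidean_space"
  assumes A: "is_atom M A" and f: "integrable M f"
  shows "AE t in M. t \<in> A \<longrightarrow> f t = (1 / measure M A) *\<^sub>R (\<integral>t. indicator A t *\<^sub>R f t \<partial>M)"
proof -
  have AM [measurable]: "A \<in> sets M" and Apos: "emeasure M A > 0"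
    and atom: "\<And>B. B \<in> sets M \<Longrightarrow> B \<subseteq> A \<Longrightarrow> emeasure M B = 0 \<or> emeasure M (A - B) = 0"
    using A by (auto simp: is_atom_def)
  have mA: "measure M A > 0" using Apos by (simp add: emeasure_eq_measure)
  have real: "AE t in M. t \<in> A \<longrightarrow> F t \<le> (\<integral>t. indicator A t * F t \<partial>M) / measure M A"
    if F: "integrable M F" for F :: "'a \<Rightarrow> real"
  proof -
    define a where "a = (\<integral>t. indicator A t * F t \<partial>M) / measure M A"
    have [measurable]: "F \<in> borel_measurable M" using F by simp
    define B where "B = {t \<in> space M. t \<in> A \<and> a < F t}"
    have BM: "B \<in> sets M" unfolding B_def by measurable
    have "emeasure M B = 0"
    proof (rule ccontr)
      assume "emeasure M B \<noteq> 0"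
      then have "emeasure M (A - B) = 0" using atom[OF BM] by (auto simp: B_def)
      then have AE1: "AE t in M. t \<notin> A - B" using BM AM by (intro AE_not_in) (auto simp: null_sets_def)
      have int: "integrable M (\<lambda>t. indicator A t * (F t - a))"
        using F by (intro integrable_real_mult_indicator[of A M "\<lambda>t. F t - a", simplified mult.commute]) auto
      have eq: "(\<integral>t. indicator A t * (F t - a) \<partial>M) = 0"
      proof -
        have "integrable M (\<lambda>t. indicator A t * F t)"
          using integrable_real_mult_indicator[OF AM F] by (simp add: mult_ac)
        moreover have "integrable M (\<lambda>t. indicator A t * a)"
          using AM by (intro integrable_mult_left integrable_real_indicator) (auto simp: less_top[symmetric])
        ultimately have "(\<integral>t. indicator A t * (F t - a) \<partial>M) = (\<integral>t. indicator A t * F t \<partial>M) - measure M A * a"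
          using AM sets.sets_into_space[OF AM] by (simp add: right_diff_distrib Int_absorb2)
        then show ?thesis using mA by (simp add: a_def)
      qed
      have nn: "AE t in M. 0 \<le> indicator A t * (F t - a)"
        using AE1 by eventually_elim (auto simp: B_def indicator_def)
      have "AE t in M. indicator A t * (F t - a) = 0"
        using integral_nonneg_eq_0_iff_AE[OF int nn] eq by simp
      then have "AE t in M. t \<notin> A"
        using AE1 by eventually_elim (auto simp: B_def)
      then have "emeasure M A = 0" by (simp add: AE_iff_null_sets[OF AM] null_setsD1)
      with Apos show False by simp
    qed
    then have "AE t in M. t \<notin> B" using BM by (intro AE_not_in) (auto simp: null_sets_def)
    then show ?thesis using AE_space by eventually_elim (auto simp: B_def a_def[symmetric])
  qed
  have real_eq: "AE t in M. t \<in> A \<longrightarrow> F t = (\<integral>t. indicator A t * F t \<partial>M) / measure M A"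
    if F: "integrable M F" for F :: "'a \<Rightarrow> real"
  proof -
    have "AE t in M. t \<in> A \<longrightarrow> - F t \<le> (\<integral>t. indicator A t * - F t \<partial>M) / measure M A"
      using F by (intro real) simp
    with real[OF F] show ?thesis by eventually_elim auto
  qed
  have "AE t in M. \<forall>b\<in>Basis. t \<in> A \<longrightarrow> f t \<bullet> b = (\<integral>t. indicator A t * (f t \<bullet> b) \<partial>M) / measure M A"
    using f by (intro AE_finite_allI finite_Basis real_eq) auto
  then show ?thesis
  proof eventually_elim
    case (elim t)
    show ?case
    proof
      assume "t \<in> A"
      show "f t = (1 / measure M A) *\<^sub>R (\<integral>t. indicator A t *\<^sub>R f t \<partial>M)"
      proof (rule euclidean_eqI)
        fix b :: 'e assume b: "b \<in> Basis"
        have "(\<integral>t. indicator A t *\<^sub>R f t \<partial>M) \<bullet> b = (\<integral>t. (indicator A t *\<^sub>R f t) \<bullet> b \<partial>M)"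
          using integrable_mult_indicator[OF AM f] by (intro integral_inner_left[symmetric]) auto
        then show "f t \<bullet> b = (1 / measure M A) *\<^sub>R (\<integral>t. indicator A t *\<^sub>R f t \<partial>M) \<bullet> b"
          using elim b \<open>t \<in> A\<close> by simp
      qed
    qed
  qed
qed

lemma compact_subsequence:
  fixes f :: "nat \<Rightarrow> 'x::first_countable_topology"
  assumes "compact K" "\<And>n. f n \<in> K"
  shows "\<exists>l\<in>K. \<exists>r::nat \<Rightarrow> nat. strict_mono r \<and> (\<lambda>n. f (r n)) \<longlonglongrightarrow> l"
  using compact_imp_seq_compact[OF assms(1), unfolded seq_compact_def, rule_format, of f] assms(2)
  by (auto simp: o_def)

text \<open>Exhaustion: some countable family of atoms inside \<open>T\<close> has a union of
  maximal measure, and a nonnull remainder of \<open>T\<close> would contain one more atom.\<close>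

lemma (in finite_measure) purely_atomic_countable_atoms:
  assumes T [measurable]: "T \<in> sets M" and pa: "purely_atomic (density M (indicator T))"
  obtains \<C> where "countable \<C>" "\<And>A. A \<in> \<C> \<Longrightarrow> is_atom M A" "AE t in M. t \<in> T \<longrightarrow> t \<in> \<Union>\<C>"
proof -
  \<comment> \<open>The restricted measure agrees with \<open>M\<close> on subsets of
    \<open>T\<close>, so its atoms inside \<open>T\<close> are atoms of \<open>M\<close>.\<close>
  have atom_in: "\<exists>A\<subseteq>B. is_atom M A" if B: "B \<in> sets M" "B \<subseteq> T" "emeasure M B > 0" for B
  proof -
    have dens: "emeasure (density M (indicator T)) C = emeasure M C" if "C \<in> sets M" "C \<subseteq> T" for C
      using that emeasure_restricted[OF T that(1)] by (simp add: Int_absorb1)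
    obtain A where A: "A \<subseteq> B" "is_atom (density M (indicator T)) A"
      using pa B dens[OF B(1,2)] unfolding purely_atomic_def by auto
    have AT: "A \<subseteq> T" using A(1) B(2) by blast
    have AM: "A \<in> sets M" using A(2) by (simp add: is_atom_def)
    have "emeasure M C = 0 \<or> emeasure M (A - C) = 0" if C: "C \<in> sets M" "C \<subseteq> A" for C
    proof -
      have "emeasure (density M (indicator T)) C = 0 \<or> emeasure (density M (indicator T)) (A - C) = 0"
        using A(2) C by (simp add: is_atom_def)
      moreover have "C \<subseteq> T" "A - C \<subseteq> T" using C(2) AT by blast+
      ultimately show ?thesis using dens[of C] dens[of "A - C"] C(1) AM by simp
    qed
    moreover have "emeasure M A > 0" using A(2) dens[OF AM AT] by (simp add: is_atom_def)
    ultimately have "is_atom M A" using AM by (simp add: is_atom_def)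
    with A(1) show ?thesis by blast
  qed
  define F where "F = {\<C>. countable \<C> \<and> (\<forall>A\<in>\<C>. is_atom M A \<and> A \<subseteq> T)}"
  define m where "m \<C> = measure M (\<Union>\<C>)" for \<C>
  have Fs: "\<Union>\<C> \<in> sets M" if "\<C> \<in> F" for \<C>
    using that by (intro sets.countable_Union) (auto simp: F_def is_atom_def)
  have bdd: "bdd_above (m ` F)"
    by (rule bdd_aboveI[of _ "measure M (space M)"]) (auto simp: m_def bounded_measure)
  have ne: "F \<noteq> {}" by (auto simp: F_def)
  have "\<exists>\<C>\<in>F. (SUP \<C>\<in>F. m \<C>) - 1 / Suc n < m \<C>" for n
    using less_cSUP_iff[OF ne bdd, of "(SUP \<C>\<in>F. m \<C>) - 1 / Suc n"] by simp
  then obtain c where c: "\<And>n. c n \<in> F" "\<And>n. (SUP \<C>\<in>F. m \<C>) - 1 / Suc n < m (c n)" by metis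
  define \<C> where "\<C> = (\<Union>n. c n)"
  have \<C>F: "\<C> \<in> F" using c(1) unfolding \<C>_def F_def by auto
  have "(SUP \<C>\<in>F. m \<C>) \<le> m \<C>"
  proof (rule field_le_epsilon)
    fix e :: real assume "e > 0"
    then obtain n where n: "1 / Suc n < e" using nat_approx_posE by (metis inverse_eq_divide of_nat_Suc)
    have "m (c n) \<le> m \<C>"
      unfolding m_def using Fs[OF \<C>F] by (intro finite_measure_mono) (auto simp: \<C>_def)
    with c(2)[of n] n show "(SUP \<C>\<in>F. m \<C>) \<le> m \<C> + e" by linarith
  qed
  have null: "emeasure M (T - \<Union>\<C>) = 0"
  proof (rule ccontr)
    assume "emeasure M (T - \<Union>\<C>) \<noteq> 0"
    then obtain A where A: "A \<subseteq> T - \<Union>\<C>" "is_atom M A"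
      using atom_in[of "T - \<Union>\<C>"] Fs[OF \<C>F] T by (auto simp: zero_less_iff_neq_zero)
    then have AM: "A \<in> sets M" "measure M A > 0" by (auto simp: is_atom_def emeasure_eq_measure)
    have "insert A \<C> \<in> F" using A \<C>F by (auto simp: F_def)
    then have "m (insert A \<C>) \<le> (SUP \<C>\<in>F. m \<C>)" using bdd by (intro cSUP_upper)
    moreover have "m (insert A \<C>) = measure M A + m \<C>"
      unfolding m_def using A(1) AM(1) Fs[OF \<C>F] by (simp, intro finite_measure_Union) auto
    ultimately show False using \<open>(SUP \<C>\<in>F. m \<C>) \<le> m \<C>\<close> AM(2) by linarith
  qed
  have "AE t in M. t \<notin> T - \<Union>\<C>"
    using null Fs[OF \<C>F] T by (intro AE_not_in) (auto simp: null_sets_def)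
  then have "AE t in M. t \<in> T \<longrightarrow> t \<in> \<Union>\<C>" by eventually_elim auto
  with \<C>F show thesis by (intro that[of \<C>]) (auto simp: F_def)
qed

text \<open>On each of countably many atoms \<open>f n\<close> is almost everywhere its mean
  \<open>c n A\<close>, so pointwise convergence reduces to bounded vector sequences and a diagonal
  subsequence.\<close>

lemma (in finite_measure) purely_atomic_AE_convergent_subseq:
  fixes f :: "nat \<Rightarrow> 'a \<Rightarrow> 'e::euclidean_space"
  assumes T: "T \<in> sets M" "purely_atomic (density M (indicator T))"
    and fm: "\<And>n. f n \<in> borel_measurable M" and fR: "\<And>n. AE t in M. norm (f n t) \<le> R"
  obtains r where "strict_mono r" "AE t in M. t \<in> T \<longrightarrow> convergent (\<lambda>n. f (r n) t)"
proof -
  obtain \<C> where \<C>: "countable \<C>" "\<And>A. A \<in> \<C> \<Longrightarrow> is_atom M A" "AE t in M. t \<in> T \<longrightarrow> t \<in> \<Union>\<C>"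
    by (rule purely_atomic_countable_atoms[OF T]) (rule that; assumption)
  have fint: "integrable M (f n)" for n using fR fm by (rule integrable_const_bound)
  define c where "c n A = (1 / measure M A) *\<^sub>R (\<integral>t. indicator A t *\<^sub>R f n t \<partial>M)" for n A
  have cR: "\<exists>B. \<forall>n. norm (c n A) \<le> B" if "A \<in> sets M" for A
  proof -
    have "norm (\<integral>t. indicator A t *\<^sub>R f n t \<partial>M) \<le> \<bar>R\<bar> * measure M (space M)" for n
    proof (rule norm_integral_le[OF integrable_mult_indicator[OF that fint]])
      show "AE t in M. norm (indicator A t *\<^sub>R f n t) \<le> \<bar>R\<bar>"
        using fR[of n] by eventually_elim (auto simp: indicator_def)
    qed
    then have "norm (c n A) \<le> \<bar>1 / measure M A\<bar> * (\<bar>R\<bar> * measure M (space M))" for n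
      unfolding c_def norm_scaleR by (intro mult_left_mono) auto
    then show ?thesis by blast
  qed
  \<comment> \<open>This enumeration may repeat members, so finite families are covered; only the
    empty family needs its own case.\<close>
  define e where "e = from_nat_into \<C>"
  define P where "P i s \<longleftrightarrow> convergent (\<lambda>n. c (s n) (e i))" for i and s :: "nat \<Rightarrow> nat"
  have eC: "e i \<in> sets M" if "\<C> \<noteq> {}" for i
    using from_nat_into[OF that] \<C>(2) unfolding e_def is_atom_def by blast
  show thesis
  proof (cases "\<C> = {}")
    case True
    with \<C>(3) have "AE t in M. t \<in> T \<longrightarrow> convergent (\<lambda>n. f (id n) t)" by auto
    with strict_mono_id show thesis by (rule that)
  next
    case False
    interpret subseqs P
    proof
      fix i and s :: "nat \<Rightarrow> nat" assume "strict_mono s"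
      obtain B where B: "\<And>n. norm (c n (e i)) \<le> B" using cR[OF eC[OF False]] by blast
      then have "\<And>n. c (s n) (e i) \<in> cball 0 B" by simp
      then obtain l and r :: "nat \<Rightarrow> nat" where "strict_mono r" "(\<lambda>n. c (s (r n)) (e i)) \<longlonglongrightarrow> l"
        using compact_subsequence[OF compact_cball, of "\<lambda>n. c (s n) (e i)" 0 B] by blast
      then show "\<exists>r'. strict_mono r' \<and> P i (s \<circ> r')"
        unfolding P_def by (intro exI[of _ r]) (auto simp: convergent_def o_def)
    qed
    have conv: "convergent (\<lambda>n. c (diagseq n) (e i))" for i
    proof -
      have "P i (diagseq \<circ> (+) (Suc i))"
      proof (rule diagseq_holds)
        fix r s :: "nat \<Rightarrow> nat" and n assume "strict_mono r" "P n s"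
        then show "P n (s \<circ> r)"
          unfolding P_def convergent_def using LIMSEQ_subseq_LIMSEQ by (fastforce simp: o_def)
      qed
      then have "convergent (\<lambda>n. c (diagseq (n + Suc i)) (e i))" by (simp add: P_def o_def add.commute)
      then show ?thesis using convergent_ignore_initial_segment[of "\<lambda>n. c (diagseq n) (e i)" "Suc i"] by simp
    qed
    have "AE t in M. \<forall>A\<in>\<C>. \<forall>n. t \<in> A \<longrightarrow> f n t = c n A"
      unfolding AE_ball_countable[OF \<C>(1)] AE_all_countable c_def
      using AE_const_on_atom[OF \<C>(2) fint] by blast
    with \<C>(3) have "AE t in M. t \<in> T \<longrightarrow> convergent (\<lambda>n. f (diagseq n) t)"
    proof eventually_elim
      case (elim t)
      show ?case
      proof
        assume "t \<in> T"
        then obtain A where A: "A \<in> \<C>" "t \<in> A" using elim by blast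
        obtain i where "A = e i" unfolding e_def using from_nat_into_surj[OF \<C>(1) A(1)] by blast
        then show "convergent (\<lambda>n. f (diagseq n) t)" using conv[of i] elim(2) A by simp
      qed
    qed
    with subseq_diagseq show thesis by (rule that)
  qed
qed

section \<open>Limits of selections remain in the graph\<close>

text \<open>By compactness of \<open>G\<close>, the points \<open>w n\<close> eventually lie in any
  closed neighbourhood of the section over \<open>x\<close>. This neighbourhood is convex and
  compact, so it contains the averages \<open>g n\<close> and their limit. The hypothesis on
  \<open>g n\<close> places it in the convex hull of a tail of \<open>w\<close>.\<close>

lemma limit_of_hulls_in_section:
  fixes G :: "('p::euclidean_space \<times> 'q::euclidean_space) set"
  assumes G: "closed G" "bounded G" and conv: "convex {v. (x, v) \<in> G}"
    and uw: "\<And>n. (u n, w n) \<in> G" and u: "u \<longlonglongrightarrow> x"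
    and g: "\<And>n C. convex C \<Longrightarrow> (\<And>k. k \<ge> n \<Longrightarrow> w k \<in> C) \<Longrightarrow> g n \<in> C" and gl: "g \<longlonglongrightarrow> gl"
  shows "(x, gl) \<in> G"
proof -
  define S where "S = {v. (x, v) \<in> G}"
  have clS: "closed S"
  proof -
    have "S = (\<lambda>v. (x, v)) -` G" by (auto simp: S_def)
    then show ?thesis using G(1) by (auto intro!: closed_vimage continuous_intros)
  qed
  have "bounded S"
  proof -
    have "S \<subseteq> snd ` G" by (force simp: S_def)
    then show ?thesis using bounded_snd[OF G(2)] bounded_subset by blast
  qed
  have near: "\<exists>y\<in>S. dist y gl < e" if "e > 0" for e
  proof -
    define Se where "Se = {a + b | a b. a \<in> S \<and> b \<in> cball 0 (e / 2)}"
    have cSe: "compact Se"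
      unfolding Se_def using clS \<open>bounded S\<close> by (intro compact_sums) (auto simp: compact_eq_bounded_closed)
    have vSe: "convex Se"
    proof -
      have "Se = (\<Union>a\<in>S. \<Union>b\<in>cball 0 (e / 2). {a + b})" unfolding Se_def by blast
      then show ?thesis using convex_sums[of S "cball 0 (e / 2)"] conv by (simp add: S_def)
    qed
    have "eventually (\<lambda>n. w n \<in> Se) sequentially"
    proof (rule ccontr)
      assume "\<not> eventually (\<lambda>n. w n \<in> Se) sequentially"
      from not_eventually_sequentiallyD[OF this]
      obtain r :: "nat \<Rightarrow> nat" where r: "strict_mono r" "\<forall>n. w (r n) \<notin> Se" by blast
      have "compact G" using G by (simp add: compact_eq_bounded_closed)
      then obtain l q where q: "strict_mono (q :: nat \<Rightarrow> nat)" "(\<lambda>n. (u (r (q n)), w (r (q n)))) \<longlonglongrightarrow> l" "l \<in> G"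
        using compact_subsequence[of G "\<lambda>n. (u (r n), w (r n))"] uw by blast
      have "(\<lambda>n. u (r (q n))) \<longlonglongrightarrow> fst l" "(\<lambda>n. w (r (q n))) \<longlonglongrightarrow> snd l"
        using tendsto_fst[OF q(2)] tendsto_snd[OF q(2)] by simp_all
      moreover have "(\<lambda>n. u (r (q n))) \<longlonglongrightarrow> x"
        using LIMSEQ_subseq_LIMSEQ[OF LIMSEQ_subseq_LIMSEQ[OF u r(1)] q(1)] by (simp add: o_def)
      ultimately have "fst l = x" and wl: "(\<lambda>n. w (r (q n))) \<longlonglongrightarrow> snd l"
        using LIMSEQ_unique by blast+
      then have "snd l \<in> S" using q(3) by (auto simp: S_def)
      obtain n where "dist (w (r (q n))) (snd l) < e / 2"
        using wl \<open>e > 0\<close> unfolding lim_sequentially by (meson half_gt_zero le_refl)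
      then have "w (r (q n)) - snd l \<in> cball 0 (e / 2)" by (simp add: dist_norm norm_minus_commute)
      then have "snd l + (w (r (q n)) - snd l) \<in> Se" using \<open>snd l \<in> S\<close> unfolding Se_def by blast
      then show False using r(2) by simp
    qed
    then obtain n0 where n0: "\<And>n. n \<ge> n0 \<Longrightarrow> w n \<in> Se" unfolding eventually_sequentially by blast
    have "g n \<in> Se" if "n \<ge> n0" for n using that n0 by (intro g vSe) auto
    then have "gl \<in> Se"
      by (intro Lim_in_closed_set[OF compact_imp_closed[OF cSe] _ _ gl]) (auto simp: eventually_sequentially)
    then obtain a b where "a \<in> S" "norm b \<le> e / 2" "gl = a + b" unfolding Se_def by auto
    then have "dist a gl < e" using \<open>e > 0\<close> by (simp add: dist_norm)
    with \<open>a \<in> S\<close> show ?thesis by blast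
  qed
  have "gl \<in> S" using closed_approachable[OF clS] near by blast
  then show ?thesis by (simp add: S_def)
qed

text \<open>Only integrals of second components have to converge to that of \<open>v\<close>. On
  \<open>Tna\<close> this permits averaging; on \<open>Tpa\<close> sections need not be convex, so a
  genuine pointwise limit is extracted. The L2 hypothesis merges the first components into the
  single vector \<open>x\<close>.\<close>

lemma (in finite_measure) selections_closure:
  fixes \<Gamma> :: "'a \<Rightarrow> ('p::euclidean_space \<times> 'q::euclidean_space) set"
  assumes closed: "\<And>t. t \<in> space M \<Longrightarrow> closed (\<Gamma> t)"
    and bdd: "\<And>t. t \<in> space M \<Longrightarrow> \<Gamma> t \<subseteq> cball 0 R"
    and decomp: "atomic_decomposition M Tpa Tna"
    and conv: "AE t in M. t \<in> Tna \<longrightarrow> (\<forall>x. convex {v. (x, v) \<in> \<Gamma> t})"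
    and z: "\<And>n. z n \<in> selections M \<Gamma>"
    and xi: "bounded (range xi)"
    and L2: "(\<lambda>n. \<integral>t. (norm (fst (z n t) - xi n))\<^sup>2 \<partial>M) \<longlonglongrightarrow> 0"
  obtains r x v where "strict_mono r" "(\<lambda>n. xi (r n)) \<longlonglongrightarrow> x" "v \<in> borel_measurable M"
    "(\<lambda>n. \<integral>t. snd (z (r n) t) \<partial>M) \<longlonglongrightarrow> (\<integral>t. v t \<partial>M)" "AE t in M. (x, v t) \<in> \<Gamma> t"
proof -
  have Tm [measurable]: "Tpa \<in> sets M" "Tna \<in> sets M" and T: "Tpa \<inter> Tna = {}" "Tpa \<union> Tna = space M"
    and pa: "purely_atomic (density M (indicator Tpa))"
    using decomp by (auto simp: atomic_decomposition_def)
  have zm [measurable]: "z n \<in> borel_measurable M" and z\<Gamma>: "AE t in M. z n t \<in> \<Gamma> t" for n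
    using z[of n] by (auto simp: selections_def)
  have zR: "AE t in M. norm (z n t) \<le> R" for n
    using z\<Gamma>[of n] AE_space by eventually_elim (auto dest!: bdd[THEN subsetD])
  define U where "U n t = fst (z n t)" for n t
  define V where "V n t = snd (z n t)" for n t
  have [measurable]: "U n \<in> borel_measurable M" "V n \<in> borel_measurable M" for n
    unfolding U_def[abs_def] V_def[abs_def]
    by (rule borel_measurable_continuous_on[OF _ zm]; intro continuous_intros)+
  have L2U: "(\<lambda>n. \<integral>t. (norm (U n t - xi n))\<^sup>2 \<partial>M) \<longlonglongrightarrow> 0"
    using L2 by (simp add: U_def)
  have fs: "norm (fst p) \<le> norm p" "norm (snd p) \<le> norm p" for p :: "'p \<times> 'q"
    by (metis norm_fst_le prod.collapse, metis norm_snd_le prod.collapse)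
  obtain B where B: "\<And>n. norm (xi n) \<le> B" using xi unfolding bounded_iff by auto
  have "\<And>n. xi n \<in> cball 0 B" using B by simp
  then obtain x and r1 :: "nat \<Rightarrow> nat" where r1: "strict_mono r1" "(\<lambda>n. xi (r1 n)) \<longlonglongrightarrow> x"
    using compact_subsequence[OF compact_cball, of xi 0 B] by blast
  have int2: "integrable M (\<lambda>t. (norm (U n t - xi n))\<^sup>2)" for n
  proof (rule integrable_norm_square)
    show "AE t in M. norm (U n t - xi n) \<le> R + B"
      using zR[of n]
    proof eventually_elim
      case (elim t)
      then show ?case
        using norm_triangle_ineq4[of "U n t" "xi n"] fs(1)[of "z n t", folded U_def] B[of n] by linarith
    qed
  qed measurable
  have "\<exists>r. strict_mono r \<and> (AE t in M. (\<lambda>n. (norm (U (r1 (r n)) t - xi (r1 (r n))))\<^sup>2) \<longlonglongrightarrow> 0)"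
  proof (rule tendsto_L1_AE_subseq[of M "\<lambda>n t. (norm (U (r1 n) t - xi (r1 n)))\<^sup>2"])
    show "integrable M (\<lambda>t. (norm (U (r1 n) t - xi (r1 n)))\<^sup>2)" for n by (rule int2)
    show "(\<lambda>n. \<integral>t. norm ((norm (U (r1 n) t - xi (r1 n)))\<^sup>2) \<partial>M) \<longlonglongrightarrow> 0"
      using LIMSEQ_subseq_LIMSEQ[OF L2U r1(1)] by (simp add: o_def)
  qed
  then obtain r2 where r2: "strict_mono r2"
    "AE t in M. (\<lambda>n. (norm (U (r1 (r2 n)) t - xi (r1 (r2 n))))\<^sup>2) \<longlonglongrightarrow> 0" by blast
  have u2: "AE t in M. (\<lambda>n. U (r1 (r2 n)) t) \<longlonglongrightarrow> x"
    using r2(2)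
  proof eventually_elim
    case (elim t)
    have "(\<lambda>n. sqrt ((norm (U (r1 (r2 n)) t - xi (r1 (r2 n))))\<^sup>2)) \<longlonglongrightarrow> sqrt 0"
      by (intro tendsto_real_sqrt elim)
    then have "(\<lambda>n. U (r1 (r2 n)) t - xi (r1 (r2 n))) \<longlonglongrightarrow> 0"
      by (simp add: tendsto_norm_zero_iff)
    from tendsto_add[OF this LIMSEQ_subseq_LIMSEQ[OF r1(2) r2(1)]] show ?case by (simp add: o_def)
  qed
  have wR: "AE t in M. norm (V n t) \<le> R" for n
    using zR[of n] by eventually_elim (auto simp: V_def intro: order_trans[OF fs(2)])
  obtain r3 where r3: "strict_mono r3"
    "AE t in M. t \<in> Tpa \<longrightarrow> convergent (\<lambda>n. V (r1 (r2 (r3 n))) t)"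
    by (rule purely_atomic_AE_convergent_subseq[OF Tm(1) pa, of "\<lambda>n t. V (r1 (r2 n)) t" R])
      (use wR in \<open>auto intro: that\<close>)
  \<comment> \<open>The last extraction makes the integrals over \<open>Tna\<close> converge to
    \<open>\<beta>\<close>; averaging over tails will not change this limit.\<close>
  define I where "I n = (\<integral>t. indicator Tna t *\<^sub>R V n t \<partial>M)" for n
  have R0: "norm (indicator A t *\<^sub>R y) \<le> \<bar>R\<bar>" if "norm y \<le> R" for A t and y :: 'q
    using that by (auto simp: indicator_def)
  have wint: "integrable M (\<lambda>t. indicator A t *\<^sub>R V n t)" if [measurable]: "A \<in> sets M" for A n
    by (rule integrable_const_bound[of _ "\<bar>R\<bar>"]) (use wR[of n] R0 in \<open>auto elim!: eventually_mono\<close>)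
  have IR: "norm (I n) \<le> \<bar>R\<bar> * measure M (space M)" for n
    unfolding I_def
  proof (rule norm_integral_le[OF wint[OF Tm(2)]])
    show "AE t in M. norm (indicator Tna t *\<^sub>R V n t) \<le> \<bar>R\<bar>"
      using wR[of n] by eventually_elim (rule R0)
  qed
  have "\<And>n. I (r1 (r2 (r3 n))) \<in> cball 0 (\<bar>R\<bar> * measure M (space M))" using IR by simp
  then obtain \<beta> and r4 :: "nat \<Rightarrow> nat" where r4: "strict_mono r4" "(\<lambda>n. I (r1 (r2 (r3 (r4 n))))) \<longlonglongrightarrow> \<beta>"
    using compact_subsequence[OF compact_cball, of "\<lambda>n. I (r1 (r2 (r3 n)))" 0 "\<bar>R\<bar> * measure M (space M)"] by blast
  define r where "r n = r1 (r2 (r3 (r4 n)))" for n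
  have r34: "strict_mono (\<lambda>n. r3 (r4 n))" using strict_mono_o[OF r3(1) r4(1)] by (simp add: o_def)
  have r234: "strict_mono (\<lambda>n. r2 (r3 (r4 n)))" using strict_mono_o[OF r2(1) r34] by (simp add: o_def)
  have r: "strict_mono r" using strict_mono_o[OF r1(1) r234] by (simp add: o_def r_def[abs_def])
  define w where "w n t = V (r n) t" for n t
  have wm [measurable]: "w n \<in> borel_measurable M" for n unfolding w_def[abs_def] by measurable
  have u: "AE t in M. (\<lambda>n. U (r n) t) \<longlonglongrightarrow> x"
    using u2 by eventually_elim (use LIMSEQ_subseq_LIMSEQ[OF _ r34] in \<open>auto simp: o_def r_def\<close>)
  have wpa: "AE t in M. t \<in> Tpa \<longrightarrow> convergent (\<lambda>n. w n t)"
    using r3(2) by eventually_elim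
      (use convergent_subseq_convergent[OF _ r4(1)] in \<open>auto simp: o_def r_def w_def\<close>)
  have Ilim: "(\<lambda>n. \<integral>t. indicator Tna t *\<^sub>R w n t \<partial>M) \<longlonglongrightarrow> \<beta>"
    using r4(2) by (simp add: I_def w_def r_def o_def)
  have wR': "AE t in M. \<forall>n. norm (w n t) \<le> R"
    unfolding AE_all_countable w_def using wR by blast

  define f where "f n t = indicator Tna t *\<^sub>R w n t" for n t
  have fm: "f n \<in> borel_measurable M" for n unfolding f_def[abs_def] by measurable
  have fR: "AE t in M. norm (f n t) \<le> \<bar>R\<bar>" for n
    unfolding f_def using wR' by eventually_elim (intro R0, blast)
  have fint: "integrable M (f n)" for n using fR fm by (rule integrable_const_bound)
  obtain g gl where g: "\<And>n. g n \<in> midpoint_hull (f ` {n..})" "gl \<in> borel_measurable M"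
    "AE t in M. (\<lambda>n. g n t) \<longlonglongrightarrow> gl t"
    by (rule mazur_AE[OF fm fR]) (rule that; assumption)
  have gm [measurable]: "g n \<in> borel_measurable M" for n
    using midpoint_hull_measurable[OF g(1)] fm by blast
  have [measurable]: "gl \<in> borel_measurable M" by (rule g(2))
  have gconv: "g n t \<in> C" if "convex C" "\<And>k. k \<ge> n \<Longrightarrow> f k t \<in> C" for n t C
    using midpoint_hull_in_convex[OF g(1) that(1)] that(2) by auto
  have gR: "AE t in M. norm (g n t) \<le> \<bar>R\<bar>" for n
  proof -
    have "AE t in M. \<forall>k. norm (f k t) \<le> \<bar>R\<bar>" unfolding AE_all_countable using fR by blast
    then show ?thesis
    proof eventually_elim
      case (elim t)
      have "g n t \<in> cball 0 \<bar>R\<bar>" by (rule gconv) (use elim in auto)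
      then show ?case by simp
    qed
  qed
  have glint: "(\<lambda>n. integral\<^sup>L M (g n)) \<longlonglongrightarrow> integral\<^sup>L M gl"
    by (rule integral_dominated_convergence[where w = "\<lambda>_. \<bar>R\<bar>"]) (use g(3) gR in auto)
  \<comment> \<open>A ball about \<open>\<beta>\<close> is convex and contains the integrals of a
    tail of \<open>f\<close>, hence also those of the averages.\<close>
  have "(\<lambda>n. integral\<^sup>L M (g n)) \<longlonglongrightarrow> \<beta>"
    unfolding lim_sequentially
  proof (intro allI impI)
    fix e :: real assume "e > 0"
    then obtain n0 where n0: "\<And>n. n \<ge> n0 \<Longrightarrow> dist (integral\<^sup>L M (f n)) \<beta> < e"
      using Ilim unfolding lim_sequentially f_def[abs_def] by blast
    have "dist (integral\<^sup>L M (g n)) \<beta> < e" if "n \<ge> n0" for n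
    proof -
      have "integrable M (g n) \<and> integral\<^sup>L M (g n) \<in> ball \<beta> e"
        by (rule midpoint_hull_integral_in_convex[OF g(1)])
          (use n0 that fint in \<open>auto simp: dist_commute\<close>)
      then show ?thesis by (simp add: dist_commute)
    qed
    then show "\<exists>n0. \<forall>n\<ge>n0. dist (integral\<^sup>L M (g n)) \<beta> < e" by blast
  qed
  then have gl\<beta>: "integral\<^sup>L M gl = \<beta>" using glint LIMSEQ_unique by blast
  define h where "h t = lim (\<lambda>n. indicator Tpa t *\<^sub>R w n t)" for t
  have hm [measurable]: "h \<in> borel_measurable M"
    unfolding h_def by (rule borel_measurable_lim_metric) measurable
  have hconv: "AE t in M. (\<lambda>n. indicator Tpa t *\<^sub>R w n t) \<longlonglongrightarrow> h t"
    using wpa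
  proof eventually_elim
    case (elim t)
    then have "convergent (\<lambda>n. indicator Tpa t *\<^sub>R w n t)"
      by (cases "t \<in> Tpa") (auto simp: convergent_const)
    then show ?case by (simp add: h_def convergent_LIMSEQ_iff)
  qed
  have hR: "AE t in M. norm (indicator Tpa t *\<^sub>R w n t) \<le> \<bar>R\<bar>" for n
    using wR' by eventually_elim (intro R0, blast)
  have hint: "integrable M h"
    by (rule integrable_dominated_convergence[where w = "\<lambda>_. \<bar>R\<bar>", OF hm _ _ hconv hR]) simp_all
  have hlim: "(\<lambda>n. \<integral>t. indicator Tpa t *\<^sub>R w n t \<partial>M) \<longlonglongrightarrow> integral\<^sup>L M h"
    by (rule integral_dominated_convergence[where w = "\<lambda>_. \<bar>R\<bar>", OF hm _ _ hconv hR]) simp_all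
  have glintegrable: "integrable M gl"
    by (rule integrable_dominated_convergence[where w = "\<lambda>_. \<bar>R\<bar>" and s = g]) (use g(3) gR in auto)
  \<comment> \<open>The summands have complementary supports: up to null sets, \<open>h\<close>
    vanishes off \<open>Tpa\<close> and \<open>gl\<close> vanishes off \<open>Tna\<close>.\<close>
  define v where "v t = h t + gl t" for t
  have vm: "v \<in> borel_measurable M" unfolding v_def[abs_def] by measurable
  have wsplit: "(\<integral>t. w n t \<partial>M) = (\<integral>t. indicator Tpa t *\<^sub>R w n t \<partial>M) + (\<integral>t. indicator Tna t *\<^sub>R w n t \<partial>M)" for n
  proof -
    have "(\<integral>t. w n t \<partial>M) = (\<integral>t. indicator Tpa t *\<^sub>R w n t + indicator Tna t *\<^sub>R w n t \<partial>M)"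
      by (rule Bochner_Integration.integral_cong) (use T in \<open>auto simp: indicator_def\<close>)
    also have "\<dots> = (\<integral>t. indicator Tpa t *\<^sub>R w n t \<partial>M) + (\<integral>t. indicator Tna t *\<^sub>R w n t \<partial>M)"
      using wint by (intro Bochner_Integration.integral_add) (auto simp: w_def)
    finally show ?thesis .
  qed
  have "(\<lambda>n. \<integral>t. w n t \<partial>M) \<longlonglongrightarrow> integral\<^sup>L M h + \<beta>"
    unfolding wsplit by (intro tendsto_add hlim Ilim)
  also have "integral\<^sup>L M h + \<beta> = (\<integral>t. v t \<partial>M)"
    unfolding v_def gl\<beta>[symmetric] using hint glintegrable by simp
  finally have vlim: "(\<lambda>n. \<integral>t. snd (z (r n) t) \<partial>M) \<longlonglongrightarrow> (\<integral>t. v t \<partial>M)" by (simp add: w_def V_def)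
  have z\<Gamma>': "AE t in M. \<forall>n. z (r n) t \<in> \<Gamma> t" unfolding AE_all_countable using z\<Gamma> by blast
  have "AE t in M. (x, v t) \<in> \<Gamma> t"
    using u hconv g(3) z\<Gamma>' conv AE_space
  proof eventually_elim
    case (elim t)
    have zuw: "(U (r n) t, w n t) \<in> \<Gamma> t" for n using elim(4) by (simp add: w_def U_def V_def)
    show ?case
    proof (cases "t \<in> Tpa")
      case True
      then have "t \<notin> Tna" using T by blast
      have "f n t = 0" for n using \<open>t \<notin> Tna\<close> by (simp add: f_def)
      then have "g n t \<in> {0}" for n by (intro gconv) auto
      then have "gl t = 0" using elim(3) LIMSEQ_unique[OF _ tendsto_const[of "0::'q"]] by simp
      then have "(\<lambda>n. w n t) \<longlonglongrightarrow> v t" using elim(2) True by (simp add: v_def)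
      from closed_sequentially[OF closed[OF elim(6)] zuw tendsto_Pair[OF elim(1) this]] show ?thesis .
    next
      case False
      then have "t \<in> Tna" using T elim(6) by blast
      have "h t = 0" using elim(2) False LIMSEQ_unique[OF _ tendsto_const[of "0::'q"]] by simp
      then have "v t = gl t" by (simp add: v_def)
      moreover have "(x, gl t) \<in> \<Gamma> t"
      proof (rule limit_of_hulls_in_section)
        show "closed (\<Gamma> t)" "bounded (\<Gamma> t)"
          using closed bdd elim(6) bounded_subset[OF bounded_cball] by blast+
        show "convex {v. (x, v) \<in> \<Gamma> t}" using elim(5) \<open>t \<in> Tna\<close> by blast
        show "(U (r n) t, w n t) \<in> \<Gamma> t" for n by (rule zuw)
        show "(\<lambda>n. U (r n) t) \<longlonglongrightarrow> x" by (rule elim(1))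
        show "g n t \<in> C" if "convex C" "\<And>k. k \<ge> n \<Longrightarrow> w k t \<in> C" for n C
          by (rule gconv[OF that(1)]) (use that(2) \<open>t \<in> Tna\<close> in \<open>simp add: f_def\<close>)
        show "(\<lambda>n. g n t) \<longlonglongrightarrow> gl t" by (rule elim(3))
      qed
      ultimately show ?thesis by simp
    qed
  qed
  moreover have "(\<lambda>n. xi (r n)) \<longlonglongrightarrow> x"
    using LIMSEQ_subseq_LIMSEQ[OF r1(2) r234] by (simp add: o_def r_def)
  ultimately show thesis using r vm vlim by (intro that[of r x v])
qed

section \<open>The penalized problem\<close>

lemma (in finite_measure) AE_nonpos_of_set_integrals:
  fixes f :: "'a \<Rightarrow> real"
  assumes f: "integrable M f" and le: "\<And>A. A \<in> sets M \<Longrightarrow> (\<integral>t. indicator A t * f t \<partial>M) \<le> 0"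
  shows "AE t in M. f t \<le> 0"
proof -
  have [measurable]: "f \<in> borel_measurable M" using f by simp
  define A where "A = {t \<in> space M. 0 < f t}"
  have A: "A \<in> sets M" unfolding A_def by measurable
  have int: "integrable M (\<lambda>t. indicator A t * f t)"
    using integrable_mult_indicator[OF A f] by simp
  have nn: "AE t in M. 0 \<le> indicator A t * f t" by (auto simp: A_def indicator_def)
  have "(\<integral>t. indicator A t * f t \<partial>M) = 0"
    using le[OF A] integral_nonneg_AE[OF nn] by simp
  then have "AE t in M. indicator A t * f t = 0" using integral_nonneg_eq_0_iff_AE[OF int nn] by simp
  then show ?thesis using AE_space by eventually_elim (auto simp: A_def indicator_def split: if_splits)
qed

text \<open>With \<open>\<xi>\<close> the mean of the first component, \<open>J\<close> is the objective
  \<open>- \<langle>x\<^sup>*, \<xi>\<rangle> + \<langle>y\<^sup>*, b\<rangle> + C(\<bar>\<xi>\<bar>\<^sup>2 + \<bar>b\<bar>\<^sup>2)\<close> plus the penalties; taking the mean for the global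
  decision makes its stationarity condition automatic.\<close>

lemma (in finite_measure) penalized_minimizer:
  fixes \<Gamma> :: "'a \<Rightarrow> ('p::euclidean_space \<times> 'q::euclidean_space) set" and xstar :: 'p and ystar :: 'q
    and R C p \<eta> \<Lambda> :: real
  defines "K \<equiv> measure M (space M)"
  defines "L \<equiv> norm xstar * R / K + norm ystar * R + C * (3 * R\<^sup>2 / K + 3 * R\<^sup>2 * K) + 2 * \<Lambda> * R\<^sup>2"
  assumes graph: "{(t, x). t \<in> space M \<and> x \<in> \<Gamma> t} \<in> sets (M \<Otimes>\<^sub>M borel)"
    and closed: "\<And>t. t \<in> space M \<Longrightarrow> closed (\<Gamma> t)"
    and bdd: "\<And>t. t \<in> space M \<Longrightarrow> \<Gamma> t \<subseteq> cball 0 R" and R: "R \<ge> 0"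
    and zero: "AE t in M. 0 \<in> \<Gamma> t"
    and K: "K > 0" and C: "C \<ge> 0" and p: "p > 0" and \<eta>: "\<eta> \<ge> 0" and \<Lambda>: "\<Lambda> > 0"
  obtains u v wu wv \<xi> b where
    "(\<lambda>t. (u t, v t)) \<in> selections M \<Gamma>"
    "wu \<in> borel_measurable M" "wv \<in> borel_measurable M"
    "AE t in M. norm (wu t) \<le> \<Lambda> * R \<and> norm (wv t) \<le> \<Lambda> * R"
    "(\<integral>t. u t \<partial>M) = K *\<^sub>R \<xi>" "b = (\<integral>t. v t \<partial>M)" "norm \<xi> \<le> R" "norm b \<le> R * K"
    "- (xstar \<bullet> \<xi>) + ystar \<bullet> b + C * ((norm \<xi>)\<^sup>2 + (norm b)\<^sup>2) +
       \<eta> * (\<integral>t. (norm (v t))\<^sup>2 \<partial>M) + p * (\<integral>t. (norm (u t - \<xi>))\<^sup>2 \<partial>M) \<le> 2 * \<Lambda> * R\<^sup>2 * K"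
    "AE t in M. - ((- (1 / K) *\<^sub>R xstar + (2 * C / K) *\<^sub>R \<xi> + (2 * p) *\<^sub>R (u t - \<xi>) + (2 * \<Lambda>) *\<^sub>R u t - 2 *\<^sub>R wu t,
        ystar + (2 * C) *\<^sub>R b + (2 * \<eta> + 2 * \<Lambda>) *\<^sub>R v t - 2 *\<^sub>R wv t)) \<in> regular_normal_cone (u t, v t) (\<Gamma> t)"
    "AE t in M. (norm (u t - \<xi>))\<^sup>2 \<le> (norm \<xi>)\<^sup>2 + L / p"
proof -
  let ?Z = "selections M \<Gamma>"
  have zm: "z \<in> borel_measurable M" and z\<Gamma>: "AE t in M. z t \<in> \<Gamma> t" if "z \<in> ?Z" for z
    using that by (auto simp: selections_def)
  have zR: "AE t in M. norm (z t) \<le> R" if "z \<in> ?Z" for z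
    using z\<Gamma>[OF that] AE_space by eventually_elim (auto dest!: bdd[THEN subsetD])
  have fs: "norm (fst q) \<le> norm q" "norm (snd q) \<le> norm q" for q :: "'p \<times> 'q"
    by (metis norm_fst_le prod.collapse, metis norm_snd_le prod.collapse)
  have fm: "(\<lambda>t. fst (z t)) \<in> borel_measurable M" and sm: "(\<lambda>t. snd (z t)) \<in> borel_measurable M"
    if "z \<in> ?Z" for z
    by (rule borel_measurable_continuous_on[OF _ zm[OF that]]; intro continuous_intros)+
  have fR: "AE t in M. norm (fst (z t)) \<le> R" and sR: "AE t in M. norm (snd (z t)) \<le> R" if "z \<in> ?Z" for z
    using zR[OF that] by (eventually_elim, blast intro: order_trans fs)+
  have fint: "integrable M (\<lambda>t. fst (z t))" and sint: "integrable M (\<lambda>t. snd (z t))"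
    and zint: "integrable M z" if "z \<in> ?Z" for z
    using fR[OF that] fm[OF that] sR[OF that] sm[OF that] zR[OF that] zm[OF that]
    by (auto intro: integrable_const_bound)
  note sq_int = integrable_norm_square
  have in_int: "integrable M (\<lambda>t. h t \<bullet> w t)"
    if "h \<in> borel_measurable M" "AE t in M. norm (h t) \<le> R" "w \<in> borel_measurable M" "AE t in M. norm (w t) \<le> S"
    for h w :: "'a \<Rightarrow> 'p \<times> 'q" and S
  proof (rule integrable_const_bound)
    show "AE t in M. norm (h t \<bullet> w t) \<le> R * \<bar>S\<bar>"
      using that(2,4)
    proof eventually_elim
      case (elim t)
      have "norm (h t \<bullet> w t) \<le> norm (h t) * norm (w t)" by (simp add: Cauchy_Schwarz_ineq2)
      also have "\<dots> \<le> R * \<bar>S\<bar>" using elim R by (intro mult_mono) auto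
      finally show ?case .
    qed
  qed (use that in measurable)
  define \<xi> where "\<xi> z = (1 / K) *\<^sub>R (\<integral>t. fst (z t) \<partial>M)" for z :: "'a \<Rightarrow> 'p \<times> 'q"
  define b where "b z = (\<integral>t. snd (z t) \<partial>M)" for z :: "'a \<Rightarrow> 'p \<times> 'q"
  have \<xi>K: "(\<integral>t. fst (z t) \<partial>M) = K *\<^sub>R \<xi> z" for z using K by (simp add: \<xi>_def)
  define F where "F z = - (xstar \<bullet> \<xi> z) + ystar \<bullet> b z + C * ((norm (\<xi> z))\<^sup>2 + (norm (b z))\<^sup>2)" for z
  \<comment> \<open>The penalty is the variance, rewritten by the identity \<open>Jvar\<close>. Thus
    the objective splits into integrals of pointwise expressions and a function of
    \<open>\<xi> z\<close> and \<open>b z\<close> alone.\<close>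
  define J where "J z = F z + (\<eta> * (\<integral>t. (norm (snd (z t)))\<^sup>2 \<partial>M) +
    p * ((\<integral>t. (norm (fst (z t)))\<^sup>2 \<partial>M) - K * (norm (\<xi> z))\<^sup>2))" for z
  have Jvar: "(\<integral>t. (norm (fst (z t) - \<xi> z))\<^sup>2 \<partial>M) = (\<integral>t. (norm (fst (z t)))\<^sup>2 \<partial>M) - K * (norm (\<xi> z))\<^sup>2"
    if z: "z \<in> ?Z" for z
  proof -
    have eq: "(norm (fst (z t) - \<xi> z))\<^sup>2 = (norm (fst (z t)))\<^sup>2 - 2 * (\<xi> z \<bullet> fst (z t)) + (norm (\<xi> z))\<^sup>2" for t
      by (simp add: power2_norm_eq_inner inner_diff inner_commute)
    have "(\<integral>t. (norm (fst (z t) - \<xi> z))\<^sup>2 \<partial>M) =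
        (\<integral>t. (norm (fst (z t)))\<^sup>2 \<partial>M) - 2 * (\<xi> z \<bullet> (\<integral>t. fst (z t) \<partial>M)) + K * (norm (\<xi> z))\<^sup>2"
      unfolding eq K_def using sq_int[OF fm[OF z] fR[OF z]] fint[OF z] by (simp add: mult_ac)
    also have "\<dots> = (\<integral>t. (norm (fst (z t)))\<^sup>2 \<partial>M) - K * (norm (\<xi> z))\<^sup>2"
      by (simp add: \<xi>K power2_norm_eq_inner)
    finally show ?thesis .
  qed
  note int_le = norm_integral_le[folded K_def]
  have \<xi>R: "norm (\<xi> z) \<le> R" if z: "z \<in> ?Z" for z
    using int_le[OF fint[OF z] fR[OF z]] K by (simp add: \<xi>_def field_simps)
  have bR: "norm (b z) \<le> R * K" if z: "z \<in> ?Z" for z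
    unfolding b_def by (rule int_le[OF sint[OF z] sR[OF z]])
  have F_ge: "- (norm xstar * R) - norm ystar * (R * K) \<le> F z" if z: "z \<in> ?Z" for z
  proof -
    have "xstar \<bullet> \<xi> z \<le> norm xstar * R"
      using norm_cauchy_schwarz[of xstar "\<xi> z"] mult_left_mono[OF \<xi>R[OF z], of "norm xstar"] by simp
    moreover have "- (ystar \<bullet> b z) \<le> norm ystar * (R * K)"
      using norm_cauchy_schwarz[of "- ystar" "b z"] mult_left_mono[OF bR[OF z], of "norm ystar"] by simp
    moreover have "0 \<le> C * ((norm (\<xi> z))\<^sup>2 + (norm (b z))\<^sup>2)" using C by simp
    ultimately show ?thesis by (simp add: F_def)
  qed
  have below: "- (norm xstar * R) - norm ystar * (R * K) \<le> J z" if z: "z \<in> ?Z" for z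
  proof -
    have "0 \<le> \<eta> * (\<integral>t. (norm (snd (z t)))\<^sup>2 \<partial>M) + p * (\<integral>t. (norm (fst (z t) - \<xi> z))\<^sup>2 \<partial>M)"
      using \<eta> p by (intro add_nonneg_nonneg mult_nonneg_nonneg) auto
    then show ?thesis using F_ge[OF z] by (simp add: J_def Jvar[OF z])
  qed
  have cont: "(\<lambda>i. J (zs i)) \<longlonglongrightarrow> J z"
    if zs: "\<And>i. zs i \<in> ?Z" and z: "z \<in> ?Z" and lim: "AE t in M. (\<lambda>i. zs i t) \<longlonglongrightarrow> z t" for zs z
  proof -
    have limf: "AE t in M. (\<lambda>i. fst (zs i t)) \<longlonglongrightarrow> fst (z t)" using lim by eventually_elim (rule tendsto_fst)
    have lims: "AE t in M. (\<lambda>i. snd (zs i t)) \<longlonglongrightarrow> snd (z t)" using lim by eventually_elim (rule tendsto_snd)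
    have sq: "(\<lambda>i. \<integral>t. (norm (hs i t))\<^sup>2 \<partial>M) \<longlonglongrightarrow> (\<integral>t. (norm (h t))\<^sup>2 \<partial>M)"
      if "AE t in M. (\<lambda>i. hs i t) \<longlonglongrightarrow> h t" "\<And>i. hs i \<in> borel_measurable M" "h \<in> borel_measurable M"
        "\<And>i. AE t in M. norm (hs i t) \<le> R" for hs and h :: "'a \<Rightarrow> 'r::euclidean_space"
    proof (rule integral_dominated_convergence[where w = "\<lambda>_. R\<^sup>2"])
      show "AE t in M. (\<lambda>i. (norm (hs i t))\<^sup>2) \<longlonglongrightarrow> (norm (h t))\<^sup>2"
        using that(1) by eventually_elim (intro tendsto_intros)
      show "AE t in M. norm ((norm (hs i t))\<^sup>2) \<le> R\<^sup>2" for i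
        using that(4)[of i] by eventually_elim (auto intro: power_mono)
    qed (use that(2,3) in auto)
    have \<xi>: "(\<lambda>i. \<xi> (zs i)) \<longlonglongrightarrow> \<xi> z"
      unfolding \<xi>_def by (intro tendsto_scaleR tendsto_const
        integral_dominated_convergence[where w = "\<lambda>_. R", OF fm[OF z] fm[OF zs] _ limf fR[OF zs]]) simp
    have b: "(\<lambda>i. b (zs i)) \<longlonglongrightarrow> b z"
      unfolding b_def by (intro
        integral_dominated_convergence[where w = "\<lambda>_. R", OF sm[OF z] sm[OF zs] _ lims sR[OF zs]]) simp
    show ?thesis
      unfolding J_def F_def
      by (intro tendsto_intros \<xi> b sq[OF limf fm[OF zs] fm[OF z] fR[OF zs]] sq[OF lims sm[OF zs] sm[OF z] sR[OF zs]])
  qed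
  have zero_Z: "(\<lambda>_. 0) \<in> ?Z" using zero by (simp add: selections_def)
  obtain z W where z: "z \<in> ?Z" and Wm: "W \<in> borel_measurable M" and WR: "AE t in M. norm (W t) \<le> \<Lambda> * R"
    and min: "\<And>z'. z' \<in> ?Z \<Longrightarrow>
      J z + (\<integral>t. \<Lambda> * (norm (z t))\<^sup>2 - 2 * (z t \<bullet> W t) \<partial>M) \<le>
      J z' + (\<integral>t. \<Lambda> * (norm (z' t))\<^sup>2 - 2 * (z' t \<bullet> W t) \<partial>M)"
  proof (rule smooth_variational_principle[of \<Gamma> R "\<lambda>_. 0" "- (norm xstar * R) - norm ystar * (R * K)" J \<Lambda>])
  qed (use closed bdd R zero_Z below cont \<Lambda> in \<open>assumption | blast\<close>)+
  define q where "q t y = \<eta> * (norm (snd y))\<^sup>2 + p * (norm (fst y))\<^sup>2 + (\<Lambda> * (norm y)\<^sup>2 - 2 * (y \<bullet> W t))"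
    for t and y :: "'p \<times> 'q"
  have q_int: "integrable M (\<lambda>t. q t (y t))"
    and I_eq: "(\<integral>t. q t (y t) \<partial>M) = \<eta> * (\<integral>t. (norm (snd (y t)))\<^sup>2 \<partial>M) + p * (\<integral>t. (norm (fst (y t)))\<^sup>2 \<partial>M) +
      (\<integral>t. \<Lambda> * (norm (y t))\<^sup>2 - 2 * (y t \<bullet> W t) \<partial>M)" if y: "y \<in> ?Z" for y
    using sq_int[OF sm[OF y] sR[OF y]] sq_int[OF fm[OF y] fR[OF y]] sq_int[OF zm[OF y] zR[OF y]]
      in_int[OF zm[OF y] zR[OF y] Wm WR]
    by (simp_all add: q_def)
  have gain: "0 \<le> F y - F z - p * K * ((norm (\<xi> y))\<^sup>2 - (norm (\<xi> z))\<^sup>2) + (\<integral>t. q t (y t) - q t (z t) \<partial>M)"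
    if y: "y \<in> ?Z" for y
  proof -
    have "J y + (\<integral>t. \<Lambda> * (norm (y t))\<^sup>2 - 2 * (y t \<bullet> W t) \<partial>M) = F y - p * K * (norm (\<xi> y))\<^sup>2 + (\<integral>t. q t (y t) \<partial>M)"
      if y: "y \<in> ?Z" for y
      by (simp add: J_def I_eq[OF y] algebra_simps)
    from min[OF y] this[OF y] this[OF z] have "F z - p * K * (norm (\<xi> z))\<^sup>2 + (\<integral>t. q t (z t) \<partial>M)
      \<le> F y - p * K * (norm (\<xi> y))\<^sup>2 + (\<integral>t. q t (y t) \<partial>M)" by simp
    then show ?thesis using q_int[OF y] q_int[OF z] by (simp add: right_diff_distrib)
  qed
  have F_diff: "F y - F z - p * K * ((norm (\<xi> y))\<^sup>2 - (norm (\<xi> z))\<^sup>2) =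
      - (xstar \<bullet> \<delta>) + ystar \<bullet> k + C * (2 * (\<xi> z \<bullet> \<delta>) + (norm \<delta>)\<^sup>2 + 2 * (b z \<bullet> k) + (norm k)\<^sup>2)
      - p * K * (2 * (\<xi> z \<bullet> \<delta>) + (norm \<delta>)\<^sup>2)" if "\<xi> y = \<xi> z + \<delta>" "b y = b z + k" for y \<delta> k
    by (simp add: F_def that power2_norm_eq_inner inner_add inner_commute algebra_simps)

  define u v where "u t = fst (z t)" and "v t = snd (z t)" for t
  have um: "u \<in> borel_measurable M" and vm: "v \<in> borel_measurable M"
    unfolding u_def[abs_def] v_def[abs_def] by (rule fm[OF z], rule sm[OF z])
  have uR: "AE t in M. norm (u t) \<le> R" and vR: "AE t in M. norm (v t) \<le> R"
    unfolding u_def v_def by (rule fR[OF z], rule sR[OF z])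
  \<comment> \<open>\<open>g\<close> is the gradient of the part depending on the integral of
    \<open>z\<close>, and \<open>bt t\<close> is that of the integrand \<open>q t\<close>. The mean
    carries a factor \<open>1 / K\<close>, which cancels the \<open>K\<close> in front of the
    variance correction; hence the terms with \<open>p\<close> combine to
    \<open>(2 * p) *\<^sub>R (u t - \<xi> z)\<close>.\<close>
  define g where "g = (- (1 / K) *\<^sub>R xstar + (2 * C / K) *\<^sub>R \<xi> z - (2 * p) *\<^sub>R \<xi> z, ystar + (2 * C) *\<^sub>R b z)"
  define bt where "bt t = ((2 * p) *\<^sub>R u t, (2 * \<eta>) *\<^sub>R v t) + (2 * \<Lambda>) *\<^sub>R z t - 2 *\<^sub>R W t" for t
  \<comment> \<open>A curvature bound: \<open>C / K\<^sup>2\<close> and \<open>C\<close> for the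
    quadratic in the integrals, \<open>p + \<eta> + \<Lambda>\<close> for the integrand. The concave
    term \<open>- p * K * (norm \<delta>)\<^sup>2\<close> has the favourable sign and is
    dropped.\<close>
  define L2 where "L2 = C / K\<^sup>2 + C + (p + \<eta> + \<Lambda>)"
  have normals: "AE t in M. - (g + bt t) \<in> regular_normal_cone (z t) (\<Gamma> t)"
  proof (rule minimizer_regular_normal[of \<Gamma> R z bt "2 * p * R + 2 * \<eta> * R + 2 * \<Lambda> * R + 2 * \<Lambda> * R" L2])
    show "L2 \<ge> 0" using C K p \<eta> \<Lambda> by (simp add: L2_def)
    show "bt \<in> borel_measurable M"
      unfolding bt_def[abs_def] using um vm zm[OF z] Wm by (intro borel_measurable_diff borel_measurable_add
        borel_measurable_Pair borel_measurable_scaleR borel_measurable_const)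
    show "AE t in M. norm (bt t) \<le> 2 * p * R + 2 * \<eta> * R + 2 * \<Lambda> * R + 2 * \<Lambda> * R"
      using uR vR zR[OF z] WR
    proof eventually_elim
      case (elim t)
      have "norm (bt t) \<le> norm ((2 * p) *\<^sub>R u t, (2 * \<eta>) *\<^sub>R v t) + norm ((2 * \<Lambda>) *\<^sub>R z t) + norm (2 *\<^sub>R W t)"
        unfolding bt_def by (rule order_trans[OF norm_triangle_ineq4 add_right_mono[OF norm_triangle_ineq]])
      also have "\<dots> \<le> (norm ((2 * p) *\<^sub>R u t) + norm ((2 * \<eta>) *\<^sub>R v t)) + norm ((2 * \<Lambda>) *\<^sub>R z t) + norm (2 *\<^sub>R W t)"
        by (intro add_right_mono norm_Pair_le)
      also have "\<dots> = 2 * p * norm (u t) + 2 * \<eta> * norm (v t) + 2 * \<Lambda> * norm (z t) + 2 * norm (W t)"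
        using p \<eta> \<Lambda> by simp
      also have "\<dots> \<le> 2 * p * R + 2 * \<eta> * R + 2 * \<Lambda> * R + 2 * (\<Lambda> * R)"
        using elim p \<eta> \<Lambda> by (intro add_mono mult_left_mono) auto
      finally show ?case by simp
    qed
    fix y assume y: "y \<in> ?Z"
    define d where "d t = y t - z t" for t
    have dint: "integrable M d" unfolding d_def[abs_def] using zint[OF y] zint[OF z] by simp
    define \<delta> k where "\<delta> = \<xi> y - \<xi> z" and "k = b y - b z"
    have D: "(\<integral>t. d t \<partial>M) = (K *\<^sub>R \<delta>, k)"
    proof (rule prod_eqI)
      have "fst (\<integral>t. d t \<partial>M) = (\<integral>t. fst (d t) \<partial>M)"
        using integral_bounded_linear[OF bounded_linear_fst dint] by simp
      also have "\<dots> = (\<integral>t. fst (y t) \<partial>M) - (\<integral>t. fst (z t) \<partial>M)"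
        unfolding d_def using fint[OF y] fint[OF z] by simp
      finally show "fst (\<integral>t. d t \<partial>M) = fst (K *\<^sub>R \<delta>, k)" by (simp add: \<xi>K \<delta>_def scaleR_diff_right)
      have "snd (\<integral>t. d t \<partial>M) = (\<integral>t. snd (d t) \<partial>M)"
        using integral_bounded_linear[OF bounded_linear_snd dint] by simp
      also have "\<dots> = (\<integral>t. snd (y t) \<partial>M) - (\<integral>t. snd (z t) \<partial>M)"
        unfolding d_def using sint[OF y] sint[OF z] by simp
      finally show "snd (\<integral>t. d t \<partial>M) = snd (K *\<^sub>R \<delta>, k)" by (simp add: b_def k_def)
    qed
    have "F y - F z - p * K * ((norm (\<xi> y))\<^sup>2 - (norm (\<xi> z))\<^sup>2)
        \<le> g \<bullet> (\<integral>t. d t \<partial>M) + L2 * (norm (\<integral>t. d t \<partial>M))\<^sup>2"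
    proof -
      have "g \<bullet> (\<integral>t. d t \<partial>M) = - (xstar \<bullet> \<delta>) + 2 * C * (\<xi> z \<bullet> \<delta>) - 2 * p * K * (\<xi> z \<bullet> \<delta>) + ystar \<bullet> k + 2 * C * (b z \<bullet> k)"
        unfolding D g_def using K by (simp add: inner_add_left inner_diff_left field_simps)
      moreover have "F y - F z - p * K * ((norm (\<xi> y))\<^sup>2 - (norm (\<xi> z))\<^sup>2) =
        - (xstar \<bullet> \<delta>) + ystar \<bullet> k + C * (2 * (\<xi> z \<bullet> \<delta>) + (norm \<delta>)\<^sup>2 + 2 * (b z \<bullet> k) + (norm k)\<^sup>2)
        - p * K * (2 * (\<xi> z \<bullet> \<delta>) + (norm \<delta>)\<^sup>2)"
        by (rule F_diff) (simp_all add: \<delta>_def k_def)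
      moreover have "C * ((norm \<delta>)\<^sup>2 + (norm k)\<^sup>2) \<le> L2 * (norm (\<integral>t. d t \<partial>M))\<^sup>2"
      proof -
        have n: "(norm (\<integral>t. d t \<partial>M))\<^sup>2 = K\<^sup>2 * (norm \<delta>)\<^sup>2 + (norm k)\<^sup>2"
          unfolding D norm_Pair using K by (simp add: power_mult_distrib)
        have "C * ((norm \<delta>)\<^sup>2 + (norm k)\<^sup>2) = C / K\<^sup>2 * (K\<^sup>2 * (norm \<delta>)\<^sup>2) + C * (norm k)\<^sup>2"
          using K by (simp add: field_simps)
        also have "\<dots> \<le> L2 * (K\<^sup>2 * (norm \<delta>)\<^sup>2) + L2 * (norm k)\<^sup>2"
          using C K p \<eta> \<Lambda> by (intro add_mono mult_right_mono) (auto simp: L2_def)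
        finally show ?thesis by (simp add: n distrib_left)
      qed
      moreover have "0 \<le> p * K * (norm \<delta>)\<^sup>2" using p K by simp
      ultimately show ?thesis by (simp add: distrib_left right_diff_distrib mult.assoc[symmetric])
    qed
    moreover have "(\<integral>t. q t (y t) - q t (z t) \<partial>M) \<le> (\<integral>t. bt t \<bullet> d t + L2 * (norm (d t))\<^sup>2 \<partial>M)"
    proof (rule integral_mono)
      show "integrable M (\<lambda>t. q t (y t) - q t (z t))" using q_int[OF y] q_int[OF z] by simp
      have pw: "q t (y t) - q t (z t) = bt t \<bullet> d t + (\<eta> * (norm (snd (d t)))\<^sup>2 + p * (norm (fst (d t)))\<^sup>2 + \<Lambda> * (norm (d t))\<^sup>2)" for t
      proof -
        have "y t = z t + d t" by (simp add: d_def)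
        then show ?thesis
          by (simp add: q_def bt_def u_def v_def power2_norm_eq_inner inner_add inner_diff inner_commute
            inner_Pair_0 inner_prod_def algebra_simps)
      qed
      have d2: "integrable M (\<lambda>t. (norm (d t))\<^sup>2)"
      proof (rule integrable_norm_square)
        show "AE t in M. norm (d t) \<le> R + R"
          unfolding d_def using zR[OF y] zR[OF z]
          by eventually_elim (rule order_trans[OF norm_triangle_ineq4 add_mono])
      qed (use dint in measurable)
      have dm: "(\<lambda>t. fst (d t)) \<in> borel_measurable M" "(\<lambda>t. snd (d t)) \<in> borel_measurable M"
        using fm[OF y] fm[OF z] sm[OF y] sm[OF z] by (simp_all add: d_def)
      have d2f: "integrable M (\<lambda>t. (norm (fst (d t)))\<^sup>2)" "integrable M (\<lambda>t. (norm (snd (d t)))\<^sup>2)"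
        by (rule Bochner_Integration.integrable_bound[OF d2]; use dm fs in \<open>auto intro!: power_mono\<close>)+
      have "integrable M (\<lambda>t. q t (y t) - q t (z t) - (\<eta> * (norm (snd (d t)))\<^sup>2 + p * (norm (fst (d t)))\<^sup>2 + \<Lambda> * (norm (d t))\<^sup>2))"
        using q_int[OF y] q_int[OF z] d2 d2f by simp
      then have "integrable M (\<lambda>t. bt t \<bullet> d t)" by (simp add: pw)
      then show "integrable M (\<lambda>t. bt t \<bullet> d t + L2 * (norm (d t))\<^sup>2)" using d2 by simp
      show "q t (y t) - q t (z t) \<le> bt t \<bullet> d t + L2 * (norm (d t))\<^sup>2" for t
      proof -
        have "\<eta> * (norm (snd (d t)))\<^sup>2 + p * (norm (fst (d t)))\<^sup>2 + \<Lambda> * (norm (d t))\<^sup>2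
            \<le> \<eta> * (norm (d t))\<^sup>2 + p * (norm (d t))\<^sup>2 + \<Lambda> * (norm (d t))\<^sup>2"
          using fs p \<eta> \<Lambda> by (intro add_mono mult_left_mono power_mono) auto
        also have "\<dots> = (p + \<eta> + \<Lambda>) * (norm (d t))\<^sup>2" by (simp add: algebra_simps)
        also have "\<dots> \<le> L2 * (norm (d t))\<^sup>2" using C K by (intro mult_right_mono) (auto simp: L2_def)
        finally show ?thesis unfolding pw by simp
      qed
    qed
    ultimately show "0 \<le> g \<bullet> (\<integral>t. y t - z t \<partial>M) + L2 * (norm (\<integral>t. y t - z t \<partial>M))\<^sup>2 +
        (\<integral>t. bt t \<bullet> (y t - z t) + L2 * (norm (y t - z t))\<^sup>2 \<partial>M)"
      using gain[OF y] unfolding d_def by linarith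
  qed (use graph bdd z in auto)

  \<comment> \<open>Terms with factor \<open>p\<close> are kept exactly or dropped by sign, and only
    the others are estimated, so \<open>L\<close> is independent of \<open>p\<close>. Since
    \<open>A\<close> is arbitrary, the integrand is nonpositive almost everywhere, and completing
    the square gives \<open>close\<close>.\<close>
  have set_bound: "(\<integral>t. indicator A t * (p * (norm (u t))\<^sup>2 - 2 * p * (\<xi> z \<bullet> u t) - L) \<partial>M) \<le> 0"
    if A: "A \<in> sets M" for A
  proof -
    define y where "y t = (if t \<in> A then 0 else z t)" for t
    have ym: "y \<in> borel_measurable M" unfolding y_def[abs_def] using zm[OF z] A by measurable
    have y: "y \<in> ?Z"
    proof -
      have "AE t in M. y t \<in> \<Gamma> t" using z\<Gamma>[OF z] zero by eventually_elim (auto simp: y_def)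
      then show ?thesis using ym by (simp add: selections_def)
    qed
    define h k where "h = (\<integral>t. indicator A t *\<^sub>R u t \<partial>M)" and "k = (\<integral>t. indicator A t *\<^sub>R v t \<partial>M)"
    have Au: "integrable M (\<lambda>t. indicator A t *\<^sub>R u t)" and Av: "integrable M (\<lambda>t. indicator A t *\<^sub>R v t)"
      unfolding u_def v_def by (rule integrable_mult_indicator[OF A fint[OF z]], rule integrable_mult_indicator[OF A sint[OF z]])
    have "fst (y t) = u t - indicator A t *\<^sub>R u t" "snd (y t) = v t - indicator A t *\<^sub>R v t" for t
      by (auto simp: y_def u_def v_def indicator_def)
    then have "\<xi> y = \<xi> z + - (1 / K) *\<^sub>R h" "b y = b z + - k"
      unfolding \<xi>_def b_def h_def k_def using Au Av fint[OF z] sint[OF z]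
      by (simp_all add: u_def[symmetric] v_def[symmetric] scaleR_diff_right)
    note Fd = F_diff[OF this]
    define mA where "mA = measure M A"
    have mA_eq: "measure M (A \<inter> space M) = mA"
      using sets.sets_into_space[OF A] by (simp add: mA_def Int_absorb2)
    have mA: "0 \<le> mA" "mA \<le> K" unfolding mA_def K_def by (auto intro: bounded_measure)
    have set_le: "norm (\<integral>t. indicator A t *\<^sub>R w t \<partial>M) \<le> R * mA"
      if w: "integrable M w" "AE t in M. norm (w t) \<le> R" for w :: "'a \<Rightarrow> 'r::euclidean_space"
    proof -
      have "norm (\<integral>t. indicator A t *\<^sub>R w t \<partial>M) \<le> (\<integral>t. norm (indicator A t *\<^sub>R w t) \<partial>M)"
        by (rule integral_norm_bound)
      also have "\<dots> \<le> (\<integral>t. indicator A t * R \<partial>M)"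
      proof (rule integral_mono_AE)
        show "integrable M (\<lambda>t. norm (indicator A t *\<^sub>R w t))"
          by (rule integrable_norm[OF integrable_mult_indicator[OF A w(1)]])
        show "integrable M (\<lambda>t. indicator A t * R)"
          using A by (intro integrable_mult_left integrable_real_indicator) (auto simp: less_top[symmetric])
        show "AE t in M. norm (indicator A t *\<^sub>R w t) \<le> indicator A t * R"
          using w(2) by eventually_elim (auto simp: indicator_def)
      qed
      also have "\<dots> = R * mA"
        using A sets.sets_into_space[OF A] by (simp add: mA_def Int_absorb2 mult_ac)
      finally show ?thesis .
    qed
    have hR: "norm h \<le> R * mA" and kR: "norm k \<le> R * mA"
      unfolding h_def k_def u_def v_def by (rule set_le[OF fint[OF z] fR[OF z]], rule set_le[OF sint[OF z] sR[OF z]])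
    have RmA: "R * mA \<le> R * K" using mA R by (intro mult_left_mono) auto
    have hh: "(norm h)\<^sup>2 \<le> R * mA * (R * K)" and kk: "(norm k)\<^sup>2 \<le> R * mA * (R * K)"
      unfolding power2_eq_square
      by (rule mult_mono[OF hR order_trans[OF hR RmA]]; use R mA in simp)
        (rule mult_mono[OF kR order_trans[OF kR RmA]]; use R mA in simp)
    have t1: "xstar \<bullet> h \<le> norm xstar * (R * mA)"
      using norm_cauchy_schwarz[of xstar h] mult_left_mono[OF hR, of "norm xstar"] by simp
    have t2: "- (ystar \<bullet> k) \<le> norm ystar * (R * mA)"
      using norm_cauchy_schwarz[of "- ystar" k] mult_left_mono[OF kR, of "norm ystar"] by simp
    have t3: "- (\<xi> z \<bullet> h) \<le> R * (R * mA)"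
    proof -
      have "- (\<xi> z \<bullet> h) \<le> norm (\<xi> z) * norm h" using norm_cauchy_schwarz[of "- \<xi> z" h] by simp
      also have "\<dots> \<le> R * (R * mA)" using \<xi>R[OF z] hR R by (intro mult_mono) auto
      finally show ?thesis .
    qed
    have t4: "- (b z \<bullet> k) \<le> R * K * (R * mA)"
    proof -
      have "- (b z \<bullet> k) \<le> norm (b z) * norm k" using norm_cauchy_schwarz[of "- b z" k] by simp
      also have "\<dots> \<le> R * K * (R * mA)" using bR[OF z] kR R K by (intro mult_mono) auto
      finally show ?thesis .
    qed
    have "F y - F z - p * K * ((norm (\<xi> y))\<^sup>2 - (norm (\<xi> z))\<^sup>2) =
        (xstar \<bullet> h) / K - ystar \<bullet> k + C * (- 2 * (\<xi> z \<bullet> h) / K + (norm h)\<^sup>2 / K\<^sup>2 - 2 * (b z \<bullet> k) + (norm k)\<^sup>2)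
        + 2 * p * (\<xi> z \<bullet> h) - p * (norm h)\<^sup>2 / K"
      unfolding Fd using K by (simp add: power_divide field_simps power2_eq_square)
    also have "\<dots> \<le> (norm xstar * (R * mA)) / K + norm ystar * (R * mA) +
        C * (2 * (R * (R * mA)) / K + (R * mA * (R * K)) / K\<^sup>2 + 2 * (R * K * (R * mA)) + R * mA * (R * K)) + 2 * p * (\<xi> z \<bullet> h)"
    proof -
      have "(xstar \<bullet> h) / K \<le> (norm xstar * (R * mA)) / K" using t1 K by (intro divide_right_mono) auto
      moreover have "- 2 * (\<xi> z \<bullet> h) / K \<le> 2 * (R * (R * mA)) / K" using t3 K by (intro divide_right_mono) auto
      moreover have "(norm h)\<^sup>2 / K\<^sup>2 \<le> (R * mA * (R * K)) / K\<^sup>2" using hh by (intro divide_right_mono) auto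
      ultimately have "C * (- 2 * (\<xi> z \<bullet> h) / K + (norm h)\<^sup>2 / K\<^sup>2 - 2 * (b z \<bullet> k) + (norm k)\<^sup>2) \<le>
          C * (2 * (R * (R * mA)) / K + (R * mA * (R * K)) / K\<^sup>2 + 2 * (R * K * (R * mA)) + R * mA * (R * K))"
        using t4 kk C by (intro mult_left_mono) linarith+
      moreover have "0 \<le> p * (norm h)\<^sup>2 / K" using p K by simp
      ultimately show ?thesis using t2 \<open>(xstar \<bullet> h) / K \<le> _\<close> by linarith
    qed
    \<comment> \<open>Each 3 in \<open>L\<close> is 2 from a cross term plus 1 from a square, once
      for the mean and once for \<open>b\<close>. The share \<open>2 * \<Lambda> * R\<^sup>2\<close>
      is reserved for the perturbation, which is estimated below.\<close>
    also have "\<dots> = (L - 2 * \<Lambda> * R\<^sup>2) * mA + 2 * p * (\<xi> z \<bullet> h)"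
      unfolding L_def using K by (simp add: field_simps power2_eq_square)
    finally have F_le: "F y - F z - p * K * ((norm (\<xi> y))\<^sup>2 - (norm (\<xi> z))\<^sup>2) \<le> (L - 2 * \<Lambda> * R\<^sup>2) * mA + 2 * p * (\<xi> z \<bullet> h)" .
    have uint2: "integrable M (\<lambda>t. indicator A t * (norm (u t))\<^sup>2)"
      using integrable_mult_indicator[OF A sq_int[OF um uR]] by simp
    have indint: "integrable M (\<lambda>t. indicator A t * c)" for c :: real
      using A by (intro integrable_mult_left integrable_real_indicator) (auto simp: less_top[symmetric])
    have \<xi>u: "integrable M (\<lambda>t. indicator A t * (\<xi> z \<bullet> u t))" "(\<integral>t. indicator A t * (\<xi> z \<bullet> u t) \<partial>M) = \<xi> z \<bullet> h"
    proof -
      have "integrable M (\<lambda>t. \<xi> z \<bullet> (indicator A t *\<^sub>R u t))" using Au by (rule integrable_inner_right)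
      then show "integrable M (\<lambda>t. indicator A t * (\<xi> z \<bullet> u t))" by simp
      have "(\<integral>t. \<xi> z \<bullet> (indicator A t *\<^sub>R u t) \<partial>M) = \<xi> z \<bullet> h"
        unfolding h_def by (rule integral_inner_right) (use Au in auto)
      then show "(\<integral>t. indicator A t * (\<xi> z \<bullet> u t) \<partial>M) = \<xi> z \<bullet> h" by simp
    qed
    have "(\<integral>t. q t (y t) - q t (z t) \<partial>M) \<le> (\<integral>t. indicator A t * (2 * \<Lambda> * R\<^sup>2) - p * (indicator A t * (norm (u t))\<^sup>2) \<partial>M)"
    proof (rule integral_mono_AE)
      show "integrable M (\<lambda>t. q t (y t) - q t (z t))" using q_int[OF y] q_int[OF z] by simp
      show "integrable M (\<lambda>t. indicator A t * (2 * \<Lambda> * R\<^sup>2) - p * (indicator A t * (norm (u t))\<^sup>2))"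
        using indint uint2 by simp
      show "AE t in M. q t (y t) - q t (z t) \<le> indicator A t * (2 * \<Lambda> * R\<^sup>2) - p * (indicator A t * (norm (u t))\<^sup>2)"
        using zR[OF z] WR
      proof eventually_elim
        case (elim t)
        have "z t \<bullet> W t \<le> norm (z t) * norm (W t)" by (rule norm_cauchy_schwarz)
        also have "\<dots> \<le> R * (\<Lambda> * R)" using elim R by (intro mult_mono) auto
        finally have "2 * (z t \<bullet> W t) \<le> 2 * \<Lambda> * R\<^sup>2" by (simp add: power2_eq_square mult_ac)
        moreover have "0 \<le> \<eta> * (norm (snd (z t)))\<^sup>2" "0 \<le> \<Lambda> * (norm (z t))\<^sup>2" using \<eta> \<Lambda> by auto
        ultimately show ?case by (cases "t \<in> A") (auto simp: y_def q_def u_def)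
      qed
    qed
    also have "\<dots> = 2 * \<Lambda> * R\<^sup>2 * mA - p * (\<integral>t. indicator A t * (norm (u t))\<^sup>2 \<partial>M)"
      using indint uint2 by (simp add: mA_eq)
    finally have "p * (\<integral>t. indicator A t * (norm (u t))\<^sup>2 \<partial>M) - 2 * p * (\<xi> z \<bullet> h) - L * mA \<le> 0"
      using gain[OF y] F_le by (simp add: left_diff_distrib)
    moreover have "(\<integral>t. indicator A t * (p * (norm (u t))\<^sup>2 - 2 * p * (\<xi> z \<bullet> u t) - L) \<partial>M) =
        p * (\<integral>t. indicator A t * (norm (u t))\<^sup>2 \<partial>M) - 2 * p * (\<xi> z \<bullet> h) - L * mA"
    proof -
      have "(\<integral>t. indicator A t * (p * (norm (u t))\<^sup>2 - 2 * p * (\<xi> z \<bullet> u t) - L) \<partial>M) =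
        (\<integral>t. p * (indicator A t * (norm (u t))\<^sup>2) - 2 * p * (indicator A t * (\<xi> z \<bullet> u t)) - indicator A t * L \<partial>M)"
        by (intro Bochner_Integration.integral_cong) (auto simp: algebra_simps)
      also have "\<dots> = p * (\<integral>t. indicator A t * (norm (u t))\<^sup>2 \<partial>M) - 2 * p * (\<xi> z \<bullet> h) - L * mA"
        using uint2 \<xi>u(1) indint by (simp add: \<xi>u(2) mA_eq)
      finally show ?thesis .
    qed
    ultimately show ?thesis by simp
  qed
  have close: "AE t in M. (norm (u t - \<xi> z))\<^sup>2 \<le> (norm (\<xi> z))\<^sup>2 + L / p"
  proof -
    have "integrable M (\<lambda>t. p * (norm (u t))\<^sup>2 - 2 * p * (\<xi> z \<bullet> u t) - L)"
      using sq_int[OF um uR] fint[OF z] by (simp add: u_def)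
    then have "AE t in M. p * (norm (u t))\<^sup>2 - 2 * p * (\<xi> z \<bullet> u t) - L \<le> 0"
      using set_bound by (rule AE_nonpos_of_set_integrals)
    then show ?thesis
    proof eventually_elim
      case (elim t)
      have "(norm (u t - \<xi> z))\<^sup>2 = (norm (u t))\<^sup>2 - 2 * (\<xi> z \<bullet> u t) + (norm (\<xi> z))\<^sup>2"
        by (simp add: power2_norm_eq_inner inner_diff inner_commute)
      moreover have "(norm (u t))\<^sup>2 - 2 * (\<xi> z \<bullet> u t) \<le> L / p"
        using elim p by (simp add: field_simps)
      ultimately show ?case by simp
    qed
  qed
  define wu wv where "wu t = fst (W t)" and "wv t = snd (W t)" for t
  have Wuv: "wu \<in> borel_measurable M" "wv \<in> borel_measurable M"
    unfolding wu_def[abs_def] wv_def[abs_def]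
    by (rule borel_measurable_continuous_on[OF _ Wm]; intro continuous_intros)+
  show thesis
  proof (rule that[of u v wu wv "\<xi> z" "b z"])
    show "(\<lambda>t. (u t, v t)) \<in> ?Z" using z by (simp add: u_def v_def)
    show "wu \<in> borel_measurable M" "wv \<in> borel_measurable M" by (rule Wuv)+
    show "AE t in M. norm (wu t) \<le> \<Lambda> * R \<and> norm (wv t) \<le> \<Lambda> * R"
      using WR by eventually_elim (auto simp: wu_def wv_def intro: order_trans[OF fs(1)] order_trans[OF fs(2)])
    show "(\<integral>t. u t \<partial>M) = K *\<^sub>R \<xi> z" unfolding u_def by (rule \<xi>K)
    show "b z = (\<integral>t. v t \<partial>M)" by (simp add: b_def v_def)
    show "norm (\<xi> z) \<le> R" "norm (b z) \<le> R * K" by (rule \<xi>R[OF z], rule bR[OF z])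
    show "AE t in M. (norm (u t - \<xi> z))\<^sup>2 \<le> (norm (\<xi> z))\<^sup>2 + L / p" by (rule close)
    show "AE t in M. - ((- (1 / K) *\<^sub>R xstar + (2 * C / K) *\<^sub>R \<xi> z + (2 * p) *\<^sub>R (u t - \<xi> z) + (2 * \<Lambda>) *\<^sub>R u t - 2 *\<^sub>R wu t,
        ystar + (2 * C) *\<^sub>R b z + (2 * \<eta> + 2 * \<Lambda>) *\<^sub>R v t - 2 *\<^sub>R wv t)) \<in> regular_normal_cone (u t, v t) (\<Gamma> t)"
      using normals
    proof eventually_elim
      case (elim t)
      have "g + bt t = (- (1 / K) *\<^sub>R xstar + (2 * C / K) *\<^sub>R \<xi> z + (2 * p) *\<^sub>R (u t - \<xi> z) + (2 * \<Lambda>) *\<^sub>R u t - 2 *\<^sub>R wu t,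
        ystar + (2 * C) *\<^sub>R b z + (2 * \<eta> + 2 * \<Lambda>) *\<^sub>R v t - 2 *\<^sub>R wv t)"
        by (rule prod_eqI) (simp_all add: g_def bt_def u_def v_def wu_def wv_def algebra_simps)
      with elim show ?case by (simp only: u_def v_def prod.collapse)
    qed
    \<comment> \<open>At the zero selection the perturbed objective vanishes; the perturbation
      itself is at least \<open>- (2 * \<Lambda> * R\<^sup>2 * K)\<close>.\<close>
    have "J z + (\<integral>t. \<Lambda> * (norm (z t))\<^sup>2 - 2 * (z t \<bullet> W t) \<partial>M) \<le> 0"
      using min[OF zero_Z] by (simp add: J_def F_def \<xi>_def b_def)
    moreover have "- (2 * \<Lambda> * R\<^sup>2 * K) \<le> (\<integral>t. \<Lambda> * (norm (z t))\<^sup>2 - 2 * (z t \<bullet> W t) \<partial>M)"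
    proof -
      have "(\<integral>t. - (2 * \<Lambda> * R\<^sup>2) \<partial>M) \<le> (\<integral>t. \<Lambda> * (norm (z t))\<^sup>2 - 2 * (z t \<bullet> W t) \<partial>M)"
      proof (rule integral_mono_AE)
        show "integrable M (\<lambda>t. \<Lambda> * (norm (z t))\<^sup>2 - 2 * (z t \<bullet> W t))"
          using sq_int[OF zm[OF z] zR[OF z]] in_int[OF zm[OF z] zR[OF z] Wm WR] by simp
        show "AE t in M. - (2 * \<Lambda> * R\<^sup>2) \<le> \<Lambda> * (norm (z t))\<^sup>2 - 2 * (z t \<bullet> W t)"
          using zR[OF z] WR
        proof eventually_elim
          case (elim t)
          have "z t \<bullet> W t \<le> norm (z t) * norm (W t)" by (rule norm_cauchy_schwarz)
          also have "\<dots> \<le> R * (\<Lambda> * R)" using elim R by (intro mult_mono) auto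
          finally have "2 * (z t \<bullet> W t) \<le> 2 * \<Lambda> * R\<^sup>2" by (simp add: power2_eq_square mult_ac)
          moreover have "0 \<le> \<Lambda> * (norm (z t))\<^sup>2" using \<Lambda> by simp
          ultimately show ?case by simp
        qed
      qed simp
      then show ?thesis by (simp add: K_def mult_ac)
    qed
    ultimately show "- (xstar \<bullet> \<xi> z) + ystar \<bullet> b z + C * ((norm (\<xi> z))\<^sup>2 + (norm (b z))\<^sup>2) +
       \<eta> * (\<integral>t. (norm (v t))\<^sup>2 \<partial>M) + p * (\<integral>t. (norm (u t - \<xi> z))\<^sup>2 \<partial>M) \<le> 2 * \<Lambda> * R\<^sup>2 * K"
      unfolding u_def v_def Jvar[OF z] by (simp add: J_def F_def)
  qed
qed

section \<open>Quadratic support and the limit of large penalties\<close>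

text \<open>Within distance \<open>d\<close> the support combines the normal inequality with
  \<open>\<epsilon> * s \<le> \<epsilon>\<^sup>2 / C + C * s\<^sup>2\<close>; beyond it the
  quadratic term dominates. A nonpositive value therefore forces distance below \<open>d\<close>,
  where \<open>C * s\<^sup>2 \<le> \<epsilon> * s\<close>. The factor \<open>C\<close> in the last
  conclusion keeps the gradient of the quadratic term of order \<open>\<epsilon>\<close>.\<close>

lemma regular_normal_quadratic_support:
  fixes v :: "'a::real_inner"
  assumes v: "v \<in> regular_normal_cone z \<Omega>" and "\<epsilon> > 0"
  obtains C where "C \<ge> 1"
    "\<And>w. w \<in> \<Omega> \<Longrightarrow> - (\<epsilon>\<^sup>2 / C) \<le> - (v \<bullet> (w - z)) + C * (norm (w - z))\<^sup>2"
    "\<And>w. w \<in> \<Omega> \<Longrightarrow> - (v \<bullet> (w - z)) + C * (norm (w - z))\<^sup>2 \<le> 0 \<Longrightarrow> C * norm (w - z) \<le> \<epsilon>"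
proof -
  obtain d where d: "d > 0" "\<forall>w\<in>\<Omega>. norm (w - z) < d \<longrightarrow> v \<bullet> (w - z) \<le> \<epsilon> * norm (w - z)"
    using assms unfolding regular_normal_cone_iff by blast
  \<comment> \<open>The extra 1 makes the value strictly positive at distance \<open>d\<close> and
    beyond, so that value 0 is excluded there as well.\<close>
  define C where "C = max 1 ((norm v + 1) / d)"
  have C: "C \<ge> 1" "norm v + 1 \<le> C * d"
  proof -
    show "C \<ge> 1" by (simp add: C_def)
    have "(norm v + 1) / d \<le> C" by (simp add: C_def)
    then show "norm v + 1 \<le> C * d" using d(1) by (simp add: field_simps)
  qed
  have far: "- (v \<bullet> (w - z)) + C * (norm (w - z))\<^sup>2 > 0" if "norm (w - z) \<ge> d" for w
  proof -
    define s where "s = norm (w - z)"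
    have s: "s \<ge> d" "s > 0" using that d(1) by (auto simp: s_def)
    have "(norm v + 1) * s \<le> C * s * s"
      using C s by (intro mult_right_mono) (auto intro: order_trans[OF C(2)] mult_left_mono)
    moreover have "v \<bullet> (w - z) \<le> norm v * s" unfolding s_def by (rule norm_cauchy_schwarz)
    ultimately show ?thesis using s by (simp add: s_def[symmetric] power2_eq_square algebra_simps)
  qed
  have near: "v \<bullet> (w - z) \<le> \<epsilon> * norm (w - z)" if "w \<in> \<Omega>" "norm (w - z) < d" for w
    using d(2) that by blast
  show thesis
  proof (rule that[of C])
    fix w assume w: "w \<in> \<Omega>"
    define s where "s = norm (w - z)"
    show "- (\<epsilon>\<^sup>2 / C) \<le> - (v \<bullet> (w - z)) + C * (norm (w - z))\<^sup>2"
    proof (cases "s < d")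
      case True
      have "0 \<le> (\<epsilon> - C * s)\<^sup>2 + \<epsilon> * (C * s)" using \<open>\<epsilon> > 0\<close> C(1) by (simp add: s_def)
      then have "\<epsilon> * (C * s) \<le> \<epsilon>\<^sup>2 + (C * s)\<^sup>2" by (simp add: power2_eq_square algebra_simps)
      then have "\<epsilon> * s \<le> \<epsilon>\<^sup>2 / C + C * s\<^sup>2" using C(1) by (simp add: field_simps power2_eq_square)
      then show ?thesis using near[OF w] True by (simp add: s_def)
    next
      case False
      have "0 \<le> \<epsilon>\<^sup>2 / C" using C(1) by simp
      then show ?thesis using far[of w] False by (simp add: s_def)
    qed
    assume le: "- (v \<bullet> (w - z)) + C * (norm (w - z))\<^sup>2 \<le> 0"
    then have "s < d" using far[of w] by (force simp: s_def)
    then have "C * s * s \<le> \<epsilon> * s" using near[OF w] le by (simp add: s_def power2_eq_square)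
    then show "C * norm (w - z) \<le> \<epsilon>"
      using \<open>\<epsilon> > 0\<close> by (cases "s = 0") (auto simp: s_def)
  qed (rule C)
qed

text \<open>With \<open>C\<close> fixed, minimisers for \<open>p = Suc j\<close> and
  \<open>\<Lambda> = 1 / Suc j\<close> accumulate at a point of \<open>E\<close> with nonpositive
  supported value, hence of norm at most \<open>\<epsilon> / C\<close>. The lower support there
  limits what the penalties can amount to. Everything is read off at one late index, the factors 2
  leaving room for strict inequalities.\<close>

lemma (in finite_measure) penalized_limit:
  fixes \<Gamma> :: "'a \<Rightarrow> ('p::euclidean_space \<times> 'q::euclidean_space) set" and xstar :: 'p and ystar :: 'q
    and R \<epsilon> :: real and E :: "('p \<times> 'q) set"
  defines "K \<equiv> measure M (space M)"
  assumes graph: "{(t, x). t \<in> space M \<and> x \<in> \<Gamma> t} \<in> sets (M \<Otimes>\<^sub>M borel)"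
    and closed: "\<And>t. t \<in> space M \<Longrightarrow> closed (\<Gamma> t)"
    and bdd: "\<And>t. t \<in> space M \<Longrightarrow> \<Gamma> t \<subseteq> cball 0 R" and R: "R \<ge> 0"
    and zero: "AE t in M. 0 \<in> \<Gamma> t"
    and decomp: "atomic_decomposition M Tpa Tna"
    and conv: "AE t in M. t \<in> Tna \<longrightarrow> (\<forall>x. convex {v. (x, v) \<in> \<Gamma> t})"
    and K: "K > 0"
    and E: "\<And>x v. v \<in> borel_measurable M \<Longrightarrow> (AE t in M. (x, v t) \<in> \<Gamma> t) \<Longrightarrow> (x, \<integral>t. v t \<partial>M) \<in> E"
    and normal: "(xstar, - ystar) \<in> regular_normal_cone 0 E"
    and \<epsilon>: "\<epsilon> > 0"
  obtains u v wu wv \<xi> b C p \<Lambda> where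
    "C \<ge> 1" "p > 0" "0 < \<Lambda>" "\<Lambda> \<le> \<epsilon>"
    "(\<lambda>t. (u t, v t)) \<in> selections M \<Gamma>"
    "wu \<in> borel_measurable M" "wv \<in> borel_measurable M"
    "AE t in M. norm (wu t) \<le> \<Lambda> * R \<and> norm (wv t) \<le> \<Lambda> * R"
    "(\<integral>t. u t \<partial>M) = K *\<^sub>R \<xi>"
    "C * norm \<xi> \<le> 2 * \<epsilon>" "C * norm b \<le> 2 * \<epsilon>"
    "(\<integral>t. (norm (v t))\<^sup>2 \<partial>M) \<le> 2 * \<epsilon>" "p * (\<integral>t. (norm (u t - \<xi>))\<^sup>2 \<partial>M) \<le> 2 * \<epsilon>\<^sup>2"
    "AE t in M. - ((- (1 / K) *\<^sub>R xstar + (2 * C / K) *\<^sub>R \<xi> + (2 * p) *\<^sub>R (u t - \<xi>) + (2 * \<Lambda>) *\<^sub>R u t - 2 *\<^sub>R wu t,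
        ystar + (2 * C) *\<^sub>R b + (2 * \<epsilon> + 2 * \<Lambda>) *\<^sub>R v t - 2 *\<^sub>R wv t)) \<in> regular_normal_cone (u t, v t) (\<Gamma> t)"
    "AE t in M. (norm (u t - \<xi>))\<^sup>2 \<le> (norm \<xi>)\<^sup>2 + \<epsilon>\<^sup>2"
proof -
  obtain C where C: "C \<ge> 1"
    and low: "\<And>w. w \<in> E \<Longrightarrow> - (\<epsilon>\<^sup>2 / C) \<le> - ((xstar, - ystar) \<bullet> (w - 0)) + C * (norm (w - 0))\<^sup>2"
    and small: "\<And>w. w \<in> E \<Longrightarrow> - ((xstar, - ystar) \<bullet> (w - 0)) + C * (norm (w - 0))\<^sup>2 \<le> 0 \<Longrightarrow> C * norm (w - 0) \<le> \<epsilon>"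
    by (rule regular_normal_quadratic_support[OF normal \<epsilon>]) (rule that; assumption)
  define F where "F \<xi> b = - (xstar \<bullet> \<xi>) + ystar \<bullet> b + C * ((norm \<xi>)\<^sup>2 + (norm b)\<^sup>2)" for \<xi> b
  have F: "- ((xstar, - ystar) \<bullet> ((\<xi>, b) - 0)) + C * (norm ((\<xi>, b) - 0))\<^sup>2 = F \<xi> b" for \<xi> b
    by (simp add: F_def norm_Pair)
  define L where "L \<Lambda> = norm xstar * R / K + norm ystar * R + C * (3 * R\<^sup>2 / K + 3 * R\<^sup>2 * K) + 2 * \<Lambda> * R\<^sup>2" for \<Lambda>
  define PM where "PM p \<Lambda> u v wu wv \<xi> b \<longleftrightarrow>
    (\<lambda>t. (u t, v t)) \<in> selections M \<Gamma> \<and>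
    wu \<in> borel_measurable M \<and> wv \<in> borel_measurable M \<and>
    (AE t in M. norm (wu t) \<le> \<Lambda> * R \<and> norm (wv t) \<le> \<Lambda> * R) \<and>
    (\<integral>t. u t \<partial>M) = K *\<^sub>R \<xi> \<and> b = (\<integral>t. v t \<partial>M) \<and> norm \<xi> \<le> R \<and> norm b \<le> R * K \<and>
    F \<xi> b + \<epsilon> * (\<integral>t. (norm (v t))\<^sup>2 \<partial>M) + p * (\<integral>t. (norm (u t - \<xi>))\<^sup>2 \<partial>M) \<le> 2 * \<Lambda> * R\<^sup>2 * K \<and>
    (AE t in M. - ((- (1 / K) *\<^sub>R xstar + (2 * C / K) *\<^sub>R \<xi> + (2 * p) *\<^sub>R (u t - \<xi>) + (2 * \<Lambda>) *\<^sub>R u t - 2 *\<^sub>R wu t,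
        ystar + (2 * C) *\<^sub>R b + (2 * \<epsilon> + 2 * \<Lambda>) *\<^sub>R v t - 2 *\<^sub>R wv t)) \<in> regular_normal_cone (u t, v t) (\<Gamma> t)) \<and>
    (AE t in M. (norm (u t - \<xi>))\<^sup>2 \<le> (norm \<xi>)\<^sup>2 + L \<Lambda> / p)"
    for p \<Lambda> :: real and u :: "'a \<Rightarrow> 'p" and v :: "'a \<Rightarrow> 'q" and wu wv \<xi> b
  have "\<exists>u v wu wv \<xi> b. PM (real (Suc j)) (1 / real (Suc j)) u v wu wv \<xi> b" for j
  proof (rule penalized_minimizer[of \<Gamma> R C "real (Suc j)" \<epsilon> "1 / real (Suc j)" xstar ystar,
        OF graph _ _ R zero K[unfolded K_def]])
    fix u v wu wv \<xi> b
    assume "(\<lambda>t. (u t, v t)) \<in> selections M \<Gamma>"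
      "wu \<in> borel_measurable M" "wv \<in> borel_measurable M"
      "AE t in M. norm (wu t) \<le> 1 / real (Suc j) * R \<and> norm (wv t) \<le> 1 / real (Suc j) * R"
      "(\<integral>t. u t \<partial>M) = measure M (space M) *\<^sub>R \<xi>" "b = (\<integral>t. v t \<partial>M)" "norm \<xi> \<le> R"
      "norm b \<le> R * measure M (space M)"
      "- (xstar \<bullet> \<xi>) + ystar \<bullet> b + C * ((norm \<xi>)\<^sup>2 + (norm b)\<^sup>2) + \<epsilon> * (\<integral>t. (norm (v t))\<^sup>2 \<partial>M) +
         real (Suc j) * (\<integral>t. (norm (u t - \<xi>))\<^sup>2 \<partial>M) \<le> 2 * (1 / real (Suc j)) * R\<^sup>2 * measure M (space M)"
      "AE t in M. - ((- (1 / measure M (space M)) *\<^sub>R xstar + (2 * C / measure M (space M)) *\<^sub>R \<xi> +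
          (2 * real (Suc j)) *\<^sub>R (u t - \<xi>) + (2 * (1 / real (Suc j))) *\<^sub>R u t - 2 *\<^sub>R wu t,
          ystar + (2 * C) *\<^sub>R b + (2 * \<epsilon> + 2 * (1 / real (Suc j))) *\<^sub>R v t - 2 *\<^sub>R wv t))
          \<in> regular_normal_cone (u t, v t) (\<Gamma> t)"
      "AE t in M. (norm (u t - \<xi>))\<^sup>2 \<le> (norm \<xi>)\<^sup>2 + (norm xstar * R / measure M (space M) + norm ystar * R +
          C * (3 * R\<^sup>2 / measure M (space M) + 3 * R\<^sup>2 * measure M (space M)) + 2 * (1 / real (Suc j)) * R\<^sup>2) / real (Suc j)"
    then show ?thesis unfolding PM_def F_def L_def K_def by blast
  qed (use closed bdd C \<epsilon> in auto)
  then obtain u v wu wv \<xi> b where PM: "\<And>j. PM (real (Suc j)) (1 / real (Suc j)) (u j) (v j) (wu j) (wv j) (\<xi> j) (b j)"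
    by metis
  define J where "J j = \<epsilon> * (\<integral>t. (norm (v j t))\<^sup>2 \<partial>M) + real (Suc j) * (\<integral>t. (norm (u j t - \<xi> j))\<^sup>2 \<partial>M)" for j
  define s where "s j = 2 * (1 / real (Suc j)) * R\<^sup>2 * K" for j
  note PMj = PM[unfolded PM_def]
  have sel: "(\<lambda>t. (u j t, v j t)) \<in> selections M \<Gamma>" for j using PMj[of j] by (elim conjE)
  have b: "b j = (\<integral>t. v j t \<partial>M)" for j using PMj[of j] by (elim conjE)
  have \<xi>R: "norm (\<xi> j) \<le> R" for j using PMj[of j] by (elim conjE)
  have bR: "norm (b j) \<le> R * K" for j using PMj[of j] by (elim conjE)
  have FJ: "F (\<xi> j) (b j) + J j \<le> s j" for j
    using PMj[of j] unfolding J_def s_def add.assoc[symmetric] by (elim conjE)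
  have J0: "J j \<ge> 0" "\<epsilon> * (\<integral>t. (norm (v j t))\<^sup>2 \<partial>M) \<le> J j" "real (Suc j) * (\<integral>t. (norm (u j t - \<xi> j))\<^sup>2 \<partial>M) \<le> J j" for j
    using \<epsilon> by (auto simp: J_def simp del: of_nat_Suc intro!: add_nonneg_nonneg mult_nonneg_nonneg)
  have inv0: "(\<lambda>j. c * (1 / real (Suc j))) \<longlonglongrightarrow> 0" for c
    using tendsto_mult_left[OF LIMSEQ_inverse_real_of_nat, of c] by (simp add: inverse_eq_divide)
  have s0: "s \<longlonglongrightarrow> 0" using inv0[of "2 * R\<^sup>2 * K"] by (simp add: s_def[abs_def] mult_ac)
  define B where "B = 2 * R\<^sup>2 * K + norm xstar * R + norm ystar * (R * K)"
  \<comment> \<open>\<open>F\<close> is bounded below uniformly in \<open>j\<close>, so the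
    penalties stay bounded and the squared distance to the mean is at most \<open>B / Suc j\<close>.
    This is the L2 hypothesis of \<open>selections_closure\<close>.\<close>
  have JB: "J j \<le> B" for j
  proof -
    have "xstar \<bullet> \<xi> j \<le> norm xstar * R"
      using norm_cauchy_schwarz[of xstar "\<xi> j"] mult_left_mono[OF \<xi>R, of "norm xstar" j] by simp
    moreover have "- (ystar \<bullet> b j) \<le> norm ystar * (R * K)"
      using norm_cauchy_schwarz[of "- ystar" "b j"] mult_left_mono[OF bR, of "norm ystar" j] by simp
    moreover have "0 \<le> C * ((norm (\<xi> j))\<^sup>2 + (norm (b j))\<^sup>2)" using C by simp
    moreover have "s j \<le> 2 * R\<^sup>2 * K"
    proof -
      have "(2 * R\<^sup>2 * K) * (1 / real (Suc j)) \<le> (2 * R\<^sup>2 * K) * 1" using K by (intro mult_left_mono) auto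
      then show ?thesis by (simp add: s_def mult_ac)
    qed
    ultimately show ?thesis using FJ[of j] by (simp add: F_def B_def)
  qed
  have L2: "(\<lambda>j. \<integral>t. (norm (fst (u j t, v j t) - \<xi> j))\<^sup>2 \<partial>M) \<longlonglongrightarrow> 0"
  proof (rule tendsto_sandwich[OF _ _ tendsto_const inv0[of B]])
    have "(\<integral>t. (norm (u j t - \<xi> j))\<^sup>2 \<partial>M) \<le> B * (1 / real (Suc j))" for j
      using order_trans[OF J0(3) JB, of j] by (simp add: field_simps)
    then show "eventually (\<lambda>j. (\<integral>t. (norm (fst (u j t, v j t) - \<xi> j))\<^sup>2 \<partial>M) \<le> B * (1 / real (Suc j))) sequentially"
      by simp
  qed simp
  have bnd: "bounded (range \<xi>)" using \<xi>R by (auto simp: bounded_iff)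
  obtain r x vl where r: "strict_mono r" "(\<lambda>n. \<xi> (r n)) \<longlonglongrightarrow> x" "vl \<in> borel_measurable M"
    "(\<lambda>n. \<integral>t. snd (u (r n) t, v (r n) t) \<partial>M) \<longlonglongrightarrow> (\<integral>t. vl t \<partial>M)" "AE t in M. (x, vl t) \<in> \<Gamma> t"
    by (rule selections_closure[of \<Gamma> R Tpa Tna "\<lambda>n t. (u n t, v n t)" \<xi>, OF _ _ decomp conv sel bnd L2])
      (use closed bdd in \<open>blast intro: that\<close>)+
  define y where "y = (\<integral>t. vl t \<partial>M)"
  have blim: "(\<lambda>n. b (r n)) \<longlonglongrightarrow> y" using r(4) by (simp add: b y_def)
  have xyE: "(x, y) \<in> E" unfolding y_def by (rule E[OF r(3,5)])
  have Flim: "(\<lambda>n. F (\<xi> (r n)) (b (r n))) \<longlonglongrightarrow> F x y"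
    unfolding F_def by (intro tendsto_intros r(2) blim)
  have srlim: "(\<lambda>n. s (r n)) \<longlonglongrightarrow> 0" using LIMSEQ_subseq_LIMSEQ[OF s0 r(1)] by (simp add: o_def)
  have "F x y \<le> 0"
  proof (rule LIMSEQ_le[OF Flim srlim])
    have "F (\<xi> (r n)) (b (r n)) \<le> s (r n)" for n using FJ[of "r n"] J0(1)[of "r n"] by linarith
    then show "\<exists>N. \<forall>n\<ge>N. F (\<xi> (r n)) (b (r n)) \<le> s (r n)" by blast
  qed
  then have Cxy: "C * norm (x, y) \<le> \<epsilon>" using small[OF xyE, unfolded F] by simp
  have nxy: "norm x \<le> norm (x, y)" "norm y \<le> norm (x, y)" by (rule norm_fst_le, rule norm_snd_le)
  have "C * norm x < 2 * \<epsilon>" "C * norm y < 2 * \<epsilon>"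
    using mult_left_mono[OF nxy(1), of C] mult_left_mono[OF nxy(2), of C] C Cxy \<epsilon> by linarith+
  then have e1: "eventually (\<lambda>n. C * norm (\<xi> (r n)) < 2 * \<epsilon>) sequentially"
    and e2: "eventually (\<lambda>n. C * norm (b (r n)) < 2 * \<epsilon>) sequentially"
    by (intro order_tendstoD(2)[OF tendsto_mult_left[OF tendsto_norm]] r(2) blim; simp)+
  \<comment> \<open>The penalties are at most \<open>s j - F (\<xi> j) (b j)\<close>; along the
    subsequence this tends to \<open>- F x y\<close>, which the support bounds by
    \<open>\<epsilon>\<^sup>2 / C\<close>.\<close>
  have "- F x y < 2 * \<epsilon>\<^sup>2 / C"
  proof -
    have "\<epsilon>\<^sup>2 / C > 0" using C \<epsilon> by simp
    then show ?thesis using low[OF xyE, unfolded F] by simp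
  qed
  moreover have "(\<lambda>n. s (r n) - F (\<xi> (r n)) (b (r n))) \<longlonglongrightarrow> 0 - F x y" by (intro tendsto_diff srlim Flim)
  ultimately have e3: "eventually (\<lambda>n. s (r n) - F (\<xi> (r n)) (b (r n)) < 2 * \<epsilon>\<^sup>2 / C) sequentially"
    by (intro order_tendstoD(2)) auto
  have invr: "(\<lambda>n. c * (1 / real (Suc (r n)))) \<longlonglongrightarrow> 0" for c
    using LIMSEQ_subseq_LIMSEQ[OF inv0 r(1), of c] by (simp add: o_def)
  have e4: "eventually (\<lambda>n. 1 * (1 / real (Suc (r n))) < \<epsilon>) sequentially"
    by (rule order_tendstoD(2)[OF invr \<epsilon>])
  have e5: "eventually (\<lambda>n. L 1 * (1 / real (Suc (r n))) < \<epsilon>\<^sup>2) sequentially"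
    by (rule order_tendstoD(2)[OF invr]) (use \<epsilon> in simp)
  obtain n where n: "C * norm (\<xi> (r n)) < 2 * \<epsilon>" "C * norm (b (r n)) < 2 * \<epsilon>"
    "s (r n) - F (\<xi> (r n)) (b (r n)) < 2 * \<epsilon>\<^sup>2 / C" "1 * (1 / real (Suc (r n))) < \<epsilon>" "L 1 * (1 / real (Suc (r n))) < \<epsilon>\<^sup>2"
    using eventually_happens'[OF sequentially_bot eventually_conj[OF e1 eventually_conj[OF e2 eventually_conj[OF e3 eventually_conj[OF e4 e5]]]]]
    by blast
  define j where "j = r n"
  have Jj: "J j \<le> 2 * \<epsilon>\<^sup>2 / C" using FJ[of j] n(3) by (simp add: j_def)
  have "2 * \<epsilon>\<^sup>2 / C \<le> 2 * \<epsilon>\<^sup>2" using C mult_right_mono[of 1 C "\<epsilon>\<^sup>2"] by (simp add: field_simps)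
  with Jj have Jj': "J j \<le> 2 * \<epsilon>\<^sup>2" by linarith
  show thesis
  proof (rule that[of C "real (Suc j)" "1 / real (Suc j)" "u j" "v j" "wu j" "wv j" "\<xi> j" "b j"])
    \<comment> \<open>This penalty has weight \<open>\<epsilon>\<close>, which costs one of the two
      powers in the bound \<open>2 * \<epsilon>\<^sup>2\<close>.\<close>
    show "(\<integral>t. (norm (v j t))\<^sup>2 \<partial>M) \<le> 2 * \<epsilon>"
    proof -
      have "\<epsilon> * (\<integral>t. (norm (v j t))\<^sup>2 \<partial>M) \<le> \<epsilon> * (2 * \<epsilon>)"
        using J0(2)[of j] Jj' by (simp add: power2_eq_square mult_ac)
      then show ?thesis using \<epsilon> by simp
    qed
    show "real (Suc j) * (\<integral>t. (norm (u j t - \<xi> j))\<^sup>2 \<partial>M) \<le> 2 * \<epsilon>\<^sup>2" using J0(3)[of j] Jj' by linarith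
    have "L (1 / real (Suc j)) / real (Suc j) \<le> \<epsilon>\<^sup>2"
    proof -
      have "2 * (1 / real (Suc j)) * R\<^sup>2 \<le> 2 * 1 * R\<^sup>2" by (intro mult_right_mono mult_left_mono) auto
      then have "L (1 / real (Suc j)) \<le> L 1" by (simp add: L_def)
      then have "L (1 / real (Suc j)) / real (Suc j) \<le> L 1 / real (Suc j)" by (intro divide_right_mono) auto
      then show ?thesis using n(5) by (simp add: j_def)
    qed
    moreover have "AE t in M. (norm (u j t - \<xi> j))\<^sup>2 \<le> (norm (\<xi> j))\<^sup>2 + L (1 / real (Suc j)) / real (Suc j)"
      using PMj[of j] by (elim conjE)
    ultimately show "AE t in M. (norm (u j t - \<xi> j))\<^sup>2 \<le> (norm (\<xi> j))\<^sup>2 + \<epsilon>\<^sup>2"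
      by (auto elim!: eventually_mono)
    show "C \<ge> 1" by (rule C)
    show "0 < real (Suc j)" "0 < 1 / real (Suc j)" by simp_all
    show "1 / real (Suc j) \<le> \<epsilon>" using n(4) unfolding j_def by linarith
    show "(\<lambda>t. (u j t, v j t)) \<in> selections M \<Gamma>" by (rule sel)
    show "wu j \<in> borel_measurable M" using PMj[of j] by (elim conjE)
    show "wv j \<in> borel_measurable M" using PMj[of j] by (elim conjE)
    show "AE t in M. norm (wu j t) \<le> 1 / real (Suc j) * R \<and> norm (wv j t) \<le> 1 / real (Suc j) * R"
      using PMj[of j] by (elim conjE)
    show "(\<integral>t. u j t \<partial>M) = K *\<^sub>R \<xi> j" using PMj[of j] by (elim conjE)
    show "C * norm (\<xi> j) \<le> 2 * \<epsilon>" using n(1) unfolding j_def by linarith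
    show "C * norm (b j) \<le> 2 * \<epsilon>" using n(2) unfolding j_def by linarith
    show "AE t in M. - ((- (1 / K) *\<^sub>R xstar + (2 * C / K) *\<^sub>R \<xi> j + (2 * real (Suc j)) *\<^sub>R (u j t - \<xi> j) +
        (2 * (1 / real (Suc j))) *\<^sub>R u j t - 2 *\<^sub>R wu j t,
        ystar + (2 * C) *\<^sub>R b j + (2 * \<epsilon> + 2 * (1 / real (Suc j))) *\<^sub>R v j t - 2 *\<^sub>R wv j t))
        \<in> regular_normal_cone (u j t, v j t) (\<Gamma> t)"
      using PMj[of j] by (elim conjE)
  qed
qed

section \<open>Transfer to normal integrands\<close>

lemma Linf_norm_le:
  assumes "f \<in> borel_measurable M" "AE t in M. norm (f t) \<le> c"
  shows "Linf_norm M f \<le> ennreal c"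
  unfolding Linf_norm_def
proof (rule esssup_I)
  show "(\<lambda>t. ennreal (norm (f t))) \<in> borel_measurable M" using assms(1) by measurable
  show "AE t in M. ennreal (norm (f t)) \<le> ennreal c"
    using assms(2) by eventually_elim (rule ennreal_leI)
qed

lemma Linf_I:
  assumes "f \<in> borel_measurable M" "AE t in M. norm (f t) \<le> c"
  shows "f \<in> Linf M"
  using Linf_norm_le[OF assms] assms(1) by (auto simp: Linf_def intro: le_less_trans)

text \<open>The map \<open>(u, v)\<close> to \<open>(x0 + u, y0 + k *\<^sub>R v)\<close> identifies
  the two sets locally: \<open>norm u < \<rho>\<close> leaves room around \<open>u\<close>, and
  \<open>norm v \<le> 2\<close> is automatic since values and \<open>y0\<close> have norm at most
  \<open>k\<close>. Its inverse adjoint sends the normal to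
  \<open>(\<alpha>, (1 / k) *\<^sub>R \<beta>)\<close>, and multiplication by \<open>k\<close> stays
  in the cone. For \<open>k \<ge> 1\<close> the map does not shrink norms.\<close>

lemma regular_normal_cone_rescale:
  fixes \<Phi> :: "'p::euclidean_space \<Rightarrow> 'q::euclidean_space set"
  assumes N: "(\<alpha>, \<beta>) \<in> regular_normal_cone (u, v) {(u, v). norm u \<le> \<rho> \<and> norm v \<le> 2 \<and> y0 + k *\<^sub>R v \<in> \<Phi> (x0 + u)}"
    (is "_ \<in> regular_normal_cone _ ?G")
    and u: "norm u < \<rho>" and k: "k \<ge> 1" and y0: "norm y0 \<le> k"
    and bdd: "\<And>x. x \<in> cball x0 \<rho> \<Longrightarrow> \<Phi> x \<subseteq> cball 0 k"
  shows "(k *\<^sub>R \<alpha>, \<beta>) \<in> regular_normal_cone (x0 + u, y0 + k *\<^sub>R v) (gph \<Phi>)"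
  unfolding regular_normal_cone_iff
proof (intro conjI allI impI)
  show "(x0 + u, y0 + k *\<^sub>R v) \<in> gph \<Phi>"
    using N by (auto simp: regular_normal_cone_iff gph_def)
  fix e :: real assume "e > 0"
  then have "e / k > 0" using k by simp
  with N obtain d where d: "d > 0" "\<forall>w\<in>?G. norm (w - (u, v)) < d \<longrightarrow>
      (\<alpha>, \<beta>) \<bullet> (w - (u, v)) \<le> e / k * norm (w - (u, v))"
    unfolding regular_normal_cone_iff by blast
  have "(k *\<^sub>R \<alpha>, \<beta>) \<bullet> (w - (x0 + u, y0 + k *\<^sub>R v)) \<le> e * norm (w - (x0 + u, y0 + k *\<^sub>R v))"
    if w: "w \<in> gph \<Phi>" and near: "norm (w - (x0 + u, y0 + k *\<^sub>R v)) < min d (\<rho> - norm u)" for w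
  proof -
    obtain x y where xy: "w = (x, y)" "y \<in> \<Phi> x" using w by (cases w) (auto simp: gph_def)
    define u' v' where "u' = x - x0" and "v' = (1 / k) *\<^sub>R (y - y0)"
    have x: "x = x0 + u'" and y: "y = y0 + k *\<^sub>R v'" using k by (auto simp: u'_def v'_def)
    have dw: "w - (x0 + u, y0 + k *\<^sub>R v) = (u' - u, k *\<^sub>R (v' - v))"
      by (simp add: xy(1) x y scaleR_diff_right)
    have "norm (u' - u) \<le> norm (u' - u, k *\<^sub>R (v' - v))" by (rule norm_fst_le)
    then have "norm u' \<le> \<rho>" using near norm_triangle_ineq2[of u' u] unfolding dw by simp
    moreover have "norm v' \<le> 2"
    proof -
      have "x \<in> cball x0 \<rho>" using \<open>norm u' \<le> \<rho>\<close> by (simp add: u'_def dist_norm norm_minus_commute)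
      then have "y \<in> cball 0 k" using bdd xy(2) by blast
      then have "norm y \<le> k" by simp
      then have "norm (y - y0) \<le> 2 * k" using y0 norm_triangle_ineq4[of y y0] by linarith
      then have "norm (y - y0) / k \<le> 2 * k / k" using k by (intro divide_right_mono) auto
      moreover have "norm v' = norm (y - y0) / k" using k unfolding v'_def norm_scaleR by simp
      ultimately show ?thesis using k by simp
    qed
    ultimately have mem: "(u', v') \<in> ?G" using xy(2) x y by simp
    have le: "norm ((u', v') - (u, v)) \<le> norm (w - (x0 + u, y0 + k *\<^sub>R v))"
    proof -
      have "1 * norm (v' - v) \<le> k * norm (v' - v)" using k by (intro mult_right_mono) auto
      then have "(norm (v' - v))\<^sup>2 \<le> (norm (k *\<^sub>R (v' - v)))\<^sup>2" using k by (intro power_mono) auto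
      then show ?thesis unfolding dw by (simp add: norm_Pair)
    qed
    then have "(\<alpha>, \<beta>) \<bullet> ((u', v') - (u, v)) \<le> e / k * norm ((u', v') - (u, v))"
      using d(2) mem near by (meson le_less_trans less_le_trans min.cobounded1)
    also have "\<dots> \<le> e / k * norm (w - (x0 + u, y0 + k *\<^sub>R v))"
      using le \<open>e / k > 0\<close> by (intro mult_left_mono) auto
    finally have "k * ((\<alpha>, \<beta>) \<bullet> ((u', v') - (u, v))) \<le> k * (e / k * norm (w - (x0 + u, y0 + k *\<^sub>R v)))"
      using k by (intro mult_left_mono) auto
    moreover have "k * ((\<alpha>, \<beta>) \<bullet> ((u', v') - (u, v))) = (k *\<^sub>R \<alpha>, \<beta>) \<bullet> (w - (x0 + u, y0 + k *\<^sub>R v))"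
      unfolding dw by (simp add: distrib_left)
    ultimately show ?thesis using k by simp
  qed
  moreover have "min d (\<rho> - norm u) > 0" using d(1) u by simp
  ultimately show "\<exists>d>0. \<forall>w\<in>gph \<Phi>. norm (w - (x0 + u, y0 + k *\<^sub>R v)) < d \<longrightarrow>
      (k *\<^sub>R \<alpha>, \<beta>) \<bullet> (w - (x0 + u, y0 + k *\<^sub>R v)) \<le> e * norm (w - (x0 + u, y0 + k *\<^sub>R v))"
    by blast
qed

text \<open>Being an atom depends only on which measurable sets are null, so measures with the same
  null sets share their decompositions.\<close>

lemma atomic_decomposition_cong:
  assumes decomp: "atomic_decomposition M Tpa Tna" and sets: "sets N = sets M"
    and null: "\<And>A. A \<in> sets M \<Longrightarrow> emeasure N A = 0 \<longleftrightarrow> emeasure M A = 0"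
  shows "atomic_decomposition N Tpa Tna"
proof -
  have sp: "space N = space M" using sets by (rule sets_eq_imp_space_eq)
  have zero: "emeasure (density N (indicator T)) B = 0 \<longleftrightarrow> emeasure (density M (indicator T)) B = 0"
    if "T \<in> sets M" "B \<in> sets M" for T B
    using emeasure_restricted[of T M B] emeasure_restricted[of T N B] that sets null[of "T \<inter> B"] by simp
  have atom: "is_atom (density N (indicator T)) A \<longleftrightarrow> is_atom (density M (indicator T)) A"
    if T: "T \<in> sets M" for T A
    unfolding is_atom_def zero_less_iff_neq_zero sets_density sets using zero[OF T] by auto
  have "purely_atomic (density N (indicator T)) \<longleftrightarrow> purely_atomic (density M (indicator T))"
    if T: "T \<in> sets M" for T
    unfolding purely_atomic_def zero_less_iff_neq_zero sets_density sets using zero[OF T] atom[OF T] by simp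
  moreover have "nonatomic (density N (indicator T)) \<longleftrightarrow> nonatomic (density M (indicator T))"
    if T: "T \<in> sets M" for T
    unfolding nonatomic_def using atom[OF T] by simp
  ultimately show ?thesis using decomp unfolding atomic_decomposition_def sets sp by simp
qed

text \<open>The problem is transferred to the measure \<open>\<kappa>\<mu>\<close> and the variables \<open>u = x - xbar\<close>,
  \<open>v = (y - ysel(t)) / \<kappa>(t)\<close>, in which the constraint sets are uniformly bounded.\<close>

lemma approximate_coderivatives:
  fixes M :: "'t measure"
    and \<Phi> :: "'t \<Rightarrow> real^'n \<Rightarrow> (real^'m) set"
    and xbar xstar :: "real^'n" and ybar ystar :: "real^'m"
    and ysel :: "'t \<Rightarrow> real^'m" and \<rho> \<epsilon> :: real and \<kappa> :: "'t \<Rightarrow> real"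
  defines "K \<equiv> \<integral>t. \<kappa> t \<partial>M" and "R \<equiv> \<rho> + 2"
  assumes fin: "finite_measure M"
    and decomp: "atomic_decomposition M Tpa Tna"
    and normal: "set_valued_normal_integrand M \<Phi>"
    and \<rho>: "\<rho> > 0"
    and \<kappa>: "integrable M \<kappa>" "\<And>t. \<kappa> t \<ge> 1"
    and conv: "AE t in M. t \<in> Tna \<longrightarrow> (\<forall>x\<in>cball xbar \<rho>. convex (\<Phi> t x))"
    and bound: "AE t in M. \<forall>x\<in>cball xbar \<rho>. \<Phi> t x \<subseteq> cball 0 (\<kappa> t)"
    and ysel: "ysel \<in> integral_selections M \<Phi> xbar ybar"
    and xstar: "xstar \<in> regular_coderivative (expected_integral M \<Phi>) xbar ybar ystar"
    and K: "K > 0"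
    and \<epsilon>: "0 < \<epsilon>" "\<epsilon> \<le> 1" "5 * \<epsilon> < \<rho>"
  shows "\<exists>x xs xsstar ys ysstar.
      xs \<in> Linf M \<and> integrable M xsstar \<and> integrable M ys \<and> ysstar \<in> Linf M \<and>
      (AE t in M. xsstar t \<in> regular_coderivative (\<Phi> t) (xs t) (ys t) (ysstar t)) \<and>
      norm (xbar - x) \<le> 2 * \<epsilon> \<and>
      Linf_norm M (\<lambda>t. xbar - xs t) \<le> ennreal (5 * \<epsilon>) \<and>
      (LINT t|M. norm (ysel t - ys t)) \<le> (K + 2) * sqrt \<epsilon> \<and>
      Linf_norm M (\<lambda>t. ysstar t - ystar) \<le> ennreal ((12 + 2 * R) * \<epsilon>) \<and>
      (LINT t|M. norm (xsstar t) * norm (xs t - x)) \<le> (3 * (norm xstar / K + 4 / K + 10 + 2 * R) * K + 4) * \<epsilon> \<and>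
      norm ((LINT t|M. xsstar t) - xstar) \<le> (4 + 4 * K + 2 * R * K) * \<epsilon>"
proof -
  interpret M: finite_measure M by (rule fin)
  have [measurable]: "\<kappa> \<in> borel_measurable M" using \<kappa>(1) by simp
  have k0: "0 < \<kappa> t" "0 \<le> \<kappa> t" for t using \<kappa>(2)[of t] by linarith+
  have ysint: "integrable M ysel" and ysbar: "integral\<^sup>L M ysel = ybar" and ys\<Phi>: "AE t in M. ysel t \<in> \<Phi> t xbar"
    using ysel by (auto simp: integral_selections_def)
  have [measurable]: "ysel \<in> borel_measurable M" using ysint by simp
  have ysR: "AE t in M. norm (ysel t) \<le> \<kappa> t"
    using ys\<Phi> bound by eventually_elim (use \<rho> in force)
  \<comment> \<open>Since \<open>\<kappa>\<close> is positive everywhere, \<open>N\<close> and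
    \<open>M\<close> have the same null sets; this transfers all almost everywhere statements and
    the atomic decomposition. The total mass of \<open>N\<close> is \<open>K\<close>.\<close>
  define N where "N = density M (\<lambda>t. ennreal (\<kappa> t))"
  have setsN [measurable_cong]: "sets N = sets M" and spN: "space N = space M" by (simp_all add: N_def)
  have AEN: "(AE t in N. P t) \<longleftrightarrow> (AE t in M. P t)" for P
    unfolding N_def using k0 by (subst AE_density) auto
  have intN: "integral\<^sup>L N f = (\<integral>t. \<kappa> t *\<^sub>R f t \<partial>M)" and integrableN: "integrable N f \<longleftrightarrow> integrable M (\<lambda>t. \<kappa> t *\<^sub>R f t)"
    if "f \<in> borel_measurable M" for f :: "'t \<Rightarrow> 'b::euclidean_space"
    unfolding N_def using that k0 by (simp_all add: integral_density integrable_density)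
  have eN: "emeasure N (space N) = ennreal K"
    unfolding N_def K_def using \<kappa> k0 by (subst emeasure_density) (auto simp: nn_integral_eq_integral)
  interpret N: finite_measure N by (rule finite_measureI) (simp add: eN)
  have KN: "measure N (space N) = K" using eN K by (simp add: measure_def)
  have decompN: "atomic_decomposition N Tpa Tna"
  proof (rule atomic_decomposition_cong[OF decomp setsN])
    fix A assume A: "A \<in> sets M"
    then have "A \<in> null_sets N \<longleftrightarrow> A \<in> null_sets M"
      using AE_iff_null_sets[of A N] AE_iff_null_sets[of A M] AEN[of "\<lambda>t. t \<notin> A"] setsN by simp
    then show "emeasure N A = 0 \<longleftrightarrow> emeasure M A = 0" using A setsN by (simp add: null_sets_def)
  qed
  \<comment> \<open>The bound 2 discards nothing over \<open>cball xbar \<rho>\<close> for almost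
    all \<open>t\<close>: \<open>ysel t\<close> and the values there have norm at most
    \<open>\<kappa> t\<close>, so they differ by at most \<open>2 * \<kappa> t\<close>.\<close>
  define \<Gamma> where "\<Gamma> t = {(u, v). norm u \<le> \<rho> \<and> norm v \<le> 2 \<and> ysel t + \<kappa> t *\<^sub>R v \<in> \<Phi> t (xbar + u)}" for t
  have R0: "R \<ge> 0" using \<rho> by (simp add: R_def)
  have graph: "{(t, z). t \<in> space N \<and> z \<in> \<Gamma> t} \<in> sets (N \<Otimes>\<^sub>M borel)"
  proof -
    let ?P = "M \<Otimes>\<^sub>M (borel :: ((real^'n) \<times> (real^'m)) measure)"
    have u: "(\<lambda>p. fst (snd p)) \<in> borel_measurable ?P" and v: "(\<lambda>p. snd (snd p)) \<in> borel_measurable ?P"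
      by (rule borel_measurable_continuous_on[OF _ measurable_snd]; intro continuous_intros)+
    define h where "h p = (fst p, xbar + fst (snd p), ysel (fst p) + \<kappa> (fst p) *\<^sub>R snd (snd p))"
      for p :: "'t \<times> (real^'n) \<times> (real^'m)"
    have h: "h \<in> ?P \<rightarrow>\<^sub>M ?P"
    proof -
      have "(\<lambda>p. (xbar + fst (snd p), ysel (fst p) + \<kappa> (fst p) *\<^sub>R snd (snd p))) \<in> borel_measurable ?P"
        by (intro borel_measurable_Pair borel_measurable_add borel_measurable_scaleR borel_measurable_const u v) measurable
      then show ?thesis unfolding h_def[abs_def] by (intro measurable_Pair measurable_fst)
    qed
    have G: "{(t, x, y). t \<in> space M \<and> y \<in> \<Phi> t x} \<in> sets ?P"
      using normal by (simp add: set_valued_normal_integrand_def)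
    have "{(t, z). t \<in> space N \<and> z \<in> \<Gamma> t} = (h -` {(t, x, y). t \<in> space M \<and> y \<in> \<Phi> t x} \<inter> space ?P) \<inter>
      {p \<in> space ?P. norm (fst (snd p)) \<le> \<rho>} \<inter> {p \<in> space ?P. norm (snd (snd p)) \<le> 2}"
      by (auto simp: \<Gamma>_def h_def spN space_pair_measure)
    also have "\<dots> \<in> sets ?P"
      by (intro sets.Int[OF sets.Int] measurable_sets[OF h G]
        borel_measurable_le[OF measurable_compose[OF u borel_measurable_norm] borel_measurable_const]
        borel_measurable_le[OF measurable_compose[OF v borel_measurable_norm] borel_measurable_const])
    also have "sets ?P = sets (N \<Otimes>\<^sub>M borel)" using setsN by (intro sets_pair_measure_cong) auto
    finally show ?thesis .
  qed
  have closed: "closed (\<Gamma> t)" if "t \<in> space N" for t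
  proof -
    have "closed (gph (\<Phi> t))" using normal that by (simp add: set_valued_normal_integrand_def spN)
    moreover have "continuous_on UNIV (\<lambda>z :: (real^'n) \<times> (real^'m). (xbar + fst z, ysel t + \<kappa> t *\<^sub>R snd z))"
      by (intro continuous_intros)
    ultimately have "closed ((\<lambda>z. (xbar + fst z, ysel t + \<kappa> t *\<^sub>R snd z)) -` gph (\<Phi> t))"
      by (rule closed_vimage)
    moreover have "\<Gamma> t = (cball 0 \<rho> \<times> cball 0 2) \<inter> (\<lambda>z. (xbar + fst z, ysel t + \<kappa> t *\<^sub>R snd z)) -` gph (\<Phi> t)"
      by (auto simp: \<Gamma>_def gph_def)
    ultimately show ?thesis by (simp add: closed_Int closed_Times)
  qed
  have bdd: "\<Gamma> t \<subseteq> cball 0 R" for t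
  proof
    fix z assume "z \<in> \<Gamma> t"
    then obtain u v where "z = (u, v)" "norm u \<le> \<rho>" "norm v \<le> 2" by (auto simp: \<Gamma>_def)
    then show "z \<in> cball 0 R" using norm_Pair_le[of u v] by (simp add: R_def)
  qed
  have zero: "AE t in N. 0 \<in> \<Gamma> t"
    unfolding AEN using ys\<Phi> by eventually_elim (use \<rho> in \<open>simp add: \<Gamma>_def zero_prod_def\<close>)
  have convN: "AE t in N. t \<in> Tna \<longrightarrow> (\<forall>x. convex {v. (x, v) \<in> \<Gamma> t})"
    unfolding AEN using conv
  proof eventually_elim
    case (elim t)
    show ?case
    proof (intro impI allI)
      fix x assume "t \<in> Tna"
      show "convex {v. (x, v) \<in> \<Gamma> t}"
      proof (cases "norm x \<le> \<rho>")
        case True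
        then have "xbar + x \<in> cball xbar \<rho>" by (simp add: dist_norm)
        then have cv: "convex (\<Phi> t (xbar + x))" using elim \<open>t \<in> Tna\<close> by blast
        have "convex {v. ysel t + \<kappa> t *\<^sub>R v \<in> \<Phi> t (xbar + x)}"
        proof (rule convexI)
          fix v w :: "real^'m" and a b :: real
          assume "v \<in> {v. ysel t + \<kappa> t *\<^sub>R v \<in> \<Phi> t (xbar + x)}" "w \<in> {v. ysel t + \<kappa> t *\<^sub>R v \<in> \<Phi> t (xbar + x)}"
            and ab: "0 \<le> a" "0 \<le> b" "a + b = 1"
          then have "a *\<^sub>R (ysel t + \<kappa> t *\<^sub>R v) + b *\<^sub>R (ysel t + \<kappa> t *\<^sub>R w) \<in> \<Phi> t (xbar + x)"
            by (intro convexD[OF cv]) auto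
          moreover have "a *\<^sub>R (ysel t + \<kappa> t *\<^sub>R v) + b *\<^sub>R (ysel t + \<kappa> t *\<^sub>R w) =
              (a + b) *\<^sub>R ysel t + \<kappa> t *\<^sub>R (a *\<^sub>R v + b *\<^sub>R w)"
            by (simp add: algebra_simps)
          ultimately show "a *\<^sub>R v + b *\<^sub>R w \<in> {v. ysel t + \<kappa> t *\<^sub>R v \<in> \<Phi> t (xbar + x)}" using ab by simp
        qed
        moreover have "{v. (x, v) \<in> \<Gamma> t} = cball 0 2 \<inter> {v. ysel t + \<kappa> t *\<^sub>R v \<in> \<Phi> t (xbar + x)}"
          using True by (auto simp: \<Gamma>_def)
        ultimately show ?thesis by (simp add: convex_Int)
      next
        case False
        then show ?thesis by (simp add: \<Gamma>_def)
      qed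
    qed
  qed
  define E where "E = {(\<xi>, b). (xbar + \<xi>, ybar + b) \<in> gph (expected_integral M \<Phi>)}"
  have E: "(x, \<integral>t. v t \<partial>N) \<in> E" if v: "v \<in> borel_measurable N" and mem: "AE t in N. (x, v t) \<in> \<Gamma> t" for x v
  proof -
    have [measurable]: "v \<in> borel_measurable M" using v setsN by (simp cong: measurable_cong_sets)
    have mem': "AE t in M. norm (v t) \<le> 2 \<and> ysel t + \<kappa> t *\<^sub>R v t \<in> \<Phi> t (xbar + x)"
      using mem unfolding AEN by eventually_elim (simp add: \<Gamma>_def)
    have "integrable N v"
      by (rule N.integrable_const_bound[of _ 2]) (use mem' v in \<open>auto simp: AEN\<close>)
    then have "integrable M (\<lambda>t. \<kappa> t *\<^sub>R v t)" by (simp add: integrableN)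
    then have "integrable M (\<lambda>t. ysel t + \<kappa> t *\<^sub>R v t)" "(\<integral>t. ysel t + \<kappa> t *\<^sub>R v t \<partial>M) = ybar + (\<integral>t. v t \<partial>N)"
      using ysint by (simp_all add: intN ysbar)
    moreover have "AE t in M. ysel t + \<kappa> t *\<^sub>R v t \<in> \<Phi> t (xbar + x)" using mem' by eventually_elim simp
    ultimately have "ybar + (\<integral>t. v t \<partial>N) \<in> expected_integral M \<Phi> (xbar + x)"
      unfolding expected_integral_def aumann_integral_def
      by (intro CollectI exI[of _ "\<lambda>t. ysel t + \<kappa> t *\<^sub>R v t"]) simp
    then show ?thesis by (simp add: E_def gph_def)
  qed
  have normalE: "(xstar, - ystar) \<in> regular_normal_cone 0 E"
  proof -
    have *: "(xstar, - ystar) \<in> regular_normal_cone (xbar, ybar) (gph (expected_integral M \<Phi>))"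
      using xstar by (simp add: regular_coderivative_def)
    show ?thesis
      unfolding regular_normal_cone_iff
    proof (intro conjI allI impI)
      show "0 \<in> E" using * by (simp add: regular_normal_cone_iff E_def zero_prod_def)
      fix e :: real assume "e > 0"
      with * obtain d where d: "d > 0" "\<forall>w\<in>gph (expected_integral M \<Phi>). norm (w - (xbar, ybar)) < d \<longrightarrow>
          (xstar, - ystar) \<bullet> (w - (xbar, ybar)) \<le> e * norm (w - (xbar, ybar))"
        unfolding regular_normal_cone_iff by blast
      have "(xstar, - ystar) \<bullet> (w - 0) \<le> e * norm (w - 0)" if "w \<in> E" "norm (w - 0) < d" for w
      proof -
        have "w = (xbar, ybar) + w - (xbar, ybar)" by simp
        moreover have "(xbar, ybar) + w \<in> gph (expected_integral M \<Phi>)" using that(1) by (cases w) (simp add: E_def)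
        ultimately show ?thesis using d(2)[rule_format, of "(xbar, ybar) + w"] that(2) by simp
      qed
      with d(1) show "\<exists>d>0. \<forall>w\<in>E. norm (w - 0) < d \<longrightarrow> (xstar, - ystar) \<bullet> (w - 0) \<le> e * norm (w - 0)" by blast
    qed
  qed
  obtain u v wu wv \<xi> b C p \<Lambda> where C: "C \<ge> 1" and p: "p > 0" and \<Lambda>: "0 < \<Lambda>" "\<Lambda> \<le> \<epsilon>"
    and sel: "(\<lambda>t. (u t, v t)) \<in> selections N \<Gamma>"
    and w: "wu \<in> borel_measurable N" "wv \<in> borel_measurable N"
      "AE t in N. norm (wu t) \<le> \<Lambda> * R \<and> norm (wv t) \<le> \<Lambda> * R"
    and \<xi>: "(\<integral>t. u t \<partial>N) = measure N (space N) *\<^sub>R \<xi>"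
    and C\<xi>: "C * norm \<xi> \<le> 2 * \<epsilon>" and Cb: "C * norm b \<le> 2 * \<epsilon>"
    and v2: "(\<integral>t. (norm (v t))\<^sup>2 \<partial>N) \<le> 2 * \<epsilon>" and u2: "p * (\<integral>t. (norm (u t - \<xi>))\<^sup>2 \<partial>N) \<le> 2 * \<epsilon>\<^sup>2"
    and normals: "AE t in N. - ((- (1 / measure N (space N)) *\<^sub>R xstar + (2 * C / measure N (space N)) *\<^sub>R \<xi> +
        (2 * p) *\<^sub>R (u t - \<xi>) + (2 * \<Lambda>) *\<^sub>R u t - 2 *\<^sub>R wu t,
        ystar + (2 * C) *\<^sub>R b + (2 * \<epsilon> + 2 * \<Lambda>) *\<^sub>R v t - 2 *\<^sub>R wv t)) \<in> regular_normal_cone (u t, v t) (\<Gamma> t)"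
    and close: "AE t in N. (norm (u t - \<xi>))\<^sup>2 \<le> (norm \<xi>)\<^sup>2 + \<epsilon>\<^sup>2"
    by (rule N.penalized_limit[of \<Gamma> R Tpa Tna E xstar ystar \<epsilon>, OF graph _ _ R0 zero decompN convN _ _ normalE \<epsilon>(1)])
      (rule closed, assumption, rule bdd, use K KN in simp, rule E, assumption, assumption, (rule that; assumption))
  note \<xi> = \<xi>[unfolded KN] and normals = normals[unfolded KN AEN] and close = close[unfolded AEN] and w3 = w(3)[unfolded AEN]
  have measN: "f \<in> borel_measurable N \<longleftrightarrow> f \<in> borel_measurable M" for f :: "'t \<Rightarrow> 'b::euclidean_space"
    using setsN by (simp cong: measurable_cong_sets)
  have [measurable]: "wu \<in> borel_measurable M" "wv \<in> borel_measurable M" using w(1,2) by (simp_all add: measN)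
  have uvm: "(\<lambda>t. (u t, v t)) \<in> borel_measurable M" and uv\<Gamma>: "AE t in M. (u t, v t) \<in> \<Gamma> t"
    using sel by (auto simp: selections_def AEN measN)
  have um [measurable]: "u \<in> borel_measurable M"
    using borel_measurable_continuous_on[OF continuous_on_fst[OF continuous_on_id] uvm] by simp
  have vm [measurable]: "v \<in> borel_measurable M"
    using borel_measurable_continuous_on[OF continuous_on_snd[OF continuous_on_id] uvm] by simp
  have n\<xi>: "norm \<xi> \<le> 2 * \<epsilon>"
  proof -
    have "1 * norm \<xi> \<le> C * norm \<xi>" using C by (intro mult_right_mono) auto
    then show ?thesis using C\<xi> by simp
  qed
  \<comment> \<open>\<open>4 * \<epsilon>\<^sup>2 + \<epsilon>\<^sup>2\<close> is rounded up to
    \<open>(3 * \<epsilon>)\<^sup>2\<close>. Together with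
    \<open>norm \<xi> \<le> 2 * \<epsilon>\<close> this gives \<open>5 * \<epsilon>\<close> for
    \<open>u\<close>, which is why \<open>5 * \<epsilon> < \<rho>\<close> is required: the
    truncation at \<open>\<rho>\<close> is then inactive.\<close>
  have close3: "AE t in M. norm (u t - \<xi>) \<le> 3 * \<epsilon>"
    using close
  proof eventually_elim
    case (elim t)
    have "(norm \<xi>)\<^sup>2 \<le> (2 * \<epsilon>)\<^sup>2" using n\<xi> by (intro power_mono) auto
    moreover have "(2 * \<epsilon>)\<^sup>2 = 4 * \<epsilon>\<^sup>2" "(3 * \<epsilon>)\<^sup>2 = 9 * \<epsilon>\<^sup>2" by (simp_all add: power_mult_distrib)
    ultimately have "(norm (u t - \<xi>))\<^sup>2 \<le> (3 * \<epsilon>)\<^sup>2" using elim zero_le_power2[of \<epsilon>] by linarith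
    then show ?case by (rule power2_le_imp_le) (use \<epsilon>(1) in simp)
  qed
  have u5: "AE t in M. norm (u t) \<le> 5 * \<epsilon>"
    using close3
  proof eventually_elim
    case (elim t)
    then show ?case using norm_triangle_sub[of "u t" \<xi>] n\<xi> by linarith
  qed
  have vb: "AE t in M. norm (v t) \<le> 2" using uv\<Gamma> by eventually_elim (simp add: \<Gamma>_def)
  define \<alpha> where "\<alpha> t = - (- (1 / K) *\<^sub>R xstar + (2 * C / K) *\<^sub>R \<xi> + (2 * p) *\<^sub>R (u t - \<xi>) + (2 * \<Lambda>) *\<^sub>R u t - 2 *\<^sub>R wu t)" for t
  define \<beta> where "\<beta> t = ystar + (2 * C) *\<^sub>R b + (2 * \<epsilon> + 2 * \<Lambda>) *\<^sub>R v t - 2 *\<^sub>R wv t" for t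
  have \<alpha>m [measurable]: "\<alpha> \<in> borel_measurable M" and \<beta>m [measurable]: "\<beta> \<in> borel_measurable M"
    unfolding \<alpha>_def[abs_def] \<beta>_def[abs_def] by measurable
  have cod: "AE t in M. \<kappa> t *\<^sub>R \<alpha> t \<in> regular_coderivative (\<Phi> t) (xbar + u t) (ysel t + \<kappa> t *\<^sub>R v t) (\<beta> t)"
    using normals u5 ysR bound
  proof eventually_elim
    case (elim t)
    have "(\<alpha> t, - \<beta> t) \<in> regular_normal_cone (u t, v t) (\<Gamma> t)"
      using elim(1) by (simp only: \<alpha>_def \<beta>_def uminus_Pair)
    then have "(\<kappa> t *\<^sub>R \<alpha> t, - \<beta> t) \<in> regular_normal_cone (xbar + u t, ysel t + \<kappa> t *\<^sub>R v t) (gph (\<Phi> t))"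
      unfolding \<Gamma>_def using elim(2,3,4) \<epsilon>(3) \<kappa>(2)
      by (intro regular_normal_cone_rescale[where \<rho> = \<rho>]) auto
    then show ?case by (simp add: regular_coderivative_def)
  qed
  \<comment> \<open>\<open>A\<close> bounds every part of \<open>\<alpha>\<close> except the penalty
    gradient, independently of \<open>\<epsilon>\<close> and \<open>p\<close>.\<close>
  define A where "A = norm xstar / K + 4 / K + 10 + 2 * R"
  have \<Lambda>1: "\<Lambda> \<le> 1" using \<Lambda> \<epsilon> by linarith
  have \<alpha>A: "AE t in M. norm (\<alpha> t) \<le> A + 2 * p * norm (u t - \<xi>)"
    using u5 w3
  proof eventually_elim
    case (elim t)
    have "norm (\<alpha> t) \<le> norm (- (1 / K) *\<^sub>R xstar) + norm ((2 * C / K) *\<^sub>R \<xi>) + norm ((2 * p) *\<^sub>R (u t - \<xi>)) +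
        norm ((2 * \<Lambda>) *\<^sub>R u t) + norm (2 *\<^sub>R wu t)"
      unfolding \<alpha>_def norm_minus_cancel
      by (intro order_trans[OF norm_triangle_ineq4 add_right_mono] order_trans[OF norm_triangle_ineq add_right_mono] order_refl)
    also have "\<dots> = norm xstar / K + 2 * (C * norm \<xi>) / K + 2 * p * norm (u t - \<xi>) + 2 * (\<Lambda> * norm (u t)) + 2 * norm (wu t)"
      using K C p \<Lambda> by (simp add: mult_ac)
    also have "\<dots> \<le> norm xstar / K + 4 / K + 2 * p * norm (u t - \<xi>) + 2 * 5 + 2 * R"
    proof -
      have "2 * (C * norm \<xi>) / K \<le> 4 / K" using C\<xi> \<epsilon>(2) K by (intro divide_right_mono) auto
      moreover have "\<Lambda> * norm (u t) \<le> 1 * 5" using elim \<Lambda> \<Lambda>1 \<epsilon>(2) by (intro mult_mono) auto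
      moreover have "norm (wu t) \<le> R" using elim \<Lambda>1 R0 mult_right_mono[of \<Lambda> 1 R] by simp
      ultimately show ?thesis by linarith
    qed
    finally show ?case by (simp add: A_def)
  qed
  have A0: "A \<ge> 0" using K R0 by (simp add: A_def)
  \<comment> \<open>This bound involves \<open>p\<close> and serves integrability only.\<close>
  have \<alpha>B: "AE t in M. norm (\<alpha> t) \<le> A + 2 * p * (3 * \<epsilon>)"
    using \<alpha>A close3
  proof eventually_elim
    case (elim t)
    have "2 * p * norm (u t - \<xi>) \<le> 2 * p * (3 * \<epsilon>)" using elim(2) p by (intro mult_left_mono) auto
    then show ?case using elim(1) by linarith
  qed
  have \<alpha>N: "integrable N \<alpha>" using \<alpha>B \<alpha>m by (intro N.integrable_const_bound) (auto simp: AEN measN)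
  have uN: "integrable N u" using u5 um by (intro N.integrable_const_bound) (auto simp: AEN measN)
  have vN: "integrable N v" using vb vm by (intro N.integrable_const_bound) (auto simp: AEN measN)
  have wR: "AE t in M. norm (wu t) \<le> \<epsilon> * R \<and> norm (wv t) \<le> \<epsilon> * R"
    using w3
  proof eventually_elim
    case (elim t)
    have "\<Lambda> * R \<le> \<epsilon> * R" using \<Lambda> R0 by (intro mult_right_mono) auto
    then show ?case using elim by linarith
  qed
  have wuN: "integrable N wu" using wR w(1) by (intro N.integrable_const_bound[of _ "\<epsilon> * R"]) (auto simp: AEN elim: eventually_mono)
  have nint: "norm (integral\<^sup>L N f) \<le> c * K" if "integrable N f" "AE t in M. norm (f t) \<le> c"
    for f :: "'t \<Rightarrow> 'b::euclidean_space" and c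
    using N.norm_integral_le[of f c] that by (simp add: AEN KN)
  have sqN: "integrable N (\<lambda>t. (norm (f t))\<^sup>2)" if "f \<in> borel_measurable M" "AE t in M. norm (f t) \<le> c"
    for f :: "'t \<Rightarrow> 'b::euclidean_space" and c
    using that by (intro N.integrable_norm_square) (auto simp: AEN measN)
  have normN: "(LINT t|M. \<kappa> t * f t) = integral\<^sup>L N f" if "f \<in> borel_measurable M" for f :: "'t \<Rightarrow> real"
    using intN[OF that] by simp
  show ?thesis
  proof (intro exI conjI)
    show "(\<lambda>t. xbar + u t) \<in> Linf M"
    proof (rule Linf_I)
      show "AE t in M. norm (xbar + u t) \<le> norm xbar + 5 * \<epsilon>"
        using u5 by eventually_elim (rule order_trans[OF norm_triangle_ineq], simp)
    qed measurable
    show "integrable M (\<lambda>t. \<kappa> t *\<^sub>R \<alpha> t)" using \<alpha>N \<alpha>m by (simp add: integrableN)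
    show "integrable M (\<lambda>t. ysel t + \<kappa> t *\<^sub>R v t)" using vN vm ysint by (simp add: integrableN)
    have \<beta>c: "AE t in M. norm (\<beta> t - ystar) \<le> (12 + 2 * R) * \<epsilon>"
      using vb wR
    proof eventually_elim
      case (elim t)
      have "\<beta> t - ystar = (2 * C) *\<^sub>R b + (2 * \<epsilon> + 2 * \<Lambda>) *\<^sub>R v t - 2 *\<^sub>R wv t" by (simp add: \<beta>_def)
      then have "norm (\<beta> t - ystar) \<le> norm ((2 * C) *\<^sub>R b) + norm ((2 * \<epsilon> + 2 * \<Lambda>) *\<^sub>R v t) + norm (2 *\<^sub>R wv t)"
        using order_trans[OF norm_triangle_ineq4 add_right_mono[OF norm_triangle_ineq]] by metis
      also have "\<dots> = 2 * (C * norm b) + (2 * \<epsilon> + 2 * \<Lambda>) * norm (v t) + 2 * norm (wv t)"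
        using C \<epsilon> \<Lambda> by simp
      also have "\<dots> \<le> 2 * (2 * \<epsilon>) + (4 * \<epsilon>) * 2 + 2 * (\<epsilon> * R)"
      proof -
        have "(2 * \<epsilon> + 2 * \<Lambda>) * norm (v t) \<le> (4 * \<epsilon>) * 2"
          using elim(1) \<epsilon> \<Lambda> by (intro mult_mono) auto
        then show ?thesis using Cb elim(2) by linarith
      qed
      finally show ?case by (simp add: algebra_simps)
    qed
    show "\<beta> \<in> Linf M"
    proof (rule Linf_I[OF \<beta>m])
      show "AE t in M. norm (\<beta> t) \<le> norm ystar + (12 + 2 * R) * \<epsilon>"
        using \<beta>c
      proof eventually_elim
        case (elim t)
        then show ?case using norm_triangle_sub[of "\<beta> t" ystar] by linarith
      qed
    qed
    show "AE t in M. \<kappa> t *\<^sub>R \<alpha> t \<in> regular_coderivative (\<Phi> t) (xbar + u t) (ysel t + \<kappa> t *\<^sub>R v t) (\<beta> t)"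
      by (rule cod)
    show "norm (xbar - (xbar + \<xi>)) \<le> 2 * \<epsilon>" using n\<xi> by simp
    show "Linf_norm M (\<lambda>t. xbar - (xbar + u t)) \<le> ennreal (5 * \<epsilon>)"
      by (rule Linf_norm_le) (use u5 in auto)
    show "Linf_norm M (\<lambda>t. \<beta> t - ystar) \<le> ennreal ((12 + 2 * R) * \<epsilon>)"
      by (rule Linf_norm_le[OF _ \<beta>c]) measurable
    \<comment> \<open>The splitting parameter \<open>sqrt \<epsilon>\<close> balances the mass term
      against the squared norm, which is at most \<open>2 * \<epsilon>\<close>.\<close>
    show "(LINT t|M. norm (ysel t - (ysel t + \<kappa> t *\<^sub>R v t))) \<le> (K + 2) * sqrt \<epsilon>"
    proof -
      have s: "sqrt \<epsilon> > 0" using \<epsilon> by simp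
      have "(LINT t|M. norm (ysel t - (ysel t + \<kappa> t *\<^sub>R v t))) = (LINT t|M. \<kappa> t * norm (v t))"
        using k0 by (simp add: abs_of_pos)
      also have "\<dots> = (\<integral>t. norm (v t) \<partial>N)" by (rule normN) measurable
      also have "\<dots> \<le> (\<integral>t. sqrt \<epsilon> + (norm (v t))\<^sup>2 / sqrt \<epsilon> \<partial>N)"
      proof (rule integral_mono)
        show "integrable N (\<lambda>t. norm (v t))" using vN by simp
        show "integrable N (\<lambda>t. sqrt \<epsilon> + (norm (v t))\<^sup>2 / sqrt \<epsilon>)" using sqN[OF vm vb] by simp
        show "norm (v t) \<le> sqrt \<epsilon> + (norm (v t))\<^sup>2 / sqrt \<epsilon>" for t
          by (rule le_add_power2_divide[OF s]) simp
      qed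
      also have "\<dots> = sqrt \<epsilon> * K + (\<integral>t. (norm (v t))\<^sup>2 \<partial>N) / sqrt \<epsilon>"
        using sqN[OF vm vb] by (simp add: KN mult_ac)
      also have "\<dots> \<le> sqrt \<epsilon> * K + 2 * \<epsilon> / sqrt \<epsilon>" using v2 s by (intro add_left_mono divide_right_mono) auto
      also have "2 * \<epsilon> / sqrt \<epsilon> = 2 * sqrt \<epsilon>" using \<epsilon> real_div_sqrt[of \<epsilon>] by simp
      finally show ?thesis by (simp add: algebra_simps)
    qed
    show "(LINT t|M. norm (\<kappa> t *\<^sub>R \<alpha> t) * norm ((xbar + u t) - (xbar + \<xi>))) \<le> (3 * (norm xstar / K + 4 / K + 10 + 2 * R) * K + 4) * \<epsilon>"
    proof -
      have "(LINT t|M. norm (\<kappa> t *\<^sub>R \<alpha> t) * norm ((xbar + u t) - (xbar + \<xi>))) = (LINT t|M. \<kappa> t * (norm (\<alpha> t) * norm (u t - \<xi>)))"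
        using k0 by (simp add: abs_of_pos mult.assoc)
      also have "\<dots> = (\<integral>t. norm (\<alpha> t) * norm (u t - \<xi>) \<partial>N)" by (rule normN) measurable
      \<comment> \<open>The bounded part of \<open>\<alpha>\<close> meets the uniform bound
        \<open>3 * \<epsilon>\<close> on the distance; the penalty gradient times the distance is
        twice the penalty integrand.\<close>
      also have "\<dots> \<le> (\<integral>t. A * (3 * \<epsilon>) + 2 * p * (norm (u t - \<xi>))\<^sup>2 \<partial>N)"
      proof (rule integral_mono_AE)
        have ux: "(\<lambda>t. u t - \<xi>) \<in> borel_measurable M" by measurable
        show "integrable N (\<lambda>t. A * (3 * \<epsilon>) + 2 * p * (norm (u t - \<xi>))\<^sup>2)" using sqN[OF ux close3] by simp
        show "integrable N (\<lambda>t. norm (\<alpha> t) * norm (u t - \<xi>))"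
        proof (rule N.integrable_const_bound)
          show "AE t in N. norm (norm (\<alpha> t) * norm (u t - \<xi>)) \<le> (A + 2 * p * (3 * \<epsilon>)) * (3 * \<epsilon>)"
            unfolding AEN using \<alpha>B close3 by eventually_elim (use A0 p \<epsilon> in \<open>auto intro!: mult_mono\<close>)
          show "(\<lambda>t. norm (\<alpha> t) * norm (u t - \<xi>)) \<in> borel_measurable N" unfolding measN by measurable
        qed
        show "AE t in N. norm (\<alpha> t) * norm (u t - \<xi>) \<le> A * (3 * \<epsilon>) + 2 * p * (norm (u t - \<xi>))\<^sup>2"
          unfolding AEN using \<alpha>A close3
        proof eventually_elim
          case (elim t)
          have "norm (\<alpha> t) * norm (u t - \<xi>) \<le> (A + 2 * p * norm (u t - \<xi>)) * norm (u t - \<xi>)"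
            using elim(1) by (intro mult_right_mono) auto
          also have "\<dots> = A * norm (u t - \<xi>) + 2 * p * (norm (u t - \<xi>))\<^sup>2"
            by (simp add: algebra_simps power2_eq_square)
          also have "\<dots> \<le> A * (3 * \<epsilon>) + 2 * p * (norm (u t - \<xi>))\<^sup>2"
            using elim(2) A0 by (intro add_right_mono mult_left_mono) auto
          finally show ?case .
        qed
      qed
      also have "\<dots> = A * (3 * \<epsilon>) * K + 2 * (p * (\<integral>t. (norm (u t - \<xi>))\<^sup>2 \<partial>N))"
      proof -
        have "(\<lambda>t. u t - \<xi>) \<in> borel_measurable M" by measurable
        from sqN[OF this close3] show ?thesis by (simp add: KN mult_ac)
      qed
      also have "\<dots> \<le> A * (3 * \<epsilon>) * K + 2 * (2 * \<epsilon>)"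
      proof -
        have "\<epsilon>\<^sup>2 \<le> \<epsilon>" using \<epsilon> mult_left_mono[of \<epsilon> 1 \<epsilon>] by (simp add: power2_eq_square)
        then show ?thesis using u2 by linarith
      qed
      also have "\<dots> = (3 * A * K + 4) * \<epsilon>" by (simp add: algebra_simps)
      finally show ?thesis unfolding A_def .
    qed
    show "norm ((LINT t|M. \<kappa> t *\<^sub>R \<alpha> t) - xstar) \<le> (4 + 4 * K + 2 * R * K) * \<epsilon>"
    proof -
      have "(LINT t|M. \<kappa> t *\<^sub>R \<alpha> t) = integral\<^sup>L N \<alpha>" using intN[OF \<alpha>m] by simp
      also have "\<dots> = (\<integral>t. (1 / K) *\<^sub>R xstar - (2 * C / K) *\<^sub>R \<xi> - (2 * p) *\<^sub>R (u t - \<xi>) - (2 * \<Lambda>) *\<^sub>R u t + 2 *\<^sub>R wu t \<partial>N)"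
        by (intro Bochner_Integration.integral_cong) (auto simp: \<alpha>_def algebra_simps)
      \<comment> \<open>\<open>u - \<xi>\<close> integrates to zero over \<open>N\<close>, so the
        term with the uncontrolled factor \<open>p\<close> disappears.\<close>
      also have "\<dots> = xstar - (2 * C) *\<^sub>R \<xi> - (2 * \<Lambda>) *\<^sub>R (K *\<^sub>R \<xi>) + 2 *\<^sub>R integral\<^sup>L N wu"
        using uN wuN K by (simp add: KN \<xi> scaleR_diff_right)
      finally have "(LINT t|M. \<kappa> t *\<^sub>R \<alpha> t) - xstar = - ((2 * C) *\<^sub>R \<xi>) - (2 * \<Lambda>) *\<^sub>R (K *\<^sub>R \<xi>) + 2 *\<^sub>R integral\<^sup>L N wu" by simp
      then have "norm ((LINT t|M. \<kappa> t *\<^sub>R \<alpha> t) - xstar) \<le> norm (- ((2 * C) *\<^sub>R \<xi>)) + norm ((2 * \<Lambda>) *\<^sub>R (K *\<^sub>R \<xi>)) + norm (2 *\<^sub>R integral\<^sup>L N wu)"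
        using order_trans[OF norm_triangle_ineq add_right_mono[OF norm_triangle_ineq4]] by metis
      also have "\<dots> = 2 * (C * norm \<xi>) + 2 * (\<Lambda> * (K * norm \<xi>)) + 2 * norm (integral\<^sup>L N wu)"
        using C \<Lambda> K by simp
      also have "\<dots> \<le> 2 * (2 * \<epsilon>) + 2 * (\<epsilon> * (K * 2)) + 2 * (\<epsilon> * R * K)"
      proof -
        have "norm (integral\<^sup>L N wu) \<le> \<epsilon> * R * K"
          by (rule nint[OF wuN]) (use wR in \<open>auto elim: eventually_mono\<close>)
        moreover have "\<Lambda> * (K * norm \<xi>) \<le> \<epsilon> * (K * 2)"
          using \<Lambda> K n\<xi> \<epsilon> by (intro mult_mono mult_left_mono) auto
        ultimately show ?thesis using C\<xi> by linarith
      qed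
      finally show ?thesis by (simp add: algebra_simps)
    qed
  qed
qed

theorem proposition5p2:
  fixes M :: "'t measure"
    and Tpa Tna :: "'t set"
    and \<Phi> :: "'t \<Rightarrow> real^'n \<Rightarrow> (real^'m) set"
    and xbar xbarstar :: "real^'n"
    and ybar ybarstar :: "real^'m"
    and ysel :: "'t \<Rightarrow> real^'m"
    and \<rho> :: real
    and \<kappa> :: "'t \<Rightarrow> real"
  assumes "complete_measure M" and "finite_measure M"
    and "atomic_decomposition M Tpa Tna"
    and "set_valued_normal_integrand M \<Phi>"
    and "xbar \<in> dom_sv (expected_integral M \<Phi>)"
    and "\<rho> > 0"
    and "integrable M \<kappa>" and "AE t in M. \<kappa> t > 0"
    and "AE t in M. t \<in> Tna \<longrightarrow> (\<forall>x\<in>cball xbar \<rho>. convex (\<Phi> t x))"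
    and "AE t in M. \<forall>x\<in>cball xbar \<rho>. \<Phi> t x \<subseteq> cball 0 (\<kappa> t)"
    and "ybar \<in> expected_integral M \<Phi> xbar"
    and "ysel \<in> integral_selections M \<Phi> xbar ybar"
    and "xbarstar \<in> regular_coderivative (expected_integral M \<Phi>) xbar ybar ybarstar"
  shows "\<exists>(x :: nat \<Rightarrow> real^'n)
          (xs :: nat \<Rightarrow> 't \<Rightarrow> real^'n) (xsstar :: nat \<Rightarrow> 't \<Rightarrow> real^'n)
          (ys :: nat \<Rightarrow> 't \<Rightarrow> real^'m) (ysstar :: nat \<Rightarrow> 't \<Rightarrow> real^'m).
      (\<forall>k. xs k \<in> Linf M \<and> integrable M (xsstar k) \<and>
           integrable M (ys k) \<and> ysstar k \<in> Linf M) \<and>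
      (\<forall>k. AE t in M. xsstar k t \<in> regular_coderivative (\<Phi> t) (xs k t) (ys k t) (ysstar k t)) \<and>
      (\<lambda>k. norm (xbar - x k)) \<longlonglongrightarrow> 0 \<and>
      (\<lambda>k. Linf_norm M (\<lambda>t. xbar - xs k t)) \<longlonglongrightarrow> 0 \<and>
      (\<lambda>k. LINT t|M. norm (ysel t - ys k t)) \<longlonglongrightarrow> 0 \<and>
      (\<lambda>k. Linf_norm M (\<lambda>t. ysstar k t - ybarstar)) \<longlonglongrightarrow> 0 \<and>
      (\<lambda>k. LINT t|M. norm (xsstar k t) * norm (xs k t - x k)) \<longlonglongrightarrow> 0 \<and>
      (\<lambda>k. LINT t|M. xsstar k t) \<longlonglongrightarrow> xbarstar"
proof (cases "measure M (space M) = 0")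
  \<comment> \<open>A null space is treated separately, because the means divide by
    \<open>K\<close>. There every property holds almost everywhere and the integral mapping contains
    0 at each \<open>x\<close>, which forces \<open>xbarstar = 0\<close> and \<open>ybar = 0\<close>
    in the coderivative inclusion; constant sequences then do.\<close>
  interpret M: finite_measure M by fact
  case True
  then have "space M \<in> null_sets M" by (simp add: null_sets_def M.emeasure_eq_measure)
  then have AE: "AE t in M. P t" for P by (rule AE_I') auto
  have int0: "integral\<^sup>L M f = 0" for f :: "'t \<Rightarrow> 'b::{banach, second_countable_topology}"
    using integral_eq_zero_AE[OF AE] .
  have "ybar = 0" using assms(12) int0[of ysel] by (simp add: integral_selections_def)
  have mem: "0 \<in> expected_integral M \<Phi> x" for x
    unfolding expected_integral_def aumann_integral_def
    using AE int0[of "\<lambda>_. 0 :: real^'m"] by (intro CollectI exI[of _ "\<lambda>_. 0"]) simp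
  have "norm xbarstar \<le> e" if "e > 0" for e
  proof -
    obtain d where d: "d > 0" "\<forall>w\<in>gph (expected_integral M \<Phi>). norm (w - (xbar, ybar)) < d \<longrightarrow>
        (xbarstar, - ybarstar) \<bullet> (w - (xbar, ybar)) \<le> e * norm (w - (xbar, ybar))"
      using assms(13) \<open>e > 0\<close> unfolding regular_coderivative_def regular_normal_cone_iff by blast
    show ?thesis
    proof (cases "xbarstar = 0")
      case False
      \<comment> \<open>The test displacement along \<open>xbarstar\<close> has norm
        \<open>d / 2\<close>.\<close>
      define s where "s = d / (2 * norm xbarstar)"
      have s: "s > 0" "s * norm xbarstar < d" using d(1) False by (auto simp: s_def)
      have "(xbar + s *\<^sub>R xbarstar, 0) \<in> gph (expected_integral M \<Phi>)" using mem by (simp add: gph_def)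
      then have "s * (norm xbarstar)\<^sup>2 \<le> e * (s * norm xbarstar)"
        using d(2) s \<open>ybar = 0\<close> by (force simp: norm_Pair power2_norm_eq_inner)
      then show ?thesis using s(1) False by (simp add: power2_eq_square)
    qed (use \<open>e > 0\<close> in simp)
  qed
  then have "xbarstar = 0" by (meson dense_ge norm_le_zero_iff)
  have Linf: "f \<in> Linf M" if "f \<in> borel_measurable M" for f :: "'t \<Rightarrow> 'b::real_normed_vector"
    using that Linf_norm_le[OF that AE[of "\<lambda>t. norm (f t) \<le> 0"]] by (auto simp: Linf_def intro: le_less_trans)
  have Linf0: "Linf_norm M (\<lambda>_. 0 :: real^'n) = 0" "Linf_norm M (\<lambda>_. 0 :: real^'m) = 0"
    using Linf_norm_le[of "\<lambda>_. 0 :: real^'n" M 0] Linf_norm_le[of "\<lambda>_. 0 :: real^'m" M 0] by simp_all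
  show ?thesis
  proof (intro exI conjI)
    show "\<forall>k::nat. (\<lambda>_. xbar) \<in> Linf M \<and> integrable M (\<lambda>_. 0 :: real^'n) \<and> integrable M ysel \<and> (\<lambda>_. ybarstar) \<in> Linf M"
      using assms(12) by (auto simp: integral_selections_def intro: Linf)
    show "\<forall>k::nat. AE t in M. 0 \<in> regular_coderivative (\<Phi> t) xbar (ysel t) ybarstar" using AE by blast
    show "(\<lambda>k::nat. norm (xbar - xbar)) \<longlonglongrightarrow> 0" by simp
  qed (use \<open>xbarstar = 0\<close> Linf0 in simp_all)
next
  interpret M: finite_measure M by fact
  case False
  \<comment> \<open>The rescaling requires a factor that is at least 1 at every point, not just
    positive almost everywhere; enlarging \<open>\<kappa>\<close> preserves the bound on the
    values.\<close>
  define \<kappa>' where "\<kappa>' t = max (\<kappa> t) 0 + 1" for t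
  have \<kappa>': "integrable M \<kappa>'" "\<And>t. \<kappa>' t \<ge> 1" "\<And>t. \<kappa> t \<le> \<kappa>' t"
    using \<open>integrable M \<kappa>\<close> by (auto simp: \<kappa>'_def[abs_def])
  define K where "K = (LINT t|M. \<kappa>' t)"
  have "0 < measure M (space M)" using False by (simp add: zero_less_measure_iff)
  also have "measure M (space M) = (LINT t|M. 1)" by simp
  also have "\<dots> \<le> K" unfolding K_def using \<kappa>' by (intro integral_mono) auto
  finally have "K > 0" .
  have bound: "AE t in M. \<forall>x\<in>cball xbar \<rho>. \<Phi> t x \<subseteq> cball 0 (\<kappa>' t)"
    using assms(10) by eventually_elim (use \<kappa>'(3) subset_cball in \<open>blast intro: order_trans\<close>)
  define B1 where "B1 = (12 + 2 * (\<rho> + 2))"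
  define B2 where "B2 = 3 * (norm xbarstar / K + 4 / K + 10 + 2 * (\<rho> + 2)) * K + 4"
  define B3 where "B3 = 4 + 4 * K + 2 * (\<rho> + 2) * K"
  \<comment> \<open>The cap \<open>\<rho> / 6\<close> keeps \<open>5 * \<epsilon> k\<close> strictly
    below \<open>\<rho>\<close>.\<close>
  define \<epsilon> where "\<epsilon> k = min 1 (\<rho> / 6) * (1 / real (Suc k))" for k
  have "\<epsilon> \<longlonglongrightarrow> min 1 (\<rho> / 6) * 0"
    unfolding \<epsilon>_def using LIMSEQ_inverse_real_of_nat by (intro tendsto_mult_left) (simp add: inverse_eq_divide)
  then have \<epsilon>0: "\<epsilon> \<longlonglongrightarrow> 0" by simp
  have \<epsilon>: "0 < \<epsilon> k" "\<epsilon> k \<le> 1" "5 * \<epsilon> k < \<rho>" for k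
  proof -
    show "0 < \<epsilon> k" using \<open>\<rho> > 0\<close> by (simp add: \<epsilon>_def)
    have "\<epsilon> k \<le> min 1 (\<rho> / 6) * 1" unfolding \<epsilon>_def using \<open>\<rho> > 0\<close> by (intro mult_left_mono) auto
    then show "\<epsilon> k \<le> 1" "5 * \<epsilon> k < \<rho>" using \<open>\<rho> > 0\<close> by linarith+
  qed
  define P where "P k x xs xsstar ys ysstar \<longleftrightarrow>
      xs \<in> Linf M \<and> integrable M xsstar \<and> integrable M ys \<and> ysstar \<in> Linf M \<and>
      (AE t in M. xsstar t \<in> regular_coderivative (\<Phi> t) (xs t) (ys t) (ysstar t)) \<and>
      norm (xbar - x) \<le> 2 * \<epsilon> k \<and>
      Linf_norm M (\<lambda>t. xbar - xs t) \<le> ennreal (5 * \<epsilon> k) \<and>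
      (LINT t|M. norm (ysel t - ys t)) \<le> (K + 2) * sqrt (\<epsilon> k) \<and>
      Linf_norm M (\<lambda>t. ysstar t - ybarstar) \<le> ennreal (B1 * \<epsilon> k) \<and>
      (LINT t|M. norm (xsstar t) * norm (xs t - x)) \<le> B2 * \<epsilon> k \<and>
      norm ((LINT t|M. xsstar t) - xbarstar) \<le> B3 * \<epsilon> k" for k x xs xsstar ys ysstar
  have "\<exists>x xs xsstar ys ysstar. P k x xs xsstar ys ysstar" for k
    unfolding P_def B1_def B2_def B3_def K_def
    by (rule approximate_coderivatives[OF assms(2,3,4,6) \<kappa>'(1,2) assms(9) bound assms(12,13) \<open>K > 0\<close>[unfolded K_def] \<epsilon>])
  then obtain x xs xsstar ys ysstar where P: "\<And>k. P k (x k) (xs k) (xsstar k) (ys k) (ysstar k)" by metis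
  note P' = P[unfolded P_def]
  have lim: "(\<lambda>k. c * \<epsilon> k) \<longlonglongrightarrow> 0" for c using tendsto_mult_left[OF \<epsilon>0, of c] by simp
  have liml: "(\<lambda>k. ennreal (c * \<epsilon> k)) \<longlonglongrightarrow> 0" for c using tendsto_ennrealI[OF lim[of c]] by simp
  have lims: "(\<lambda>k. c * sqrt (\<epsilon> k)) \<longlonglongrightarrow> 0" for c using tendsto_mult_left[OF tendsto_real_sqrt[OF \<epsilon>0], of c] by simp
  show ?thesis
  proof (intro exI conjI)
    show "\<forall>k. xs k \<in> Linf M \<and> integrable M (xsstar k) \<and> integrable M (ys k) \<and> ysstar k \<in> Linf M"
      using P' by blast
    show "\<forall>k. AE t in M. xsstar k t \<in> regular_coderivative (\<Phi> t) (xs k t) (ys k t) (ysstar k t)"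
      using P' by blast
    show "(\<lambda>k. norm (xbar - x k)) \<longlonglongrightarrow> 0"
      by (rule tendsto_sandwich[OF _ _ tendsto_const lim[of 2]]) (use P' in auto)
    show "(\<lambda>k. Linf_norm M (\<lambda>t. xbar - xs k t)) \<longlonglongrightarrow> 0"
      by (rule tendsto_sandwich[OF _ _ tendsto_const liml[of 5]]) (use P' in auto)
    show "(\<lambda>k. LINT t|M. norm (ysel t - ys k t)) \<longlonglongrightarrow> 0"
      by (rule tendsto_sandwich[OF _ _ tendsto_const lims[of "K + 2"]]) (use P' in auto)
    show "(\<lambda>k. Linf_norm M (\<lambda>t. ysstar k t - ybarstar)) \<longlonglongrightarrow> 0"
      by (rule tendsto_sandwich[OF _ _ tendsto_const liml[of B1]]) (use P' in auto)
    show "(\<lambda>k. LINT t|M. norm (xsstar k t) * norm (xs k t - x k)) \<longlonglongrightarrow> 0"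
      by (rule tendsto_sandwich[OF _ _ tendsto_const lim[of B2]]) (use P' in auto)
    have "(\<lambda>k. norm ((LINT t|M. xsstar k t) - xbarstar)) \<longlonglongrightarrow> 0"
      by (rule tendsto_sandwich[OF _ _ tendsto_const lim[of B3]]) (use P' in auto)
    then show "(\<lambda>k. LINT t|M. xsstar k t) \<longlonglongrightarrow> xbarstar"
      using LIM_zero_cancel tendsto_norm_zero_iff by blast
  qed
qed

end
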